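(* Let $k$ be a field, $n$ a positive integer, $q\in k^\times$ arbitrary, and $A=\mathcal{O}_q(M_n(k))$. The standard products $[T\mid T']$, as $(T,T')$ runs over all standard bitableaux, form a $k$-basis for $A$.
   Context: $A=\mathcal{O}_q(M_n(k))$ is the $k$-algebra with generators $X_{ij}$ ($1\le i,j\le n$) and relations $X_{ij}X_{lj}=qX_{lj}X_{ij}$ for $i<l$; $X_{ij}X_{im}=qX_{im}X_{ij}$ for $j<m$; $X_{ij}X_{lm}=X_{lm}X_{ij}$ for $i<l$, $j>m$; $X_{ij}X_{lm}-X_{lm}X_{ij}=(q-q^{-1})X_{im}X_{lj}$ for $i<l$, $j<m$. For subsets $I=\{i_1<\cdots<i_s\}$, $J=\{j_1<\cdots<j_s\}$ of $\{1,\dots,n\}$ of the same cardinality, the quantum minor is $[I\mid J]=\sum_{\sigma\in S_s}(-q)^{\ell(\sigma)}X_{i_1j_{\sigma(1)}}\cdots X_{i_sj_{\sigma(s)}}$. A tableau is a Young diagram (left-justified rows of weakly decreasing lengths, possibly empty) with an entry in each box; here entries are in $\{1,\dots,n\}$. A tableau is increasing if all its rows are strictly increasing (left to right) and all its columns are nondecreasing (top to bottom). A bitableau is a pair $(T,T')$ of tableaux of the same shape; it is standard if $T$ and $T'$ are both increasing. If the $j$-th rows of $T$ and $T'$ have entry sets $I_j$ and $J_j$ ($j=1,\dots,l$), then $[T\mid T']=[I_1\mid J_1][I_2\mid J_2]\cdots[I_l\mid J_l]$ (equal to $1$ for the empty bitableau); it is called a standard product when $(T,T')$ is standard. *)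

theory Defs
  imports
    "Jordan_Normal_Form.VS_Connect"
    "HOL-Algebra.QuotRing"
    "HOL-Combinatorics.Permutations"
    "HOL-Library.Poly_Mapping"
begin

section \<open>The free algebra on generators indexed by pairs\<close>

text \<open>
  The letter \<open>(i, j)\<close> stands for the generator \<open>X\<^sub>i\<^sub>j\<close>.  Words form the free monoid, written
  additively so that finitely supported functions on words carry the convolution product of
  \<^theory>\<open>HOL-Library.Poly_Mapping\<close>, i.e. the product of noncommutative polynomials.
\<close>

datatype nc_word = NC_Word (letters: "(nat \<times> nat) list")

instantiation nc_word :: monoid_add
begin

definition zero_nc_word :: nc_word
  where "0 = NC_Word []"

definition plus_nc_word :: "nc_word \<Rightarrow> nc_word \<Rightarrow> nc_word"
  where "v + w = NC_Word (letters v @ letters w)"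

instance
  by standard (auto simp: zero_nc_word_def plus_nc_word_def)

end

type_synonym 'k nc_poly = "nc_word \<Rightarrow>\<^sub>0 'k"

definition nc_const :: "'k::field \<Rightarrow> 'k nc_poly"
  where "nc_const c = Poly_Mapping.single 0 c"

definition nc_var :: "nat \<Rightarrow> nat \<Rightarrow> 'k::field nc_poly"
  where "nc_var i j = Poly_Mapping.single (NC_Word [(i, j)]) 1"

definition free_alg :: "nat \<Rightarrow> 'k::field nc_poly ring"
  where "free_alg n =
    \<lparr>carrier = {p. \<forall>w \<in> Poly_Mapping.keys p. set (letters w) \<subseteq> {1..n} \<times> {1..n}},
     mult = (*), one = 1, zero = 0, add = (+)\<rparr>"


section \<open>Quantum matrices\<close>

definition qmat_rels :: "nat \<Rightarrow> 'k::field \<Rightarrow> 'k nc_poly set"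
  where "qmat_rels n q =
    {nc_var i j * nc_var l j - nc_const q * (nc_var l j * nc_var i j) | i l j.
       i \<in> {1..n} \<and> l \<in> {1..n} \<and> j \<in> {1..n} \<and> i < l} \<union>
    {nc_var i j * nc_var i m - nc_const q * (nc_var i m * nc_var i j) | i j m.
       i \<in> {1..n} \<and> j \<in> {1..n} \<and> m \<in> {1..n} \<and> j < m} \<union>
    {nc_var i j * nc_var l m - nc_var l m * nc_var i j | i j l m.
       i \<in> {1..n} \<and> j \<in> {1..n} \<and> l \<in> {1..n} \<and> m \<in> {1..n} \<and> i < l \<and> j > m} \<union>
    {nc_var i j * nc_var l m - nc_var l m * nc_var i j
       - nc_const (q - inverse q) * (nc_var i m * nc_var l j) | i j l m.
       i \<in> {1..n} \<and> j \<in> {1..n} \<and> l \<in> {1..n} \<and> m \<in> {1..n} \<and> i < l \<and> j < m}"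

definition qmat_ideal :: "nat \<Rightarrow> 'k::field \<Rightarrow> 'k nc_poly set"
  where "qmat_ideal n q = Idl\<^bsub>free_alg n\<^esub> (qmat_rels n q)"

definition qmat_proj :: "nat \<Rightarrow> 'k::field \<Rightarrow> 'k nc_poly \<Rightarrow> 'k nc_poly set"
  where "qmat_proj n q p = qmat_ideal n q +>\<^bsub>free_alg n\<^esub> p"

text \<open>
  The quotient ring of the free algebra, with the scalar \<open>c\<close> acting as multiplication by the
  residue class of the constant polynomial \<open>c\<close>.  The record type \<open>module\<close> is a ring together
  with a scalar multiplication, so it also serves for (noncommutative) algebras.
\<close>

definition qmat :: "nat \<Rightarrow> 'k::field \<Rightarrow> ('k, 'k nc_poly set) module"
  where "qmat n q = (let Q = free_alg n Quot qmat_ideal n q in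
    \<lparr>carrier = carrier Q, mult = mult Q, one = one Q, zero = zero Q, add = add Q,
     smult = (\<lambda>c x. qmat_proj n q (nc_const c) \<otimes>\<^bsub>Q\<^esub> x)\<rparr>)"

definition qmat_gen :: "nat \<Rightarrow> 'k::field \<Rightarrow> nat \<Rightarrow> nat \<Rightarrow> 'k nc_poly set"
  where "qmat_gen n q i j = qmat_proj n q (nc_var i j)"

definition qmat_prod_list :: "nat \<Rightarrow> 'k::field \<Rightarrow> 'k nc_poly set list \<Rightarrow> 'k nc_poly set"
  where "qmat_prod_list n q xs = foldr (mult (qmat n q)) xs \<one>\<^bsub>qmat n q\<^esub>"


section \<open>Quantum minors\<close>

text \<open>The length of a permutation of \<open>{0, \<dots>, s - 1}\<close> is its number of inversions.\<close>

definition perm_length :: "nat \<Rightarrow> (nat \<Rightarrow> nat) \<Rightarrow> nat"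
  where "perm_length s \<sigma> = card {(a, b). a < b \<and> b < s \<and> \<sigma> b < \<sigma> a}"

text \<open>Positions are counted from \<open>0\<close>; meaningful for finite \<open>I\<close> and \<open>J\<close> of equal cardinality.\<close>

definition quantum_minor :: "nat \<Rightarrow> 'k::field \<Rightarrow> nat set \<Rightarrow> nat set \<Rightarrow> 'k nc_poly set"
  where "quantum_minor n q I J =
    (\<Oplus>\<^bsub>qmat n q\<^esub>\<sigma>\<in>{\<sigma>. \<sigma> permutes {..<card I}}.
       (- q) ^ perm_length (card I) \<sigma> \<odot>\<^bsub>qmat n q\<^esub>
       qmat_prod_list n q
         (map (\<lambda>a. qmat_gen n q (sorted_list_of_set I ! a) (sorted_list_of_set J ! \<sigma> a))
              [0..<card I]))"


section \<open>Bitableaux\<close>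

text \<open>A tableau is the list of its rows, top to bottom; rows are required to be nonempty so that
  each Young diagram has exactly one representation (the empty diagram being \<open>[]\<close>).\<close>

definition tableau :: "nat \<Rightarrow> nat list list \<Rightarrow> bool"
  where "tableau n T \<longleftrightarrow>
    (\<forall>r \<in> set T. r \<noteq> [] \<and> set r \<subseteq> {1..n}) \<and> sorted_wrt (\<ge>) (map length T)"

definition tableau_shape :: "nat list list \<Rightarrow> nat list"
  where "tableau_shape T = map length T"

definition increasing_tableau :: "nat list list \<Rightarrow> bool"
  where "increasing_tableau T \<longleftrightarrow>
    (\<forall>r \<in> set T. sorted_wrt (<) r) \<and>
    (\<forall>i i' j. i < i' \<and> i' < length T \<and> j < length (T ! i') \<longrightarrow> T ! i ! j \<le> T ! i' ! j)"

definition bitableaux :: "nat \<Rightarrow> (nat list list \<times> nat list list) set"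
  where "bitableaux n =
    {(T, T'). tableau n T \<and> tableau n T' \<and> tableau_shape T = tableau_shape T'}"

definition standard_bitableaux :: "nat \<Rightarrow> (nat list list \<times> nat list list) set"
  where "standard_bitableaux n =
    {(T, T') \<in> bitableaux n. increasing_tableau T \<and> increasing_tableau T'}"

definition bitableau_product ::
  "nat \<Rightarrow> 'k::field \<Rightarrow> nat list list \<times> nat list list \<Rightarrow> 'k nc_poly set"
  where "bitableau_product n q = (\<lambda>(T, T').
    qmat_prod_list n q (map2 (\<lambda>r r'. quantum_minor n q (set r) (set r')) T T'))"


section \<open>Well-definedness\<close>

lemma free_alg_simps:
  "mult (free_alg n) = (*)" "one (free_alg n) = 1" "add (free_alg n) = (+)"
  "zero (free_alg n) = 0"
  by (simp_all add: free_alg_def)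

lemma keys_nc_mult:
  fixes p p' :: "'k::field nc_poly"
  assumes "w \<in> Poly_Mapping.keys (p * p')"
  obtains u v where "u \<in> Poly_Mapping.keys p" "v \<in> Poly_Mapping.keys p'" "w = u + v"
  using assms keys_mult[of p p'] by blast

lemma free_alg_ring: "ring (free_alg n :: 'k::field nc_poly ring)"
proof (rule ringI)
  let ?F = "free_alg n :: 'k nc_poly ring"
  show "abelian_group ?F"
  proof (rule abelian_groupI)
    fix p p' assume "p \<in> carrier ?F" "p' \<in> carrier ?F"
    then show "p \<oplus>\<^bsub>?F\<^esub> p' \<in> carrier ?F"
      using Poly_Mapping.keys_add[of p p'] by (auto simp: free_alg_def)
  next
    fix p assume "p \<in> carrier ?F"
    then show "\<exists>p' \<in> carrier ?F. p' \<oplus>\<^bsub>?F\<^esub> p = \<zero>\<^bsub>?F\<^esub>"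
      by (intro bexI[of _ "- p"]) (auto simp: free_alg_def in_keys_iff)
  qed (auto simp: free_alg_def ac_simps)
  show "Group.monoid ?F"
  proof (rule monoidI)
    fix p p' assume p: "p \<in> carrier ?F" "p' \<in> carrier ?F"
    show "p \<otimes>\<^bsub>?F\<^esub> p' \<in> carrier ?F"
      unfolding free_alg_def
    proof (simp, intro ballI)
      fix w assume "w \<in> Poly_Mapping.keys (p * p')"
      then obtain u v where "u \<in> Poly_Mapping.keys p" "v \<in> Poly_Mapping.keys p'" "w = u + v"
        by (rule keys_nc_mult)
      with p show "set (letters w) \<subseteq> {Suc 0..n} \<times> {Suc 0..n}"
        by (fastforce simp: free_alg_def plus_nc_word_def)
    qed
  qed (auto simp: free_alg_def zero_nc_word_def mult.assoc)
qed (auto simp: free_alg_def algebra_simps)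

lemma nc_const_carrier [simp]: "nc_const c \<in> carrier (free_alg n)"
  by (auto simp: free_alg_def nc_const_def zero_nc_word_def)

lemma nc_var_carrier [simp]:
  "i \<in> {1..n} \<Longrightarrow> j \<in> {1..n} \<Longrightarrow> nc_var i j \<in> carrier (free_alg n)"
  by (auto simp: free_alg_def nc_var_def)

lemma nc_minus_carrier:
  assumes "p \<in> carrier (free_alg n)" "p' \<in> carrier (free_alg n)"
  shows "p - p' \<in> carrier (free_alg n)"
  using assms keys_diff[of p p'] by (auto simp: free_alg_def)

lemma nc_mult_carrier:
  assumes "p \<in> carrier (free_alg n)" "p' \<in> carrier (free_alg n)"
  shows "p * p' \<in> carrier (free_alg n)"
  using ring.ring_simprules(5)[OF free_alg_ring assms] by (simp add: free_alg_def)

lemma qmat_rels_carrier: "qmat_rels n q \<subseteq> carrier (free_alg n)"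
  unfolding qmat_rels_def
  by (auto intro!: nc_minus_carrier nc_mult_carrier)

lemma qmat_ideal: "ideal (qmat_ideal n q) (free_alg n)"
  unfolding qmat_ideal_def by (rule ring.genideal_ideal[OF free_alg_ring qmat_rels_carrier])

lemma nc_const_comm: "nc_const c * p = p * nc_const c"
proof (induction p rule: update_induct)
  case const
  then show ?case by simp
next
  case (update f a b)
  have "Poly_Mapping.update a b f = f + Poly_Mapping.single a b"
    using update by (intro poly_mapping_eqI)
      (auto simp: lookup_update lookup_add lookup_single in_keys_iff when_def)
  moreover have "nc_const c * Poly_Mapping.single a b = Poly_Mapping.single a b * nc_const c"
    by (simp add: nc_const_def mult_single mult.commute)
  ultimately show ?case using update by (simp add: distrib_left distrib_right)
qed

lemma qmat_simps:
  "carrier (qmat n q) = carrier (free_alg n Quot qmat_ideal n q)"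
  "mult (qmat n q) = mult (free_alg n Quot qmat_ideal n q)"
  "one (qmat n q) = one (free_alg n Quot qmat_ideal n q)"
  "zero (qmat n q) = zero (free_alg n Quot qmat_ideal n q)"
  "add (qmat n q) = add (free_alg n Quot qmat_ideal n q)"
  "c \<odot>\<^bsub>qmat n q\<^esub> x = qmat_proj n q (nc_const c) \<otimes>\<^bsub>qmat n q\<^esub> x"
  by (simp_all add: qmat_def Let_def)

lemma qmat_ring: "ring (qmat n q)"
proof -
  have Q: "ring (free_alg n Quot qmat_ideal n q)"
    by (rule ideal.quotient_is_ring[OF qmat_ideal])
  interpret Q: ring "free_alg n Quot qmat_ideal n q" by (rule Q)
  show ?thesis
  proof (rule ringI)
    show "abelian_group (qmat n q)"
      by (rule abelian_groupI)
        (auto simp: qmat_simps Q.add.m_ac Q.l_neg intro: Q.a_inv_closed)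
    show "Group.monoid (qmat n q)"
      by (rule monoidI) (auto simp: qmat_simps Q.m_assoc)
  qed (auto simp: qmat_simps Q.l_distr Q.r_distr)
qed

lemma qmat_proj_carrier:
  assumes "p \<in> carrier (free_alg n)"
  shows "qmat_proj n q p \<in> carrier (qmat n q)"
  using Ring.ring_hom_closed[OF ideal.rcos_ring_hom[OF qmat_ideal[of n q]] assms]
  by (simp add: qmat_simps qmat_proj_def)

lemma qmat_proj_hom:
  assumes "p \<in> carrier (free_alg n)" "p' \<in> carrier (free_alg n)"
  shows "qmat_proj n q (p * p') = qmat_proj n q p \<otimes>\<^bsub>qmat n q\<^esub> qmat_proj n q p'"
    and "qmat_proj n q (p + p') = qmat_proj n q p \<oplus>\<^bsub>qmat n q\<^esub> qmat_proj n q p'"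
  using Ring.ring_hom_mult[OF ideal.rcos_ring_hom[OF qmat_ideal[of n q]] assms]
    Ring.ring_hom_add[OF ideal.rcos_ring_hom[OF qmat_ideal[of n q]] assms]
  by (simp_all add: qmat_simps qmat_proj_def free_alg_simps)

lemma qmat_proj_one: "qmat_proj n q 1 = \<one>\<^bsub>qmat n q\<^esub>"
  using Ring.ring_hom_one[OF ideal.rcos_ring_hom[OF qmat_ideal[of n q]]]
  by (simp add: qmat_simps qmat_proj_def free_alg_simps)

lemma qmat_proj_surj:
  assumes "x \<in> carrier (qmat n q)"
  obtains p where "p \<in> carrier (free_alg n)" "x = qmat_proj n q p"
  using assms by (auto simp: qmat_simps FactRing_def A_RCOSETS_def' qmat_proj_def)

lemma qmat_smult_assoc:
  assumes "x \<in> carrier (qmat n q)" "y \<in> carrier (qmat n q)"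
  shows "(c \<odot>\<^bsub>qmat n q\<^esub> x) \<otimes>\<^bsub>qmat n q\<^esub> y = c \<odot>\<^bsub>qmat n q\<^esub> (x \<otimes>\<^bsub>qmat n q\<^esub> y)"
    and "x \<otimes>\<^bsub>qmat n q\<^esub> (c \<odot>\<^bsub>qmat n q\<^esub> y) = c \<odot>\<^bsub>qmat n q\<^esub> (x \<otimes>\<^bsub>qmat n q\<^esub> y)"
proof -
  interpret ring "qmat n q" by (rule qmat_ring)
  have C: "qmat_proj n q (nc_const c) \<in> carrier (qmat n q)"
    by (simp add: qmat_proj_carrier)
  obtain p where p: "p \<in> carrier (free_alg n)" "x = qmat_proj n q p"
    using assms(1) by (rule qmat_proj_surj)
  have comm: "qmat_proj n q (nc_const c) \<otimes>\<^bsub>qmat n q\<^esub> x = x \<otimes>\<^bsub>qmat n q\<^esub> qmat_proj n q (nc_const c)"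
    using p by (metis nc_const_comm nc_const_carrier qmat_proj_hom(1))
  show "(c \<odot>\<^bsub>qmat n q\<^esub> x) \<otimes>\<^bsub>qmat n q\<^esub> y = c \<odot>\<^bsub>qmat n q\<^esub> (x \<otimes>\<^bsub>qmat n q\<^esub> y)"
    using assms C by (simp only: qmat_simps(6) m_assoc)
  show "x \<otimes>\<^bsub>qmat n q\<^esub> (c \<odot>\<^bsub>qmat n q\<^esub> y) = c \<odot>\<^bsub>qmat n q\<^esub> (x \<otimes>\<^bsub>qmat n q\<^esub> y)"
    using assms C by (simp only: qmat_simps(6) m_assoc[symmetric] comm)
qed

lemma qmat_vectorspace: "vectorspace (class_ring :: 'k::field ring) (qmat n q)"
proof -
  interpret ring "qmat n q" by (rule qmat_ring)
  have C: "qmat_proj n q (nc_const c) \<in> carrier (qmat n q)" for c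
    by (simp add: qmat_proj_carrier)
  have cadd: "nc_const (a + b) = nc_const a + nc_const b" for a b :: 'k
    by (simp add: nc_const_def single_add)
  have cmult: "nc_const (a * b) = nc_const a * nc_const b" for a b :: 'k
    by (simp add: nc_const_def mult_single)
  have cone: "nc_const (1::'k) = 1"
    by (simp add: nc_const_def)
  have "Module.module (class_ring :: 'k ring) (qmat n q)"
  proof (rule moduleI)
    show "cring (class_ring :: 'k ring)" by (rule class_cring.cring_axioms)
    show "abelian_group (qmat n q)" by (rule abelian_group_axioms)
    fix a b :: 'k and x y assume x: "x \<in> carrier (qmat n q)"
    show "a \<odot>\<^bsub>qmat n q\<^esub> x \<in> carrier (qmat n q)"
      using C x by (simp add: qmat_simps(6))
    show "(a \<oplus>\<^bsub>class_ring\<^esub> b) \<odot>\<^bsub>qmat n q\<^esub> x =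
        (a \<odot>\<^bsub>qmat n q\<^esub> x) \<oplus>\<^bsub>qmat n q\<^esub> (b \<odot>\<^bsub>qmat n q\<^esub> x)"
      using C x by (simp add: qmat_simps(6) cadd qmat_proj_hom(2) l_distr)
    show "(a \<otimes>\<^bsub>class_ring\<^esub> b) \<odot>\<^bsub>qmat n q\<^esub> x = a \<odot>\<^bsub>qmat n q\<^esub> (b \<odot>\<^bsub>qmat n q\<^esub> x)"
      using C x by (simp add: qmat_simps(6) cmult qmat_proj_hom(1) m_assoc)
    have "qmat_proj n q (nc_const 1) = \<one>\<^bsub>qmat n q\<^esub>"
      by (simp add: cone qmat_proj_one)
    then show "\<one>\<^bsub>class_ring\<^esub> \<odot>\<^bsub>qmat n q\<^esub> x = x"
      using x by (simp add: qmat_simps(6))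
    assume y: "y \<in> carrier (qmat n q)"
    show "a \<odot>\<^bsub>qmat n q\<^esub> (x \<oplus>\<^bsub>qmat n q\<^esub> y) =
        (a \<odot>\<^bsub>qmat n q\<^esub> x) \<oplus>\<^bsub>qmat n q\<^esub> (a \<odot>\<^bsub>qmat n q\<^esub> y)"
      using C x y by (simp add: qmat_simps(6) r_distr)
  qed
  then show ?thesis
    by (intro vectorspace.intro class_field)
qed

end

theory Submission
  imports Defs "HOL-Library.Product_Lexorder"
begin

text \<open>
  Independence. In a matrix \<open>Z = X Y\<close> over a larger algebra, with \<open>X\<close> and \<open>Y\<close> two commuting copies of
  the generic quantum matrix, the Cauchy-Binet formula turns \<open>[T|T']\<close> into
  \<open>\<Sum>\<^sub>K [T|K](X) [K|T'](Y)\<close>. The smallest possible \<open>K\<close> has rows \<open>1, 2, \<dots>, s\<close>; for this \<open>K\<close> the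
  leading PBW monomial of \<open>[T|K]\<close> is the product of the diagonals, whose \<open>c\<close>-th column of
  variables lists the \<open>c\<close>-th column of \<open>T\<close>. So these leading monomials separate the increasing tableaux
  \<open>T\<close>, and likewise those of \<open>[K|T']\<close> separate the \<open>T'\<close>.

  Generic matrix. PBW monomials are shown to be independent by writing down a quantum matrix of operators, a
  product of elementary matrices, in which each factor fills one more position with a new variable.

  Spanning. Ordered words of length \<open>d\<close> span the part of degree \<open>d\<close>. There are at least as many
  standard bitableaux of size \<open>d\<close>, by the local-rule form of the RSK correspondence, so the independent standard
  products span too. No straightening law is needed.
\<close>

section \<open>Counting standard bitableaux\<close>

text \<open>Leading PBW monomials of the products themselves do not separate them:
  \<open>[12|12]\<close> and \<open>[1|1][2|2]\<close> both lead with \<open>X11 X22\<close>. In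
  \<open>Z = X Y\<close> the coincidence disappears, because the second index of a variable of
  \<open>X\<close> then records the column of the box it comes from. The price is that PBW monomials
  in \<open>X\<close> acquire coefficients in the algebra generated by \<open>Y\<close>, so their
  independence is needed over operators, not only over scalars. Both copies live in one operator
  algebra: \<open>Y\<close> is \<open>X\<close> with its variables moved past the finitely many that
  \<open>X\<close> uses.

  Instead of a monomial order there is one numerical weight, \<open>wdeg\<close>, the sum of
  \<open>i * j\<close> over the letters. The correction terms of sorting and the off-diagonal terms
  of a minor both have smaller weight, and both keep the multisets of row and of column indices. The
  only property of \<open>q\<close> that enters is invertibility, so roots of unity are
  covered.\<close>

definition interlace :: "(nat \<Rightarrow> nat) \<Rightarrow> (nat \<Rightarrow> nat) \<Rightarrow> bool"
  where "interlace \<nu> \<mu> \<longleftrightarrow> (\<forall>c. \<nu> c \<le> \<mu> c \<and> \<mu> (Suc c) \<le> \<nu> c)"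

text \<open>A partition is given by its column lengths, so that \<open>interlace \<nu> \<mu>\<close> says that \<open>\<mu>/\<nu>\<close> is a vertical
  strip, the set of boxes that one letter may occupy in a tableau with strictly increasing rows.
  The recursion is the local rule of RSK growth diagrams.\<close>

fun growth :: "(nat \<Rightarrow> nat \<Rightarrow> nat) \<Rightarrow> nat \<Rightarrow> nat \<Rightarrow> nat \<Rightarrow> nat" where
  "growth M 0 j c = 0"
| "growth M (Suc i) 0 c = 0"
| "growth M (Suc i) (Suc j) 0 =
    max (growth M i (Suc j) 0) (growth M (Suc i) j 0) + M (Suc i) (Suc j)"
| "growth M (Suc i) (Suc j) (Suc c) =
    max (growth M i (Suc j) (Suc c)) (growth M (Suc i) j (Suc c)) +
    min (growth M i (Suc j) c) (growth M (Suc i) j c) - growth M i j c"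

lemma growth_0 [simp]: "growth M i 0 c = 0"
  by (cases i) auto

text \<open>The excess \<open>min (\<mu> c) (\<mu>' c) - \<nu> c\<close> is nonnegative, so
  \<open>\<kappa>\<close> contains both neighbours. Since \<open>\<mu> (Suc c)\<close> and
  \<open>\<mu>' (Suc c)\<close> are at most \<open>\<nu> c\<close>, the new value in column
  \<open>Suc c\<close> does not exceed \<open>min (\<mu> c) (\<mu>' c)\<close>.\<close>

lemma interlace_local_rule:
  assumes "interlace \<nu> \<mu>" "interlace \<nu> \<mu>'"
    and "\<kappa> 0 = max (\<mu> 0) (\<mu>' 0) + m"
    and "\<And>c. \<kappa> (Suc c) = max (\<mu> (Suc c)) (\<mu>' (Suc c)) + min (\<mu> c) (\<mu>' c) - \<nu> c"
  shows "interlace \<mu> \<kappa>" "interlace \<mu>' \<kappa>"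
proof -
  have "\<mu> c \<le> \<kappa> c \<and> \<mu>' c \<le> \<kappa> c" for c
  proof (cases c)
    case (Suc c')
    then show ?thesis
      using assms(1,2)[unfolded interlace_def, rule_format, of c'] by (auto simp: assms(4))
  qed (auto simp: assms(3))
  moreover have "\<kappa> (Suc c) \<le> \<mu> c \<and> \<kappa> (Suc c) \<le> \<mu>' c" for c
    using assms(1,2)[unfolded interlace_def, rule_format, of c] by (auto simp: assms(4))
  ultimately show "interlace \<mu> \<kappa>" "interlace \<mu>' \<kappa>"
    by (auto simp: interlace_def)
qed

lemma growth_interlace_step:
  assumes "interlace (growth M i j) (growth M (Suc i) j)"
    "interlace (growth M i j) (growth M i (Suc j))"
  shows "interlace (growth M (Suc i) j) (growth M (Suc i) (Suc j))"
    "interlace (growth M i (Suc j)) (growth M (Suc i) (Suc j))"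
  using interlace_local_rule[OF assms(2,1), of "growth M (Suc i) (Suc j)" "M (Suc i) (Suc j)"]
  by auto

lemma growth_interlace:
  "interlace (growth M i j) (growth M (Suc i) j) \<and> interlace (growth M i j) (growth M i (Suc j))"
proof (induction i arbitrary: j)
  case 0
  have V: "interlace (growth M 0 j) (growth M 0 (Suc j))" for j
    by (simp add: interlace_def)
  have "interlace (growth M 0 j) (growth M (Suc 0) j)"
  proof (induction j)
    case (Suc j)
    show ?case by (rule growth_interlace_step(2)[OF Suc V])
  qed (simp add: interlace_def)
  with V show ?case by blast
next
  case (Suc i)
  have V: "interlace (growth M (Suc i) j) (growth M (Suc i) (Suc j))" for j
    using Suc growth_interlace_step(1) by blast
  have "interlace (growth M (Suc i) j) (growth M (Suc (Suc i)) j)"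
  proof (induction j)
    case (Suc j)
    show ?case by (rule growth_interlace_step(2)[OF Suc V])
  qed (simp add: interlace_def)
  with V show ?case by blast
qed

text \<open>A vertical strip opens at most one new column, so \<open>i\<close> steps from the empty
  partition give at most \<open>i\<close> columns.\<close>

lemma growth_vanish: "i \<le> c \<Longrightarrow> growth M i j c = 0"
proof (induction i arbitrary: c)
  case (Suc i)
  then obtain c' where c: "c = Suc c'" "i \<le> c'" by (cases c) auto
  then show ?case
    using growth_interlace[of M i j] Suc.IH[of c'] unfolding interlace_def by (metis le_zero_eq)
qed simp

lemma growth_min_le: "growth M i j c \<le> min (growth M i (Suc j) c) (growth M (Suc i) j c)"
  using growth_interlace[of M i j] by (auto simp: interlace_def)

text \<open>The local rule runs backwards: in a cell, \<open>\<nu> c\<close> is the maximum of the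
  two neighbours in column \<open>Suc c\<close> plus their minimum in column \<open>c\<close>, minus
  \<open>\<kappa> (Suc c)\<close>. Descending from the two far borders recovers the whole diagram,
  and column 0 then yields the entries of \<open>M\<close>.\<close>

lemma growth_inj:
  assumes "\<And>j. j \<le> n \<Longrightarrow> growth M n j = growth M' n j"
    and "\<And>i. i \<le> n \<Longrightarrow> growth M i n = growth M' i n"
  shows "i < n \<Longrightarrow> j < n \<Longrightarrow> M (Suc i) (Suc j) = M' (Suc i) (Suc j)"
proof -
  have eq: "growth M i j = growth M' i j" if "i \<le> n" "j \<le> n" for i j
    using that
  proof (induction i arbitrary: j rule: inc_induct)
    case base
    then show ?case using assms(1) by blast
  next
    case (step i)
    note IH = step.IH and i = step.hyps
    show ?case using \<open>j \<le> n\<close>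
    proof (induction j rule: inc_induct)
      case base
      then show ?case using assms(2) i by simp
    next
      case (step j)
      have e: "growth M (Suc i) j = growth M' (Suc i) j"
        "growth M (Suc i) (Suc j) = growth M' (Suc i) (Suc j)"
        "growth M i (Suc j) = growth M' i (Suc j)"
        using IH[of j] IH[of "Suc j"] step by auto
      show ?case
      proof
        fix c
        show "growth M i j c = growth M' i j c"
          using growth.simps(4)[of M i j c] growth.simps(4)[of M' i j c]
            growth_min_le[of M i j c] growth_min_le[of M' i j c] unfolding e by linarith
      qed
    qed
  qed
  show "i < n \<Longrightarrow> j < n \<Longrightarrow> M (Suc i) (Suc j) = M' (Suc i) (Suc j)"
    using growth.simps(3)[of M i j] growth.simps(3)[of M' i j]
      eq[of "Suc i" "Suc j"] eq[of i "Suc j"] eq[of "Suc i" j] by simp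
qed

text \<open>Maximum plus minimum is the sum, so a cell changes the total size only by its matrix
  entry. The rule pairs the maximum in column \<open>Suc c\<close> with the minimum in column
  \<open>c\<close>; the surplus column \<open>n\<close> created by this offset is empty because
  \<open>Suc i \<le> n\<close>.\<close>

lemma growth_size_step:
  assumes "Suc i \<le> n"
  shows "(\<Sum>c<n. growth M (Suc i) (Suc j) c) + (\<Sum>c<n. growth M i j c) =
    (\<Sum>c<n. growth M (Suc i) j c) + (\<Sum>c<n. growth M i (Suc j) c) + M (Suc i) (Suc j)"
proof -
  have "(\<Sum>c<k. growth M (Suc i) (Suc j) (Suc c)) + (\<Sum>c<k. growth M i j c) =
    (\<Sum>c<k. max (growth M i (Suc j) (Suc c)) (growth M (Suc i) j (Suc c))) +
    (\<Sum>c<k. min (growth M i (Suc j) c) (growth M (Suc i) j c))" for k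
    unfolding sum.distrib[symmetric]
    by (rule sum.cong) (use growth_min_le[of M i j] in \<open>auto simp: le_SucI trans_le_add2\<close>)
  from this[of n] have "(\<Sum>c<Suc n. growth M (Suc i) (Suc j) c) + (\<Sum>c<n. growth M i j c) =
    M (Suc i) (Suc j) + (\<Sum>c<Suc n. max (growth M i (Suc j) c) (growth M (Suc i) j c)) +
    (\<Sum>c<n. min (growth M i (Suc j) c) (growth M (Suc i) j c))"
    unfolding sum.lessThan_Suc_shift by simp
  then have "(\<Sum>c<n. growth M (Suc i) (Suc j) c) + (\<Sum>c<n. growth M i j c) =
    M (Suc i) (Suc j) + (\<Sum>c<n. max (growth M i (Suc j) c) (growth M (Suc i) j c) +
      min (growth M i (Suc j) c) (growth M (Suc i) j c))"
    using assms by (simp add: growth_vanish sum.distrib)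
  also have "(\<lambda>c. max (growth M i (Suc j) c) (growth M (Suc i) j c) +
      min (growth M i (Suc j) c) (growth M (Suc i) j c)) =
      (\<lambda>c. growth M i (Suc j) c + growth M (Suc i) j c)"
    by (auto simp: max_def min_def)
  finally show ?thesis by (simp add: sum.distrib)
qed

lemma growth_size:
  "i \<le> n \<Longrightarrow> (\<Sum>c<n. growth M i j c) = (\<Sum>a\<in>{1..i}. \<Sum>b\<in>{1..j}. M a b)"
proof (induction i arbitrary: j)
  case (Suc i)
  then have IH: "(\<Sum>c<n. growth M i j c) = (\<Sum>a\<in>{1..i}. \<Sum>b\<in>{1..j}. M a b)" for j
    by simp
  have i: "Suc i \<le> n" by (rule Suc.prems)
  show ?case
  proof (induction j)
    case (Suc j)
    show ?case
      using growth_size_step[OF i, of M j] Suc IH[of j] IH[of "Suc j"] by simp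
  qed simp
qed simp

section \<open>Tableaux from chains of partitions\<close>

definition chain_entry :: "(nat \<Rightarrow> nat \<Rightarrow> nat) \<Rightarrow> nat \<Rightarrow> nat \<Rightarrow> nat"
  where "chain_entry \<Lambda> r c = (LEAST j. r < \<Lambda> j c)"

text \<open>A box carries the stage at which it joins the chain. Partitions are stored by columns
  and tableaux by rows, so the length of row \<open>r\<close> is the number of columns longer than
  \<open>r\<close>.\<close>

definition chain_tableau :: "(nat \<Rightarrow> nat \<Rightarrow> nat) \<Rightarrow> nat \<Rightarrow> nat list list"
  where "chain_tableau \<Lambda> n =
    map (\<lambda>r. map (chain_entry \<Lambda> r) [0..<card {c. r < \<Lambda> n c}]) [0..<\<Lambda> n 0]"

locale interlacing_chain =
  fixes \<Lambda> :: "nat \<Rightarrow> nat \<Rightarrow> nat"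
  assumes zero: "\<Lambda> 0 = (\<lambda>c. 0)"
    and interlace: "interlace (\<Lambda> j) (\<Lambda> (Suc j))"
begin

lemma mono: "j \<le> j' \<Longrightarrow> \<Lambda> j c \<le> \<Lambda> j' c"
  by (rule lift_Suc_mono_le[of "\<lambda>j. \<Lambda> j c"]) (use interlace in \<open>auto simp: interlace_def\<close>)

lemma antimono: "c \<le> c' \<Longrightarrow> \<Lambda> j c' \<le> \<Lambda> j c"
proof (rule lift_Suc_antimono_le[of "\<Lambda> j"])
  show "\<Lambda> j (Suc c) \<le> \<Lambda> j c" for c
  proof (cases j)
    case (Suc j')
    then show ?thesis
      using interlace[of j'] unfolding interlace_def by (metis le_trans)
  qed (simp add: zero)
qed

lemma vanish: "j \<le> c \<Longrightarrow> \<Lambda> j c = 0"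
proof (induction j arbitrary: c)
  case (Suc j)
  then obtain c' where c: "c = Suc c'" "j \<le> c'" by (cases c) auto
  then show ?case
    using interlace[of j] Suc.IH[of c'] unfolding interlace_def by (metis le_zero_eq)
qed (simp add: zero)

text \<open>Column lengths decrease and vanish from column \<open>n\<close> on, so the columns that
  meet row \<open>r\<close> form a finite initial segment.\<close>

lemma row_length: "c < card {c. r < \<Lambda> n c} \<longleftrightarrow> r < \<Lambda> n c"
proof -
  have down: "c' \<in> {c. r < \<Lambda> n c}" if "c \<in> {c. r < \<Lambda> n c}" "c' \<le> c" for c c'
    using that antimono[of c' c n] by auto
  have "{..<card {c. r < \<Lambda> n c}} = {c. r < \<Lambda> n c}"
  proof -
    define m where "m = (LEAST c. \<not> r < \<Lambda> n c)"
    have "\<not> r < \<Lambda> n m" unfolding m_def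
      by (rule LeastI[of _ n]) (simp add: vanish)
    then have "c < m" if "r < \<Lambda> n c" for c
      using that down[of c m] by (meson mem_Collect_eq not_le)
    moreover have "r < \<Lambda> n c" if "c < m" for c
      using not_less_Least[of c "\<lambda>c. \<not> r < \<Lambda> n c"] that unfolding m_def[symmetric] by blast
    ultimately have "{c. r < \<Lambda> n c} = {..<m}" by blast
    then show ?thesis by simp
  qed
  then show ?thesis by blast
qed

lemma entry_le:
  assumes "r < \<Lambda> n c"
  shows "chain_entry \<Lambda> r c \<le> j \<longleftrightarrow> r < \<Lambda> j c"
proof
  have "r < \<Lambda> (chain_entry \<Lambda> r c) c"
    unfolding chain_entry_def by (rule LeastI[of _ n]) (rule assms)
  then show "r < \<Lambda> j c" if "chain_entry \<Lambda> r c \<le> j"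
    using mono[OF that, of c] by simp
  show "chain_entry \<Lambda> r c \<le> j" if "r < \<Lambda> j c"
    unfolding chain_entry_def using that by (rule Least_le)
qed

lemma length_tableau: "length (chain_tableau \<Lambda> n) = \<Lambda> n 0"
  by (simp add: chain_tableau_def)

lemma nth_tableau:
  "r < \<Lambda> n 0 \<Longrightarrow> chain_tableau \<Lambda> n ! r = map (chain_entry \<Lambda> r) [0..<card {c. r < \<Lambda> n c}]"
  by (simp add: chain_tableau_def)

lemma card_antimono: "r \<le> r' \<Longrightarrow> card {c. r' < \<Lambda> n c} \<le> card {c. r < \<Lambda> n c}"
  using row_length[of "card {c. r < \<Lambda> n c}" r n] row_length[of "card {c. r < \<Lambda> n c}" r' n]
  by linarith

lemma tableau: "tableau n (chain_tableau \<Lambda> n)"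
proof -
  have "row \<noteq> [] \<and> set row \<subseteq> {1..n}" if "row \<in> set (chain_tableau \<Lambda> n)" for row
  proof -
    from that obtain r where r: "r < \<Lambda> n 0"
      "row = map (chain_entry \<Lambda> r) [0..<card {c. r < \<Lambda> n c}]"
      by (auto simp: chain_tableau_def)
    have "1 \<le> chain_entry \<Lambda> r c \<and> chain_entry \<Lambda> r c \<le> n" if "r < \<Lambda> n c" for c
      using entry_le[OF that, of n] entry_le[OF that, of 0] that zero by (simp add: Suc_le_eq)
    then show ?thesis
      using r row_length[of 0 r n] by (auto simp: row_length)
  qed
  moreover have "sorted_wrt (\<ge>) (map length (chain_tableau \<Lambda> n))"
    by (auto simp: sorted_wrt_iff_nth_less length_tableau nth_tableau card_antimono)
  ultimately show ?thesis by (auto simp: tableau_def)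
qed

lemma increasing: "increasing_tableau (chain_tableau \<Lambda> n)"
  unfolding increasing_tableau_def
proof (intro conjI ballI allI impI)
  fix row assume "row \<in> set (chain_tableau \<Lambda> n)"
  then obtain r where r: "row = map (chain_entry \<Lambda> r) [0..<card {c. r < \<Lambda> n c}]"
    by (auto simp: chain_tableau_def)
  \<comment> \<open>Interlacing: a box of column \<open>Suc c\<close> present at stage
    \<open>Suc j'\<close> has its left neighbour present already at stage \<open>j'\<close>.\<close>
  have "chain_entry \<Lambda> r c < chain_entry \<Lambda> r (Suc c)" if c: "r < \<Lambda> n (Suc c)" for c
  proof -
    have c0: "r < \<Lambda> n c" using c antimono[of c "Suc c" n] by simp
    define j where "j = chain_entry \<Lambda> r (Suc c)"
    have "r < \<Lambda> j (Suc c)" using entry_le[OF c, of j] by (simp add: j_def)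
    moreover from this obtain j' where j: "j = Suc j'" using zero by (cases j) auto
    ultimately have "r < \<Lambda> j' c"
      using interlace[of j'] unfolding interlace_def by (metis order_less_le_trans)
    then show ?thesis using entry_le[OF c0, of j'] j unfolding j_def by simp
  qed
  then show "sorted_wrt (<) row"
    using antimono[OF le_SucI[OF order_refl]] unfolding r
    by (subst sorted_wrt_iff_nth_Suc_transp) (simp_all add: row_length order_less_le_trans)
next
  fix r r' c
  assume *: "r < r' \<and> r' < length (chain_tableau \<Lambda> n) \<and> c < length (chain_tableau \<Lambda> n ! r')"
  then have r: "r' < \<Lambda> n 0" "r < \<Lambda> n 0" "r < r'" by (auto simp: length_tableau)
  with * have c: "r' < \<Lambda> n c" by (simp add: nth_tableau row_length)
  then have c': "r < \<Lambda> n c" using r by simp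
  have "r' < \<Lambda> (chain_entry \<Lambda> r' c) c" using entry_le[OF c] by blast
  then have "chain_entry \<Lambda> r c \<le> chain_entry \<Lambda> r' c"
    using entry_le[OF c'] r by auto
  then show "chain_tableau \<Lambda> n ! r ! c \<le> chain_tableau \<Lambda> n ! r' ! c"
    using r c c' by (simp add: nth_tableau row_length)
qed

text \<open>This inverts the passage from chains to tableaux and is the source of injectivity for
  \<open>rsk\<close>: the boxes of a column with entry at most \<open>j\<close> are exactly those
  present at stage \<open>j\<close>. The tableau remembers the stages up to
  \<open>n\<close>.\<close>

lemma chain_from_tableau:
  assumes "j \<le> n"
  shows "\<Lambda> j c = card {r. r < length (chain_tableau \<Lambda> n) \<and> c < length (chain_tableau \<Lambda> n ! r) \<and>
    chain_tableau \<Lambda> n ! r ! c \<le> j}"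
proof -
  have "{r. r < length (chain_tableau \<Lambda> n) \<and> c < length (chain_tableau \<Lambda> n ! r) \<and>
    chain_tableau \<Lambda> n ! r ! c \<le> j} = {..<\<Lambda> j c}"
  proof (intro equalityI subsetI)
    fix r assume "r \<in> {r. r < length (chain_tableau \<Lambda> n) \<and> c < length (chain_tableau \<Lambda> n ! r) \<and>
      chain_tableau \<Lambda> n ! r ! c \<le> j}"
    then show "r \<in> {..<\<Lambda> j c}"
      by (auto simp: length_tableau nth_tableau row_length entry_le)
  next
    fix r assume "r \<in> {..<\<Lambda> j c}"
    then have "r < \<Lambda> j c" by simp
    moreover from this have c: "r < \<Lambda> n c" using mono[OF assms, of c] by simp
    moreover from this have "r < \<Lambda> n 0" using antimono[of 0 c n] by simp
    ultimately show "r \<in> {r. r < length (chain_tableau \<Lambda> n) \<and> c < length (chain_tableau \<Lambda> n ! r) \<and>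
      chain_tableau \<Lambda> n ! r ! c \<le> j}"
      by (auto simp: length_tableau nth_tableau row_length entry_le)
  qed
  then show ?thesis by simp
qed

lemma shape: "tableau_shape (chain_tableau \<Lambda> n) =
  map (\<lambda>r. card {c. r < \<Lambda> n c}) [0..<\<Lambda> n 0]"
  by (simp add: tableau_shape_def chain_tableau_def comp_def)

lemma size: "sum_list (map length (chain_tableau \<Lambda> n)) = (\<Sum>c<n. \<Lambda> n c)"
proof -
  have "sum_list (map length (chain_tableau \<Lambda> n)) = (\<Sum>r<\<Lambda> n 0. card {c. r < \<Lambda> n c})"
    using shape[of n] by (simp add: tableau_shape_def interv_sum_list_conv_sum_set_nat atLeast0LessThan)
  also have "\<dots> = (\<Sum>r<\<Lambda> n 0. \<Sum>c<n. if r < \<Lambda> n c then 1 else 0)"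
  proof (rule sum.cong)
    fix r
    have "c < n" if "r < \<Lambda> n c" for c
      using that vanish[of n c] by (cases "n \<le> c") auto
    then have "{c. r < \<Lambda> n c} = {c \<in> {..<n}. r < \<Lambda> n c}"
      by blast
    then show "card {c. r < \<Lambda> n c} = (\<Sum>c<n. if r < \<Lambda> n c then 1 else 0)"
      by (simp add: sum.If_cases Int_def)
  qed simp
  also have "\<dots> = (\<Sum>c<n. \<Sum>r<\<Lambda> n 0. if r < \<Lambda> n c then 1 else 0)"
    by (rule sum.swap)
  also have "\<dots> = (\<Sum>c<n. \<Lambda> n c)"
  proof (rule sum.cong)
    fix c
    have "{..<\<Lambda> n 0} \<inter> {r. r < \<Lambda> n c} = {..<\<Lambda> n c}"
      using antimono[of 0 c n] by auto
    then show "(\<Sum>r<\<Lambda> n 0. if r < \<Lambda> n c then 1 else 0) = \<Lambda> n c"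
      by (simp add: sum.If_cases)
  qed simp
  finally show ?thesis .
qed

end

text \<open>The two chains are the far borders of the growth diagram. Both end in
  \<open>growth M n n\<close>, which is why the two tableaux have the same shape.\<close>

definition rsk :: "nat \<Rightarrow> (nat \<Rightarrow> nat \<Rightarrow> nat) \<Rightarrow> nat list list \<times> nat list list"
  where "rsk n M = (chain_tableau (\<lambda>i. growth M i n) n, chain_tableau (growth M n) n)"

lemma growth_chains:
  "interlacing_chain (\<lambda>i. growth M i n)" "interlacing_chain (growth M n)"
  by (standard; use growth_interlace in fastforce)+

lemma rsk_standard: "rsk n M \<in> standard_bitableaux n"
proof -
  interpret R: interlacing_chain "\<lambda>i. growth M i n" by (rule growth_chains)
  interpret C: interlacing_chain "growth M n" by (rule growth_chains)
  show ?thesis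
    using R.tableau[of n] C.tableau[of n] R.increasing[of n] C.increasing[of n]
      R.shape[of n] C.shape[of n]
    by (simp add: standard_bitableaux_def bitableaux_def rsk_def)
qed

lemma rsk_size:
  "sum_list (map length (fst (rsk n M))) = (\<Sum>a\<in>{1..n}. \<Sum>b\<in>{1..n}. M a b)"
proof -
  interpret R: interlacing_chain "\<lambda>i. growth M i n" by (rule growth_chains)
  show ?thesis using R.size[of n] growth_size[of n n M n] by (simp add: rsk_def)
qed

lemma rsk_inj:
  assumes "rsk n M = rsk n M'" "a \<in> {1..n}" "b \<in> {1..n}"
  shows "M a b = M' a b"
proof -
  have T: "chain_tableau (\<lambda>i. growth M i n) n = chain_tableau (\<lambda>i. growth M' i n) n"
    "chain_tableau (growth M n) n = chain_tableau (growth M' n) n"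
    using assms(1) by (simp_all add: rsk_def)
  have "growth M n j = growth M' n j" if "j \<le> n" for j
  proof
    fix c show "growth M n j c = growth M' n j c"
      unfolding interlacing_chain.chain_from_tableau[OF growth_chains(2) that] T ..
  qed
  moreover have "growth M i n = growth M' i n" if "i \<le> n" for i
  proof
    fix c show "growth M i n c = growth M' i n c"
      unfolding interlacing_chain.chain_from_tableau[OF growth_chains(1) that] T ..
  qed
  ultimately have "M (Suc (a - 1)) (Suc (b - 1)) = M' (Suc (a - 1)) (Suc (b - 1))"
    using assms(2,3) by (intro growth_inj[of n]) auto
  then show ?thesis using assms(2,3) by simp
qed

section \<open>Comparison of sorted words with standard bitableaux\<close>

definition sorted_words :: "nat \<Rightarrow> (nat \<times> nat) list set"
  where "sorted_words n = {w. sorted w \<and> set w \<subseteq> {1..n} \<times> {1..n}}"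

definition bitableau_size :: "nat list list \<times> nat list list \<Rightarrow> nat"
  where "bitableau_size b = sum_list (map length (fst b))"

lemma finite_sorted_words: "finite {w \<in> sorted_words n. length w = d}"
  by (rule finite_subset[OF _ finite_lists_length_eq[of "{1..n} \<times> {1..n}" d]])
    (auto simp: sorted_words_def)

lemma finite_standard_bitableaux: "finite {b \<in> standard_bitableaux n. bitableau_size b = d}"
proof -
  have sub: "T \<in> {T. set T \<subseteq> {r. set r \<subseteq> {1..n} \<and> length r \<le> d} \<and> length T \<le> d}"
    if "tableau n T" "sum_list (map length T) = d" for T
  proof -
    have "length r \<le> d" if "r \<in> set T" for r
      using member_le_sum_list[of "length r" "map length T"] that \<open>sum_list (map length T) = d\<close> by auto
    moreover have "length T \<le> sum_list (map length T)" if "\<forall>r\<in>set T. r \<noteq> []" for T :: "nat list list"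
      using that by (induction T) (auto simp: Suc_le_eq add_strict_increasing)
    ultimately show ?thesis using that by (auto simp: tableau_def)
  qed
  let ?S = "{T. set T \<subseteq> {r. set r \<subseteq> {1..n} \<and> length r \<le> d} \<and> length T \<le> d}"
  have "{b \<in> standard_bitableaux n. bitableau_size b = d} \<subseteq> ?S \<times> ?S"
  proof
    fix b assume b: "b \<in> {b \<in> standard_bitableaux n. bitableau_size b = d}"
    obtain T T' where T: "b = (T, T')" by (cases b)
    have t: "tableau n T" "tableau n T'" "map length T' = map length T"
      "sum_list (map length T) = d"
      using b T by (auto simp: standard_bitableaux_def bitableaux_def tableau_shape_def bitableau_size_def)
    show "b \<in> ?S \<times> ?S"
      using sub[OF t(1,4)] sub[OF t(2)] t(3,4) unfolding T by simp
  qed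
  moreover have "finite ?S"
    by (intro finite_lists_length_le) simp
  ultimately show ?thesis by (meson finite_SigmaI finite_subset)
qed

text \<open>A sorted word is determined by its matrix of letter multiplicities, whose entries add up
  to the length; \<open>rsk\<close> sends this matrix injectively to a standard bitableau of that
  size.\<close>

lemma card_sorted_words_le:
  "card {w \<in> sorted_words n. length w = d} \<le>
    card {b \<in> standard_bitableaux n. bitableau_size b = d}"
proof (rule card_inj_on_le[OF _ _ finite_standard_bitableaux])
  define G where "G = (\<lambda>w. rsk n (\<lambda>a b. count (mset w) (a, b)))"
  show "inj_on G {w \<in> sorted_words n. length w = d}"
  proof (rule inj_onI)
    fix w w' assume *: "w \<in> {w \<in> sorted_words n. length w = d}"
      "w' \<in> {w \<in> sorted_words n. length w = d}" "G w = G w'"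
    have "count (mset w) x = count (mset w') x" for x
    proof (cases "x \<in> {1..n} \<times> {1..n}")
      case True
      then show ?thesis using rsk_inj[OF *(3)[unfolded G_def]] by auto
    next
      case False
      then have "x \<notin> set w" "x \<notin> set w'"
        using * by (auto simp: sorted_words_def)
      then show ?thesis by (metis set_mset_mset not_in_iff)
    qed
    then have "mset w = mset w'" by (rule multiset_eqI)
    moreover have "sorted w" "sorted w'" using * by (auto simp: sorted_words_def)
    ultimately show "w = w'" using properties_for_sort[of w w'] sorted_sort_id[of w'] by simp
  qed
  show "G ` {w \<in> sorted_words n. length w = d} \<subseteq> {b \<in> standard_bitableaux n. bitableau_size b = d}"
  proof (rule image_subsetI)
    fix w assume w: "w \<in> {w \<in> sorted_words n. length w = d}"
    then have "(\<Sum>a\<in>{1..n}. \<Sum>b\<in>{1..n}. count (mset w) (a, b)) =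
      (\<Sum>x\<in>{1..n} \<times> {1..n}. count (mset w) x)"
      by (simp add: sum.cartesian_product)
    also have "\<dots> = (\<Sum>x\<in>set_mset (mset w). count (mset w) x)"
      by (rule sum.mono_neutral_right)
        (use w in \<open>auto simp: sorted_words_def count_eq_zero_iff\<close>)
    also have "\<dots> = length w" by (metis size_multiset_overloaded_eq size_mset)
    finally show "G w \<in> {b \<in> standard_bitableaux n. bitableau_size b = d}"
      using w by (simp add: G_def rsk_standard bitableau_size_def rsk_size)
  qed
qed

section \<open>An algebra of operators\<close>

text \<open>Linear operators on functions of exponent vectors of countably many variables. Below, \<open>tail f\<close>
  lets \<open>f\<close> act on all variables but the first, \<open>shift\<close> multiplies by the first variable, \<open>hscale\<close>
  scales according to its exponent, and \<open>coef m f\<close> applies \<open>f\<close> to functions free of the first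
  variable and takes the coefficient of its \<open>m\<close>-th power.\<close>

typedef (overloaded) 'k op = "{f :: ((nat \<Rightarrow> nat) \<Rightarrow> 'k::field) \<Rightarrow> (nat \<Rightarrow> nat) \<Rightarrow> 'k.
    (\<forall>x y. f (\<lambda>v. x v + y v) = (\<lambda>v. f x v + f y v)) \<and> (\<forall>c x. f (\<lambda>v. c * x v) = (\<lambda>v. c * f x v))}"
  morphisms app Op
  by (rule exI[of _ "\<lambda>x. x"]) simp

setup_lifting type_definition_op

instantiation op :: (field) ring_1
begin

lift_definition zero_op :: "'a op" is "\<lambda>x v. 0" by simp
lift_definition one_op :: "'a op" is "\<lambda>x. x" by simp
lift_definition plus_op :: "'a op \<Rightarrow> 'a op \<Rightarrow> 'a op" is "\<lambda>f g x v. f x v + g x v"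
  by (simp add: algebra_simps)
lift_definition minus_op :: "'a op \<Rightarrow> 'a op \<Rightarrow> 'a op" is "\<lambda>f g x v. f x v - g x v"
  by (simp add: algebra_simps)
lift_definition uminus_op :: "'a op \<Rightarrow> 'a op" is "\<lambda>f x v. - f x v"
  by (simp add: algebra_simps)
lift_definition times_op :: "'a op \<Rightarrow> 'a op \<Rightarrow> 'a op" is "\<lambda>f g x. f (g x)"
  by simp

instance
proof
  show "(0::'a op) \<noteq> 1"
  proof transfer
    have "(\<lambda>v. 0) \<noteq> (\<lambda>v::nat \<Rightarrow> nat. 1::'a)" by (simp add: fun_eq_iff)
    then show "(\<lambda>x v. 0) \<noteq> (\<lambda>x::(nat \<Rightarrow> nat) \<Rightarrow> 'a. x)" by metis
  qed
qed (transfer; simp add: algebra_simps fun_eq_iff)+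

end

lift_definition scal :: "'k::field \<Rightarrow> 'k op" is "\<lambda>c x v. c * x v"
  by (simp add: algebra_simps)

lemma scal_simps [simp]: "scal 0 = 0" "scal 1 = 1"
  by (transfer; simp)+

lemma scal_add: "scal (c + d) = scal c + scal d"
  by transfer (simp add: algebra_simps)

lemma scal_minus: "scal (c - d) = scal c - scal d"
  by transfer (simp add: algebra_simps)

lemma scal_mult: "scal (c * d) = scal c * scal d"
  by transfer (simp add: algebra_simps)

lemma scal_comm: "f * scal c = scal c * f"
  by transfer simp

lemma scal_left_comm: "f * (scal c * g) = scal c * (f * g)"
  by (metis mult.assoc scal_comm)

lemma scal_cancel:
  assumes "c \<noteq> 0" "scal c * f = scal c * g"
  shows "f = g"
proof -
  have "scal (inverse c) * (scal c * f) = scal (inverse c) * (scal c * g)" using assms by simp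
  then show ?thesis using assms(1) by (simp add: mult.assoc[symmetric] scal_mult[symmetric])
qed

lemma case_nat_eta [simp]: "case_nat (v 0) (\<lambda>i. v (Suc i)) = v"
  by (auto simp: fun_eq_iff split: nat.split)

lift_definition tail :: "'k::field op \<Rightarrow> 'k op"
  is "\<lambda>f w v. f (\<lambda>u. w (case_nat (v 0) u)) (\<lambda>i. v (Suc i))"
  by simp

lift_definition hscale :: "(nat \<Rightarrow> 'k::field) \<Rightarrow> 'k op" is "\<lambda>g w v. g (v 0) * w v"
  by (simp add: algebra_simps)

lift_definition shift :: "'k::field op"
  is "\<lambda>w v. case v 0 of 0 \<Rightarrow> 0 | Suc m \<Rightarrow> w (case_nat m (\<lambda>i. v (Suc i)))"
  by (auto simp: fun_eq_iff split: nat.split)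

lift_definition coef :: "nat \<Rightarrow> 'k::field op \<Rightarrow> 'k op"
  is "\<lambda>m f w v. f (\<lambda>u. if u 0 = 0 then w (\<lambda>i. u (Suc i)) else 0) (case_nat m v)"
  subgoal premises prems for m f
  proof (intro conjI allI)
    fix x y :: "(nat \<Rightarrow> nat) \<Rightarrow> 'k" and c
    have *: "(\<lambda>u. if u 0 = 0 then x (\<lambda>i. u (Suc i)) + y (\<lambda>i. u (Suc i)) else 0) =
      (\<lambda>u. (if u 0 = 0 then x (\<lambda>i. u (Suc i)) else 0) + (if u 0 = 0 then y (\<lambda>i. u (Suc i)) else 0))"
      "(\<lambda>u. if u 0 = 0 then c * x (\<lambda>i. u (Suc i)) else 0) =
      (\<lambda>u. c * (if u (0::nat) = (0::nat) then x (\<lambda>i. u (Suc i)) else 0))"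
      by auto
    show "(\<lambda>v. f (\<lambda>u. if u 0 = 0 then x (\<lambda>i. u (Suc i)) + y (\<lambda>i. u (Suc i)) else 0) (case_nat m v)) =
      (\<lambda>v. f (\<lambda>u. if u 0 = 0 then x (\<lambda>i. u (Suc i)) else 0) (case_nat m v) +
           f (\<lambda>u. if u 0 = 0 then y (\<lambda>i. u (Suc i)) else 0) (case_nat m v))"
      "(\<lambda>v. f (\<lambda>u. if u 0 = 0 then c * x (\<lambda>i. u (Suc i)) else 0) (case_nat m v)) =
      (\<lambda>v. c * f (\<lambda>u. if u 0 = 0 then x (\<lambda>i. u (Suc i)) else 0) (case_nat m v))"
      unfolding * using prems by simp_all
  qed
  done

lemma tail_0: "tail 0 = 0" and tail_1: "tail 1 = 1"
  and tail_add: "tail (f + g) = tail f + tail g"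
  and tail_minus: "tail (f - g) = tail f - tail g"
  and tail_mult: "tail (f * g) = tail f * tail g"
  and tail_scal: "tail (scal c) = scal c"
  by (transfer; simp)+

lemma hscale_mult: "hscale g * hscale h = hscale (\<lambda>m. g m * h m)"
  by transfer (simp add: mult.assoc)

lemma hscale_1: "hscale (\<lambda>m. 1) = 1"
  by transfer simp

lemma hscale_comm: "hscale g * hscale h = hscale h * hscale g"
  by (simp add: hscale_mult mult.commute)

lemma hscale_shift: "hscale g * shift = shift * hscale (\<lambda>m. g (Suc m))"
  by transfer (auto simp: fun_eq_iff split: nat.split)

lemma scal_hscale: "scal c * hscale g = hscale (\<lambda>m. c * g m)"
  by transfer (simp add: mult.assoc)

lemma tail_hscale: "tail f * hscale g = hscale g * tail f"
  by transfer simp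

lemma tail_shift: "tail f * shift = shift * tail f"
proof transfer
  fix f :: "((nat \<Rightarrow> nat) \<Rightarrow> 'a) \<Rightarrow> (nat \<Rightarrow> nat) \<Rightarrow> 'a"
  assume f: "(\<forall>x y. f (\<lambda>v. x v + y v) = (\<lambda>v. f x v + f y v)) \<and> (\<forall>c x. f (\<lambda>v. c * x v) = (\<lambda>v. c * f x v))"
  \<comment> \<open>Homogeneity with scalar 0, at an arbitrary vector, shows that \<open>f\<close>
    kills the zero function. This is the case where the first exponent is 0 and \<open>shift\<close>
    produces 0.\<close>
  have "f (\<lambda>v. 0 * undefined v) = (\<lambda>v. 0 * f undefined v)" using f by blast
  then have "f (\<lambda>v. 0) = (\<lambda>v. 0)" by simp
  then show "(\<lambda>w v. f (\<lambda>u. case case_nat (v 0) u 0 of 0 \<Rightarrow> 0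
      | Suc m \<Rightarrow> w (case_nat m (\<lambda>i. case_nat (v 0) u (Suc i)))) (\<lambda>i. v (Suc i))) =
    (\<lambda>w v. case v 0 of 0 \<Rightarrow> 0 | Suc m \<Rightarrow>
      f (\<lambda>u. w (case_nat (case_nat m (\<lambda>i. v (Suc i)) 0) u)) (\<lambda>i. case_nat m (\<lambda>i. v (Suc i)) (Suc i)))"
    by (auto simp: fun_eq_iff split: nat.split)
qed

lemma coef_add: "coef m (f + g) = coef m f + coef m g"
  and coef_0: "coef m 0 = 0"
  and coef_1: "coef m 1 = (if m = 0 then 1 else 0)"
  by (transfer; auto)+

lemma coef_sum: "coef m (sum f A) = (\<Sum>a\<in>A. coef m (f a))"
  by (induction A rule: infinite_finite_induct) (auto simp: coef_add coef_0)

lemma coef_tail_left: "coef m (tail g * f) = g * coef m f"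
  by transfer simp

lemma coef_tail_right: "coef m (f * tail g) = coef m f * g"
proof transfer
  fix m and f g :: "((nat \<Rightarrow> nat) \<Rightarrow> 'a) \<Rightarrow> (nat \<Rightarrow> nat) \<Rightarrow> 'a"
  assume g: "(\<forall>x y. g (\<lambda>v. x v + y v) = (\<lambda>v. g x v + g y v)) \<and> (\<forall>c x. g (\<lambda>v. c * x v) = (\<lambda>v. c * g x v))"
  have "g (\<lambda>v. 0 * undefined v) = (\<lambda>v. 0 * g undefined v)" using g by blast
  then have "g (\<lambda>v. 0) = (\<lambda>v. 0)" by simp
  then have "(\<lambda>v. g (\<lambda>u. if case_nat (v 0) u 0 = 0 then w (\<lambda>i. case_nat (v 0) u (Suc i)) else 0) (\<lambda>i. v (Suc i))) =
    (\<lambda>u. if u 0 = 0 then g w (\<lambda>i. u (Suc i)) else 0)" for w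
    by (auto simp: fun_eq_iff)
  then show "(\<lambda>w v. f (\<lambda>v. g (\<lambda>u. if case_nat (v 0) u 0 = 0 then w (\<lambda>i. case_nat (v 0) u (Suc i)) else 0) (\<lambda>i. v (Suc i))) (case_nat m v)) =
    (\<lambda>x. (\<lambda>w v. f (\<lambda>u. if u 0 = 0 then w (\<lambda>i. u (Suc i)) else 0) (case_nat m v)) (g x))"
    by simp
qed

lemma coef_hscale: "coef m (hscale g * f) = scal (g m) * coef m f"
  by transfer simp

lemma coef_shift: "coef m (shift * f) = (case m of 0 \<Rightarrow> 0 | Suc m' \<Rightarrow> coef m' f)"
  by (cases m; transfer; simp)

abbreviation tails :: "nat \<Rightarrow> 'k::field op \<Rightarrow> 'k op"
  where "tails N \<equiv> tail ^^ N"

lemma tails_0: "tails N 0 = 0" and tails_1: "tails N 1 = 1"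
  and tails_add: "tails N (f + g) = tails N f + tails N g"
  and tails_mult: "tails N (f * g) = tails N f * tails N g"
  and tails_scal: "tails N (scal c) = scal c"
  by (induction N) (simp_all add: tail_0 tail_1 tail_add tail_mult tail_scal)

lemma tails_sum: "tails N (sum f A) = (\<Sum>a\<in>A. tails N (f a))"
  by (induction A rule: infinite_finite_induct) (auto simp: tails_add tails_0)

section \<open>Matrices satisfying the quantum relations\<close>

definition qmatrix :: "nat \<Rightarrow> 'k::field \<Rightarrow> (nat \<Rightarrow> nat \<Rightarrow> 'k op) \<Rightarrow> bool"
  where "qmatrix n q X \<longleftrightarrow> (\<forall>i\<in>{1..n}. \<forall>l\<in>{1..n}. \<forall>j\<in>{1..n}. \<forall>m\<in>{1..n}.
    (i < l \<longrightarrow> X i j * X l j = scal q * (X l j * X i j)) \<and>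
    (j < m \<longrightarrow> X i j * X i m = scal q * (X i m * X i j)) \<and>
    (i < l \<longrightarrow> m < j \<longrightarrow> X i j * X l m = X l m * X i j) \<and>
    (i < l \<longrightarrow> j < m \<longrightarrow>
      X i j * X l m - X l m * X i j = scal (q - inverse q) * (X i m * X l j)))"

text \<open>The two sides of the equation \<open>R X\<^sub>1 X\<^sub>2 = X\<^sub>2 X\<^sub>1 R\<close>, which is equivalent to the quantum
  relations; in this form they visibly pass to products of matrices with commuting entries.\<close>

definition Rleft where
  "Rleft q X i l j m = (if i = l then scal q * (X i j * X i m)
     else X l j * X i m + (if i < l then scal (q - inverse q) * (X i j * X l m) else 0))"

definition Rright where
  "Rright q X i l j m = (if j = m then scal q * (X i j * X l j)
     else X i m * X l j + (if j < m then scal (q - inverse q) * (X i j * X l m) else 0))"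

text \<open>The relations are stated for one order of the indices, the matrix equation for all nine
  combinations of comparisons. When exactly one pair of indices agrees, the coefficient
  \<open>q - inverse q\<close> is what makes up the difference between \<open>inverse q\<close>,
  obtained by reversing a relation, and \<open>q\<close>.\<close>

lemma qmatrix_iff:
  fixes X :: "nat \<Rightarrow> nat \<Rightarrow> 'k::field op"
  assumes "q \<noteq> 0"
  shows "qmatrix n q X \<longleftrightarrow> (\<forall>i\<in>{1..n}. \<forall>l\<in>{1..n}. \<forall>j\<in>{1..n}. \<forall>m\<in>{1..n}.
    Rleft q X i l j m = Rright q X i l j m)"
proof
  have inv: "a = scal q * b \<longleftrightarrow> b = scal (inverse q) * a" for a b :: "'k op"
    using assms by (auto simp: mult.assoc[symmetric] scal_mult[symmetric])
  assume X: "qmatrix n q X"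
  show "\<forall>i\<in>{1..n}. \<forall>l\<in>{1..n}. \<forall>j\<in>{1..n}. \<forall>m\<in>{1..n}.
    Rleft q X i l j m = Rright q X i l j m"
  proof (intro ballI)
    fix i l j m
    assume ij: "i \<in> {1..n}" "l \<in> {1..n}" "j \<in> {1..n}" "m \<in> {1..n}"
    have col: "X l j * X i j = scal (inverse q) * (X i j * X l j)"
      if "i < l" "i \<in> {1..n}" "l \<in> {1..n}" "j \<in> {1..n}" for i l j
      using X that unfolding qmatrix_def inv[symmetric] by blast
    have row: "X i m * X i j = scal (inverse q) * (X i j * X i m)"
      if "j < m" "i \<in> {1..n}" "m \<in> {1..n}" "j \<in> {1..n}" for i j m
      using X that unfolding qmatrix_def inv[symmetric] by blast
    have anti: "X i j * X l m = X l m * X i j"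
      if "i < l" "m < j" "i \<in> {1..n}" "l \<in> {1..n}" "j \<in> {1..n}" "m \<in> {1..n}" for i j l m
      using X that unfolding qmatrix_def by blast
    have diag: "X i j * X l m = X l m * X i j + scal (q - inverse q) * (X i m * X l j)"
      if "i < l" "j < m" "i \<in> {1..n}" "l \<in> {1..n}" "j \<in> {1..n}" "m \<in> {1..n}" for i j l m
    proof -
      have "X i j * X l m - X l m * X i j = scal (q - inverse q) * (X i m * X l j)"
        using X that unfolding qmatrix_def by blast
      then show ?thesis by (simp add: algebra_simps)
    qed
    have qq: "scal q * (scal (inverse q) * f) = f" for f :: "'k op"
      using assms by (simp add: mult.assoc[symmetric] scal_mult[symmetric])
    consider "i < l" "j < m" | "i < l" "j = m" | "i < l" "m < j"
      | "i = l" "j < m" | "i = l" "j = m" | "i = l" "m < j"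
      | "l < i" "j < m" | "l < i" "j = m" | "l < i" "m < j"
      by (metis linorder_cases)
    then show "Rleft q X i l j m = Rright q X i l j m"
    proof cases
      case 1
      then show ?thesis using anti[OF 1] ij by (simp add: Rleft_def Rright_def)
    next
      case 2
      then show ?thesis unfolding Rleft_def Rright_def scal_minus
        using col[OF 2(1)] ij by (simp add: left_diff_distrib)
    next
      case 3
      then show ?thesis using diag[OF 3] ij by (simp add: Rleft_def Rright_def)
    next
      case 4
      then show ?thesis unfolding Rleft_def Rright_def scal_minus
        using row[OF 4(2)] ij by (simp add: left_diff_distrib)
    next
      case 6
      then show ?thesis unfolding Rleft_def Rright_def
        using row[OF 6(2)] ij by (simp add: qq)
    next
      case 7
      have "X l j * X i m = X i m * X l j + scal (q - inverse q) * (X l m * X i j)"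
        "X l m * X i j = X i j * X l m"
        using diag[OF 7] anti[OF 7] ij by simp_all
      then show ?thesis using 7 by (simp add: Rleft_def Rright_def)
    next
      case 8
      then show ?thesis unfolding Rleft_def Rright_def
        using col[OF 8(1)] ij by (simp add: qq)
    next
      case 9
      then show ?thesis using anti[OF 9] ij by (simp add: Rleft_def Rright_def)
    qed (simp add: Rleft_def Rright_def)
  qed
next
  assume R: "\<forall>i\<in>{1..n}. \<forall>l\<in>{1..n}. \<forall>j\<in>{1..n}. \<forall>m\<in>{1..n}. Rleft q X i l j m = Rright q X i l j m"
  show "qmatrix n q X" unfolding qmatrix_def
  proof (intro ballI conjI impI)
    fix i l j m assume ij: "i \<in> {1..n}" "l \<in> {1..n}" "j \<in> {1..n}" "m \<in> {1..n}"
    show "X i j * X l j = scal q * (X l j * X i j)" if "i < l"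
      using R[rule_format, of l i j j] that ij by (simp add: Rleft_def Rright_def)
    show "X i j * X i m = scal q * (X i m * X i j)" if "j < m"
      using R[rule_format, of i i m j] that ij by (simp add: Rleft_def Rright_def)
    show "X i j * X l m = X l m * X i j" if "i < l" "m < j"
      using R[rule_format, of l i j m] R[rule_format, of i l m j] that ij
      by (simp add: Rleft_def Rright_def algebra_simps)
    show "X i j * X l m - X l m * X i j = scal (q - inverse q) * (X i m * X l j)" if "i < l" "j < m"
      using R[rule_format, of i l m j] that ij
      by (simp add: Rleft_def Rright_def algebra_simps)
  qed
qed

text \<open>Because the entries of \<open>X\<close> and \<open>Y\<close> commute, \<open>Z Z\<close>
  splits into an \<open>X X\<close> part and a \<open>Y Y\<close> part. The matrix \<open>R\<close>
  passes first through the \<open>X\<close> part and then through the \<open>Y\<close> part.\<close>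

lemma qmatrix_mult:
  fixes X Y :: "nat \<Rightarrow> nat \<Rightarrow> 'k::field op"
  assumes q: "q \<noteq> 0" and X: "qmatrix n q X" and Y: "qmatrix n q Y"
    and XY: "\<And>i j k l. X i j * Y k l = Y k l * X i j"
  shows "qmatrix n q (\<lambda>i j. \<Sum>k\<in>{1..n}. X i k * Y k j)" (is "qmatrix n q ?Z")
  unfolding qmatrix_iff[OF q]
proof (intro ballI)
  fix i l j m assume ij: "i \<in> {1..n}" "l \<in> {1..n}" "j \<in> {1..n}" "m \<in> {1..n}"
  let ?S = "\<lambda>f. \<Sum>a\<in>{1..n}. \<Sum>b\<in>{1..n}. f a b :: 'k op"
  have ZZ: "?Z i j * ?Z l m = ?S (\<lambda>a b. X i a * X l b * (Y a j * Y b m))" for i l j m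
    unfolding sum_product
  proof (intro sum.cong refl)
    fix a b
    show "X i a * Y a j * (X l b * Y b m) = X i a * X l b * (Y a j * Y b m)"
      using XY[of l b a j] by (metis mult.assoc)
  qed
  have Rl: "?S (\<lambda>a b. Rleft q X i l a b * (Y a j * Y b m)) = Rleft q ?Z i l j m"
    unfolding Rleft_def ZZ
    by (simp add: sum.distrib sum_distrib_left distrib_right mult.assoc)
  have Rr: "?S (\<lambda>a b. X i a * X l b * Rright q Y a b j m) = Rright q ?Z i l j m"
    unfolding Rright_def ZZ
    by (simp add: sum.distrib sum_distrib_left distrib_left mult.assoc scal_left_comm)
  \<comment> \<open>Exchanging the summation indices carries the flip contained in \<open>R\<close>
    from the columns of \<open>X\<close> to the rows of \<open>Y\<close>.\<close>
  have sw: "?S (\<lambda>a b. if a = b then 0 else X i b * X l a * (Y a j * Y b m)) =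
    ?S (\<lambda>a b. if a = b then 0 else X i a * X l b * (Y b j * Y a m))"
    by (subst sum.swap) (intro sum.cong refl, auto)
  have "Rleft q ?Z i l j m = ?S (\<lambda>a b. Rright q X i l a b * (Y a j * Y b m))"
    unfolding Rl[symmetric] using X[unfolded qmatrix_iff[OF q]] ij by (intro sum.cong refl) auto
  also have "\<dots> = ?S (\<lambda>a b. if a = b then 0 else X i b * X l a * (Y a j * Y b m)) +
    ?S (\<lambda>a b. if a = b then scal q * (X i a * X l a * (Y a j * Y a m)) else
      if a < b then scal (q - inverse q) * (X i a * X l b * (Y a j * Y b m)) else 0)"
    unfolding sum.distrib[symmetric]
    by (intro sum.cong refl) (auto simp: Rright_def algebra_simps)
  also have "\<dots> = ?S (\<lambda>a b. X i a * X l b * Rleft q Y a b j m)"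
    unfolding sw sum.distrib[symmetric]
    by (intro sum.cong refl) (auto simp: Rleft_def algebra_simps scal_left_comm)
  also have "\<dots> = ?S (\<lambda>a b. X i a * X l b * Rright q Y a b j m)"
    using Y[unfolded qmatrix_iff[OF q]] ij by (intro sum.cong refl) auto
  finally show "Rleft q ?Z i l j m = Rright q ?Z i l j m" unfolding Rr .
qed

lemma qmatrix_cong:
  assumes "\<And>i j. i \<in> {1..n} \<Longrightarrow> j \<in> {1..n} \<Longrightarrow> X i j = Y i j"
  shows "qmatrix n q X \<longleftrightarrow> qmatrix n q Y"
  unfolding qmatrix_def by (intro ball_cong refl) (simp add: assms)

lemma qmatrix_tail:
  assumes "qmatrix n q X" shows "qmatrix n q (\<lambda>i j. tail (X i j))"
proof -
  have "scal c * tail f = tail (scal c * f)" for c :: 'a and f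
    by (simp add: tail_mult tail_scal)
  note * = this
  show ?thesis
    unfolding qmatrix_def tail_mult[symmetric] tail_minus[symmetric] *
  proof (intro ballI conjI impI arg_cong[of _ _ tail])
    fix i l j m assume "i \<in> {1..n}" "l \<in> {1..n}" "j \<in> {1..n}" "m \<in> {1..n}"
    note rel = assms[unfolded qmatrix_def, rule_format, OF this]
    show "i < l \<Longrightarrow> X i j * X l j = scal q * (X l j * X i j)"
      "j < m \<Longrightarrow> X i j * X i m = scal q * (X i m * X i j)"
      "i < l \<Longrightarrow> m < j \<Longrightarrow> X i j * X l m = X l m * X i j"
      "i < l \<Longrightarrow> j < m \<Longrightarrow>
        X i j * X l m - X l m * X i j = scal (q - inverse q) * (X i m * X l j)"
      using rel by blast+
  qed
qed

lemma qmatrix_tails: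
  assumes "qmatrix n q X" shows "qmatrix n q (\<lambda>i j. tails N (X i j))"
  by (induction N) (use assms qmatrix_tail[of n q "\<lambda>i j. tails _ (X i j)"] in auto)

definition elem_matrix :: "nat \<Rightarrow> nat \<Rightarrow> (nat \<Rightarrow> 'k::field op) \<Rightarrow> 'k op \<Rightarrow> nat \<Rightarrow> nat \<Rightarrow> 'k op"
  where "elem_matrix a b d s i j = (if i = j then d i else if i = a \<and> j = b then s else 0)"

text \<open>Adjacency of \<open>a\<close> and \<open>b\<close> matters: for an index
  \<open>c\<close> strictly between them the last relation would equate 0 with
  \<open>scal (q - inverse q)\<close> times the product of \<open>s\<close> and \<open>d c\<close>.
  The two conditions on \<open>s\<close> are the relations in the row and in the column of the entry
  \<open>s\<close>.\<close>

lemma qmatrix_elem: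
  assumes ab: "b = Suc a \<or> a = Suc b"
    and d: "\<And>i j. d i * d j = d j * d i"
    and s: "d (min a b) * s = scal q * (s * d (min a b))" "s * d (max a b) = scal q * (d (max a b) * s)"
    and c: "\<And>j. j \<noteq> a \<Longrightarrow> j \<noteq> b \<Longrightarrow> d j * s = s * d j"
  shows "qmatrix n q (elem_matrix a b d s)"
  unfolding qmatrix_def
proof (intro ballI conjI impI)
  fix i l j m
  have s1: "d a * s = scal q * (s * d a)" "s * d b = scal q * (d b * s)" if "b = Suc a"
    using s that by (simp_all add: min_def max_def)
  have s2: "d b * s = scal q * (s * d b)" "s * d a = scal q * (d a * s)" if "a = Suc b"
    using s that by (simp_all add: min_def max_def)
  show "elem_matrix a b d s i j * elem_matrix a b d s l j =
    scal q * (elem_matrix a b d s l j * elem_matrix a b d s i j)" if "i < l"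
    using that ab s1 s2 by (auto simp: elem_matrix_def)
  show "elem_matrix a b d s i j * elem_matrix a b d s i m =
    scal q * (elem_matrix a b d s i m * elem_matrix a b d s i j)" if "j < m"
    using that ab s1 s2 by (auto simp: elem_matrix_def)
  show "elem_matrix a b d s i j * elem_matrix a b d s l m =
    elem_matrix a b d s l m * elem_matrix a b d s i j" if "i < l" "m < j"
    using that ab by (auto simp: elem_matrix_def)
  show "elem_matrix a b d s i j * elem_matrix a b d s l m -
    elem_matrix a b d s l m * elem_matrix a b d s i j =
    scal (q - inverse q) * (elem_matrix a b d s i m * elem_matrix a b d s l j)" if "i < l" "j < m"
    using that ab c[of i] c[of l] d[of i l] by (auto simp: elem_matrix_def)
qed

section \<open>Independence of ordered monomials\<close>

definition wprod :: "(nat \<Rightarrow> nat \<Rightarrow> 'k::field op) \<Rightarrow> (nat \<times> nat) list \<Rightarrow> 'k op"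
  where "wprod X w = prod_list (map (\<lambda>(i, j). X i j) w)"

lemma wprod_simps [simp]: "wprod X [] = 1" "wprod X ((i, j) # w) = X i j * wprod X w"
  "wprod X (v @ w) = wprod X v * wprod X w"
  by (simp_all add: wprod_def)

lemma prod_list_commute:
  fixes y :: "'a::monoid_mult"
  shows "(\<And>x. x \<in> set xs \<Longrightarrow> x * y = y * x) \<Longrightarrow> prod_list xs * y = y * prod_list xs"
proof (induction xs)
  case (Cons a xs)
  then have "prod_list xs * y = y * prod_list xs" "a * y = y * a" by auto
  then show ?case by (metis mult.assoc prod_list.Cons)
qed simp

text \<open>Independence of the ordered monomials in \<open>X\<close>, with coefficients in all operators that avoid
  the first \<open>N\<close> variables.\<close>

definition pbw :: "(nat \<Rightarrow> nat \<Rightarrow> 'k::field op) \<Rightarrow> (nat \<times> nat) set \<Rightarrow> nat \<Rightarrow> bool"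
  where "pbw X S N \<longleftrightarrow> (\<forall>F y. finite F \<longrightarrow> (\<forall>w\<in>F. sorted w \<and> set w \<subseteq> S) \<longrightarrow>
    (\<Sum>w\<in>F. wprod X w * tails N (y w)) = 0 \<longrightarrow> (\<forall>w\<in>F. y w = 0))"

text \<open>In \<open>pbw_extend\<close> the new entry \<open>x\<close> is the monomial
  \<open>src\<close> of the old matrix times the new variable, so this is the old word that remains
  after the new variable has been split off.\<close>

definition expand :: "'a \<Rightarrow> 'a list \<Rightarrow> 'a list \<Rightarrow> 'a list"
  where "expand x src w = concat (map (\<lambda>z. if z = x then src else [z]) w)"

lemma expand_simps [simp]: "expand x src [] = []"
  "expand x src (z # w) = (if z = x then src @ expand x src w else z # expand x src w)"
  by (simp_all add: expand_def)

lemma count_expand: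
  "x \<notin> set src \<Longrightarrow> count (mset (expand x src w)) z =
    (if z = x then 0 else count (mset w) z) + count (mset w) x * count (mset src) z"
  by (induction w) (auto simp: count_eq_zero_iff)

text \<open>On sorted words the expansion loses only the number of occurrences of \<open>x\<close>;
  in \<open>pbw_extend\<close> that number is the exponent of the new variable.\<close>

lemma expand_inj:
  assumes "x \<notin> set src" "expand x src w = expand x src w'" "count (mset w) x = count (mset w') x"
    "sorted w" "sorted w'"
  shows "w = w'"
proof -
  have "count (mset w) z = count (mset w') z" for z
    using count_expand[OF assms(1), of w z] count_expand[OF assms(1), of w' z] assms(2,3)
    by (auto split: if_splits)
  then have "mset w = mset w'" by (rule multiset_eqI)
  then show ?thesis using properties_for_sort[of w w'] assms(4,5) sorted_sort_id[of w'] by simp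
qed

text \<open>In powers of the new variable \<open>shift\<close>, the lowest term of a monomial in \<open>X'\<close> is a monomial
  in \<open>X\<close>.\<close>

lemma pbw_extend:
  fixes X X' :: "nat \<Rightarrow> nat \<Rightarrow> 'k::field op"
  assumes X: "pbw X S N" and new: "(i0, j0) \<notin> S" "(i0, j0) \<notin> set src"
    and old: "\<And>i j. (i, j) \<in> S \<Longrightarrow>
      X' i j = tail (X i j) * hscale (g j) + tail (Y i j) * shift"
    and g: "\<And>i j m. (i, j) \<in> S \<Longrightarrow> g j m \<noteq> 0"
    and X'new: "X' i0 j0 = tail (wprod X src) * shift"
    and srt: "\<And>w. sorted w \<Longrightarrow> set w \<subseteq> insert (i0, j0) S \<Longrightarrow>
      sorted (expand (i0, j0) src w) \<and> set (expand (i0, j0) src w) \<subseteq> S"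
  shows "pbw X' (insert (i0, j0) S) (Suc N)"
proof -
  let ?x = "(i0, j0)"
  let ?c = "\<lambda>w. count (mset w) ?x"
  \<comment> \<open>Every new letter contributes exactly one \<open>shift\<close>. An old letter
    contributes none through its \<open>X\<close> summand and one through its \<open>Y\<close>
    summand. Hence the lowest power is the number of new letters, and only \<open>X\<close> summands
    reach it.\<close>
  have lead: "(\<forall>m<?c w. coef m (wprod X' w) = 0) \<and>
    (\<exists>e. e \<noteq> 0 \<and> coef (?c w) (wprod X' w) = scal e * wprod X (expand ?x src w))"
    if "set w \<subseteq> insert ?x S" for w
    using that
  proof (induction w)
    case Nil
    show ?case by (auto simp: coef_1 intro: exI[of _ 1])
  next
    case (Cons z w)
    obtain i j where z: "z = (i, j)" by (cases z)
    obtain e where IH: "\<And>m. m < ?c w \<Longrightarrow> coef m (wprod X' w) = 0" "e \<noteq> 0"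
      "coef (?c w) (wprod X' w) = scal e * wprod X (expand ?x src w)"
      using Cons by auto
    show ?case
    proof (cases "z = ?x")
      case True
      then have c: "?c (z # w) = Suc (?c w)" by simp
      have *: "coef m (wprod X' (z # w)) =
        wprod X src * (case m of 0 \<Rightarrow> 0 | Suc m' \<Rightarrow> coef m' (wprod X' w))" for m
        using True by (simp add: X'new mult.assoc coef_tail_left coef_shift)
      show ?thesis unfolding * c
        using True IH by (auto split: nat.split simp: scal_left_comm intro!: exI[of _ e])
    next
      case False
      then have S: "(i, j) \<in> S" using Cons.prems z by auto
      have c: "?c (z # w) = ?c w" using False by simp
      have *: "coef m (wprod X' (z # w)) = X i j * (scal (g j m) * coef m (wprod X' w)) +
        Y i j * (case m of 0 \<Rightarrow> 0 | Suc m' \<Rightarrow> coef m' (wprod X' w))" for m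
        by (simp add: z old[OF S] distrib_right mult.assoc coef_add coef_tail_left coef_hscale coef_shift)
      have low: "(case m of 0 \<Rightarrow> 0 | Suc m' \<Rightarrow> coef m' (wprod X' w)) = 0" if "m \<le> ?c w" for m
        using that IH(1) by (auto split: nat.split)
      have "X i j * (scal (g j (?c w)) * (scal e * wprod X (expand ?x src w))) =
        scal (g j (?c w) * e) * (X i j * wprod X (expand ?x src w))"
        by (simp only: scal_mult mult.assoc scal_left_comm[of "X i j"])
      then have "coef (?c w) (wprod X' (z # w)) =
        scal (g j (?c w) * e) * wprod X (expand ?x src (z # w))"
        using False unfolding * IH(3) low[OF order_refl] by (auto simp: z)
      moreover have "coef m (wprod X' (z # w)) = 0" if "m < ?c w" for m
        using that IH(1) low[of m] unfolding * by simp
      moreover have "g j (?c w) * e \<noteq> 0" using IH(2) g[OF S] by simp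
      ultimately show ?thesis unfolding c by blast
    qed
  qed
  show ?thesis unfolding pbw_def
  proof (intro allI impI)
    fix F and y :: "(nat \<times> nat) list \<Rightarrow> 'k op"
    assume fin: "finite F" and F: "\<forall>w\<in>F. sorted w \<and> set w \<subseteq> insert ?x S"
      and sum0: "(\<Sum>w\<in>F. wprod X' w * tails (Suc N) (y w)) = 0"
    have "\<exists>e. \<forall>w\<in>F. e w \<noteq> 0 \<and>
      coef (?c w) (wprod X' w) = scal (e w) * wprod X (expand ?x src w)"
      by (rule bchoice) (use lead F in blast)
    then obtain e where e: "\<And>w. w \<in> F \<Longrightarrow> e w \<noteq> 0"
      "\<And>w. w \<in> F \<Longrightarrow> coef (?c w) (wprod X' w) = scal (e w) * wprod X (expand ?x src w)"
      by blast
    show "\<forall>w\<in>F. y w = 0"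
    proof (rule ccontr)
      assume "\<not> (\<forall>w\<in>F. y w = 0)"
      then have ne: "{w \<in> F. y w \<noteq> 0} \<noteq> {}" by auto
      \<comment> \<open>Coefficients of the power \<open>m\<close> are compared, the least number of
        new letters among words with nonzero coefficient. Words with more new letters do not reach
        this power, and those with exactly \<open>m\<close> have distinct expansions.\<close>
      define m where "m = Min (?c ` {w \<in> F. y w \<noteq> 0})"
      define G where "G = {w \<in> F. y w \<noteq> 0 \<and> ?c w = m}"
      have mle: "m \<le> ?c w" if "w \<in> F" "y w \<noteq> 0" for w
        unfolding m_def using that fin by auto
      have "m \<in> ?c ` {w \<in> F. y w \<noteq> 0}"
        unfolding m_def using ne fin by (intro Min_in) auto
      then have G: "G \<noteq> {}" unfolding G_def by auto
      have inj: "inj_on (expand ?x src) G"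
        by (rule inj_onI, rule expand_inj[OF new(2)]) (use F in \<open>auto simp: G_def\<close>)
      define h where "h = the_inv_into G (expand ?x src)"
      have h: "h (expand ?x src w) = w" if "w \<in> G" for w
        unfolding h_def using the_inv_into_f_f[OF inj that] .
      have "0 = coef m (\<Sum>w\<in>F. wprod X' w * tails (Suc N) (y w))" by (simp only: sum0 coef_0)
      also have "\<dots> = (\<Sum>w\<in>F. coef m (wprod X' w) * tails N (y w))"
        by (simp add: coef_sum coef_tail_right)
      also have "\<dots> = (\<Sum>w\<in>G. coef m (wprod X' w) * tails N (y w))"
      proof (rule sum.mono_neutral_right[OF fin])
        show "\<forall>w\<in>F - G. coef m (wprod X' w) * tails N (y w) = 0"
        proof
          fix w assume w: "w \<in> F - G"
          show "coef m (wprod X' w) * tails N (y w) = 0"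
          proof (cases "y w = 0")
            case False
            then have "m < ?c w" using w mle[of w] by (auto simp: G_def)
            then show ?thesis using lead[of w] F w by simp
          qed (simp add: tails_0)
        qed
      qed (auto simp: G_def)
      also have "\<dots> = (\<Sum>w\<in>G. wprod X (expand ?x src w) * tails N (scal (e w) * y w))"
        using e(2) by (intro sum.cong refl)
          (auto simp: G_def tails_mult tails_scal scal_left_comm mult.assoc)
      also have "\<dots> = (\<Sum>v\<in>expand ?x src ` G. wprod X v * tails N (scal (e (h v)) * y (h v)))"
        unfolding sum.reindex[OF inj] by (intro sum.cong refl) (simp add: h)
      finally have "(\<Sum>v\<in>expand ?x src ` G. wprod X v * tails N (scal (e (h v)) * y (h v))) = 0" ..
      moreover have "\<forall>v\<in>expand ?x src ` G. sorted v \<and> set v \<subseteq> S"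
        using F srt by (auto simp: G_def)
      moreover have "finite (expand ?x src ` G)" using fin by (simp add: G_def)
      ultimately have *: "\<forall>v\<in>expand ?x src ` G. scal (e (h v)) * y (h v) = 0"
        using X[unfolded pbw_def, THEN spec[of _ "expand ?x src ` G"],
            THEN spec[of _ "\<lambda>v. scal (e (h v)) * y (h v)"]] by blast
      obtain w where w: "w \<in> G" using G by auto
      then have "scal (e w) * y w = scal (e w) * 0" using * h[of w] by auto
      then have "y w = 0" using e(1)[of w] w scal_cancel[of "e w" "y w" 0] by (auto simp: G_def)
      then show False using w by (simp add: G_def)
    qed
  qed
qed

section \<open>A generic quantum matrix\<close>

text \<open>The invariant of the construction: \<open>S\<close> holds the positions already generic.
  The commutation clause expresses that the entries use only the first \<open>N\<close> variables;
  it later makes \<open>tails N\<close> of the matrix a commuting copy.\<close>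

definition reach :: "nat \<Rightarrow> 'k::field \<Rightarrow> (nat \<times> nat) set \<Rightarrow> bool"
  where "reach n q S \<longleftrightarrow> (\<exists>(X :: nat \<Rightarrow> nat \<Rightarrow> 'k op) N. qmatrix n q X \<and>
    (\<forall>i j y. X i j * tails N y = tails N y * X i j) \<and> pbw X S N \<and>
    (\<forall>i\<in>{1..n}. \<forall>j\<in>{1..n}. (i, j) \<notin> S \<longrightarrow> X i j = (if i = j then 1 else 0)))"

lemma reach_empty: "reach n (q::'k::field) {}"
proof -
  let ?X = "\<lambda>i j. if i = j then 1 else 0 :: 'k op"
  have "pbw ?X {} 0"
    unfolding pbw_def
  proof (intro allI impI)
    fix F :: "(nat \<times> nat) list set" and y :: "(nat \<times> nat) list \<Rightarrow> 'k op"
    assume "\<forall>w\<in>F. sorted w \<and> set w \<subseteq> {}" and sum: "(\<Sum>w\<in>F. wprod ?X w * tails 0 (y w)) = 0"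
    from this(1) have "F \<subseteq> {[]}" by auto
    then consider "F = {}" | "F = {[]}" by blast
    then show "\<forall>w\<in>F. y w = 0" using sum by cases simp_all
  qed
  moreover have "qmatrix n q ?X" by (auto simp: qmatrix_def)
  ultimately show ?thesis
    unfolding reach_def by (intro exI[of _ ?X] exI[of _ 0]) auto
qed

text \<open>The matrix \<open>tail X * E\<close> with \<open>E\<close> elementary.\<close>

definition step_matrix ::
  "nat \<Rightarrow> nat \<Rightarrow> (nat \<Rightarrow> 'k::field op) \<Rightarrow> 'k op \<Rightarrow> (nat \<Rightarrow> nat \<Rightarrow> 'k op) \<Rightarrow> nat \<Rightarrow> nat \<Rightarrow> 'k op"
  where "step_matrix a b d s X i j = tail (X i j) * d j + (if j = b then tail (X i a) * s else 0)"

lemma step_matrix_qmatrix: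
  fixes X :: "nat \<Rightarrow> nat \<Rightarrow> 'k::field op"
  assumes q: "q \<noteq> 0" and X: "qmatrix n q X" and E: "qmatrix n q (elem_matrix a b d s)"
    and ab: "a \<noteq> b" "a \<in> {1..n}"
    and d: "\<And>f j. tail f * d j = d j * tail f" and s: "\<And>f. tail f * s = s * tail f"
  shows "qmatrix n q (step_matrix a b d s X)"
proof -
  have Z: "qmatrix n q (\<lambda>i j. \<Sum>k\<in>{1..n}. tail (X i k) * elem_matrix a b d s k j)"
    by (rule qmatrix_mult[OF q qmatrix_tail[OF X] E]) (simp add: elem_matrix_def d s)
  have *: "(\<Sum>k\<in>{1..n}. tail (X i k) * elem_matrix a b d s k j) = step_matrix a b d s X i j"
    if "j \<in> {1..n}" for i j
  proof -
    have "(\<Sum>k\<in>{1..n}. tail (X i k) * elem_matrix a b d s k j) =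
      (\<Sum>k\<in>{1..n}. (if k = j then tail (X i j) * d j else 0) +
        (if k = a then if j = b then tail (X i a) * s else 0 else 0))"
      using ab by (intro sum.cong refl) (auto simp: elem_matrix_def)
    then show ?thesis using that ab(2) by (simp add: sum.distrib step_matrix_def)
  qed
  show ?thesis by (rule iffD1[OF qmatrix_cong Z]) (rule *)
qed

lemma step_matrix_commute:
  assumes "\<And>i j y. X i j * tails N y = tails N y * X i j"
    and d: "\<And>f j. tail f * d j = d j * tail f" and s: "\<And>f. tail f * s = s * tail f"
  shows "step_matrix a b d s X i j * tails (Suc N) y = tails (Suc N) y * step_matrix a b d s X i j"
proof -
  have *: "tail (X i j) * tail (tails N y) = tail (tails N y) * tail (X i j)" for i j
    using assms(1) by (simp add: tail_mult[symmetric])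
  have "tail (X i j) * c * tail (tails N y) = tail (tails N y) * (tail (X i j) * c)"
    if "tail (tails N y) * c = c * tail (tails N y)" for i j c
    by (simp add: mult.assoc that[symmetric]) (simp add: mult.assoc[symmetric] *)
  note this[OF d] this[OF s]
  then show ?thesis
    by (simp add: step_matrix_def distrib_left distrib_right)
qed

lemma reach_diag:
  fixes q :: "'k::field"
  assumes q: "q \<noteq> 0" and S: "reach n q S" and i0: "i0 \<in> {1..n}" "\<And>i. (i, i0) \<notin> S"
    and Sn: "S \<subseteq> {1..n} \<times> {1..n}"
  shows "reach n q (insert (i0, i0) S)"
proof -
  obtain X :: "nat \<Rightarrow> nat \<Rightarrow> 'k op" and N where X: "qmatrix n q X"
    "\<And>i j y. X i j * tails N y = tails N y * X i j" "pbw X S N"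
    "\<And>i j. i \<in> {1..n} \<Longrightarrow> j \<in> {1..n} \<Longrightarrow> (i, j) \<notin> S \<Longrightarrow> X i j = (if i = j then 1 else 0)"
    using S unfolding reach_def by blast
  define d where "d = (\<lambda>j. if j = i0 then shift else 1 :: 'k op)"
  \<comment> \<open>With \<open>s = 0\<close> the elementary factor is diagonal;
    \<open>Suc i0\<close> is chosen merely as an index adjacent to \<open>i0\<close>.\<close>
  let ?X = "step_matrix i0 (Suc i0) d 0 X"
  have d: "tail f * d j = d j * tail f" for f j by (simp add: d_def tail_shift)
  have "qmatrix n q ?X"
    by (rule step_matrix_qmatrix[OF q X(1) qmatrix_elem]) (use i0 d in \<open>auto simp: d_def\<close>)
  moreover have "?X i j * tails (Suc N) y = tails (Suc N) y * ?X i j" for i j y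
    by (rule step_matrix_commute[OF X(2)]) (simp_all add: d)
  moreover have "pbw ?X (insert (i0, i0) S) (Suc N)"
  proof (rule pbw_extend[where src = "[]", OF X(3)])
    show "?X i j = tail (X i j) * hscale (\<lambda>m. 1) + tail 0 * shift" if "(i, j) \<in> S" for i j
      using that i0(2) by (auto simp: step_matrix_def d_def hscale_1 tail_0)
    show "?X i0 i0 = tail (wprod X []) * shift"
      using X(4)[OF i0(1) i0(1)] i0(2) by (simp add: step_matrix_def d_def tail_1)
    show "sorted (expand (i0, i0) [] w) \<and> set (expand (i0, i0) [] w) \<subseteq> S"
      if "sorted w" "set w \<subseteq> insert (i0, i0) S" for w
    proof -
      have "expand (i0, i0) [] w = filter (\<lambda>z. z \<noteq> (i0, i0)) w" by (induction w) auto
      then show ?thesis using that by (auto simp: sorted_wrt_filter)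
    qed
  qed (use i0 in auto)
  moreover have "?X i j = (if i = j then 1 else 0)"
    if "i \<in> {1..n}" "j \<in> {1..n}" "(i, j) \<notin> insert (i0, i0) S" for i j
    using that X(4)[of i j] by (auto simp: step_matrix_def d_def tail_0 tail_1)
  ultimately show ?thesis unfolding reach_def by blast
qed

text \<open>Right multiplication by the elementary matrix scales the columns and adds column
  \<open>a\<close> times \<open>shift\<close> to column \<open>b\<close>, so the zero at
  \<open>(i0, b)\<close> becomes the generic entry at \<open>(i0, a)\<close> times the new variable.
  The assumption \<open>other\<close> prevents a second zero from being filled at the same time; an
  already generic entry of column \<open>b\<close> only gains a term of higher order in
  \<open>shift\<close>.\<close>

lemma reach_step:
  fixes q :: "'k::field"
  assumes q: "q \<noteq> 0" and S: "reach n q S" and ab: "b = Suc a \<or> a = Suc b"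
    and i0: "a \<in> {1..n}" "i0 \<noteq> b" "i0 \<in> {1..n}" "b \<in> {1..n}"
    and mem: "(i0, b) \<notin> S" "(i0, a) \<in> S"
    and other: "\<And>i. i \<noteq> i0 \<Longrightarrow> (i, a) \<in> S \<Longrightarrow> (i, b) \<in> S"
    and diag: "\<And>i. i \<in> {1..n} \<Longrightarrow> (i, i) \<in> S"
  shows "reach n q (insert (i0, b) S)"
proof -
  obtain X :: "nat \<Rightarrow> nat \<Rightarrow> 'k op" and N where X: "qmatrix n q X"
    "\<And>i j y. X i j * tails N y = tails N y * X i j" "pbw X S N"
    "\<And>i j. i \<in> {1..n} \<Longrightarrow> j \<in> {1..n} \<Longrightarrow> (i, j) \<notin> S \<Longrightarrow> X i j = (if i = j then 1 else 0)"
    using S unfolding reach_def by blast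
  \<comment> \<open>\<open>shift\<close> raises the exponent by one, so scaling by
    \<open>q ^ m\<close> commutes with it up to \<open>q\<close> and scaling by
    \<open>inverse q ^ m\<close> up to \<open>inverse q\<close>. These are the opposite commutations
    that \<open>qmatrix_elem\<close> demands of the smaller and the larger index.\<close>
  define g :: "nat \<Rightarrow> nat \<Rightarrow> 'k" where "g = (\<lambda>j m. if j = min a b then q ^ m
    else if j = max a b then inverse q ^ m else 1)"
  have gnz: "g j m \<noteq> 0" for j m using q by (simp add: g_def)
  let ?d = "\<lambda>j. hscale (g j)"
  let ?X = "step_matrix a b ?d shift X"
  have qi: "q * (inverse q * x) = x" for x
    using q by (simp add: mult.assoc[symmetric])
  have "hscale (g (min a b)) * shift = scal q * (shift * hscale (g (min a b)))"
    by (simp add: hscale_shift g_def scal_left_comm[of shift, symmetric] scal_hscale)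
  moreover have "shift * hscale (g (max a b)) = scal q * (hscale (g (max a b)) * shift)"
    using ab by (auto simp: qi hscale_shift g_def scal_left_comm[of shift, symmetric] scal_hscale)
  moreover have "hscale (g j) * shift = shift * hscale (g j)" if "j \<noteq> a" "j \<noteq> b" for j
    using that by (auto simp: hscale_shift g_def min_def max_def)
  ultimately have E: "qmatrix n q (elem_matrix a b ?d shift)"
    by (intro qmatrix_elem[OF ab]) (auto simp: hscale_comm)
  have "qmatrix n q ?X"
    by (rule step_matrix_qmatrix[OF q X(1) E]) (use ab i0 in \<open>auto simp: tail_hscale tail_shift\<close>)
  moreover have "?X i j * tails (Suc N) y = tails (Suc N) y * ?X i j" for i j y
    by (rule step_matrix_commute[OF X(2)]) (simp_all add: tail_hscale tail_shift)
  moreover have "pbw ?X (insert (i0, b) S) (Suc N)"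
  proof (rule pbw_extend[where src = "[(i0, a)]", OF X(3) mem(1)])
    show "?X i j = tail (X i j) * hscale (g j) + tail (if j = b then X i a else 0) * shift"
      for i j
      by (simp add: step_matrix_def tail_0)
    show "?X i0 b = tail (wprod X [(i0, a)]) * shift"
      using X(4)[OF i0(3,4)] mem(1) i0(2) by (simp add: step_matrix_def tail_0)
    show "sorted (expand (i0, b) [(i0, a)] w) \<and> set (expand (i0, b) [(i0, a)] w) \<subseteq> S"
      if w: "sorted w" "set w \<subseteq> insert (i0, b) S" for w
    proof -
      let ?f = "\<lambda>z. if z = (i0, b) then (i0, a) else z"
      have "expand (i0, b) [(i0, a)] w = map ?f w" by (induction w) auto
      \<comment> \<open>No letter lies strictly between two horizontally adjacent positions, so
        replacing one by the other preserves the lexicographic order weakly.\<close>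
      moreover have "mono ?f"
      proof (rule monoI)
        fix x y :: "nat \<times> nat" assume "x \<le> y"
        then show "?f x \<le> ?f y"
          using ab by (cases x; cases y) (auto simp: less_eq_prod_def)
      qed
      then have "sorted (map ?f w)"
        unfolding sorted_map by (intro sorted_wrt_mono_rel[OF _ w(1)]) (rule monoD)
      ultimately show ?thesis using w(2) mem(2) by auto
    qed
  qed (use ab gnz in auto)
  moreover have "?X i j = (if i = j then 1 else 0)"
    if ij: "i \<in> {1..n}" "j \<in> {1..n}" "(i, j) \<notin> insert (i0, b) S" for i j
  proof -
    have "i \<noteq> j" using diag ij by auto
    then have "X i j = 0" using X(4)[of i j] ij by auto
    moreover have "X i a = 0" if "j = b"
    proof -
      have "(i, a) \<notin> S" using ij that other by auto
      then show ?thesis using X(4)[of i a] ij i0 diag by auto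
    qed
    ultimately show ?thesis using \<open>i \<noteq> j\<close> by (simp add: step_matrix_def tail_0)
  qed
  ultimately show ?thesis unfolding reach_def by blast
qed

lemma reach_diagonal:
  assumes "q \<noteq> 0" "k \<le> n"
  shows "reach n q {(i, j). i = j \<and> 1 \<le> i \<and> i \<le> k}"
  using assms(2)
proof (induction k)
  case 0
  have "{(i, j). i = j \<and> 1 \<le> i \<and> i \<le> (0::nat)} = {}" by auto
  then show ?case by (simp only: reach_empty)
next
  case (Suc k)
  have "{(i, j). i = j \<and> 1 \<le> i \<and> i \<le> Suc k} =
    insert (Suc k, Suc k) {(i, j). i = j \<and> 1 \<le> i \<and> i \<le> k}" by auto
  moreover have "reach n q (insert (Suc k, Suc k) {(i, j). i = j \<and> 1 \<le> i \<and> i \<le> k})"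
    by (rule reach_diag[OF assms(1) Suc.IH]) (use Suc.prems in auto)
  ultimately show ?case by (simp only:)
qed

text \<open>Below the diagonal the rows are filled from top to bottom, each from the diagonal
  leftwards. The order serves \<open>other\<close> in \<open>reach_step\<close>: when column
  \<open>Suc b\<close> feeds column \<open>b\<close>, its diagonal entry lies in row
  \<open>Suc b\<close>, which is either the current row or one already filled.\<close>

definition lowS :: "nat \<Rightarrow> nat \<Rightarrow> nat \<Rightarrow> (nat \<times> nat) set"
  where "lowS n i b = {(r, c). r \<in> {1..n} \<and> c \<in> {1..n} \<and> (r = c \<or> c \<le> r \<and> r \<le> i \<or> r = Suc i \<and> b \<le> c \<and> c \<le> r)}"

text \<open>Above the diagonal the rows are filled from bottom to top, each rightwards, for the
  mirrored reason: the diagonal entry of the source column lies in the current row or in one already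
  full.\<close>

definition upS :: "nat \<Rightarrow> nat \<Rightarrow> nat \<Rightarrow> (nat \<times> nat) set"
  where "upS n i b = {(r, c). r \<in> {1..n} \<and> c \<in> {1..n} \<and> (c \<le> r \<or> i < r \<or> r = i \<and> c \<le> b)}"

lemma reach_lower:
  assumes q: "q \<noteq> 0" and "i \<le> n"
  shows "reach n q (lowS n i (Suc i))"
  using assms(2)
proof (induction i)
  case 0
  have "lowS n 0 (Suc 0) = {(i, j). i = j \<and> 1 \<le> i \<and> i \<le> n}"
    by (auto simp: lowS_def)
  then show ?case using reach_diagonal[OF q, of n n] by simp
next
  case (Suc i)
  have "1 \<le> Suc i" by simp
  then have "reach n q (lowS n i 1)"
  proof (induction rule: inc_induct)
    case base
    then show ?case using Suc by simp
  next
    case (step b)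
    have "lowS n i b = insert (Suc i, b) (lowS n i (Suc b))"
      using step Suc.prems by (auto simp: lowS_def)
    moreover have "reach n q (insert (Suc i, b) (lowS n i (Suc b)))"
      by (rule reach_step[OF q step.IH, of b "Suc b"])
        (use step Suc.prems in \<open>auto simp: lowS_def\<close>)
    ultimately show ?case by simp
  qed
  moreover have "lowS n i 1 = lowS n (Suc i) (Suc (Suc i))"
    using Suc.prems by (auto simp: lowS_def)
  ultimately show ?case by simp
qed

lemma reach_upper:
  assumes q: "q \<noteq> 0" and "i \<le> n"
  shows "reach n q (upS n i i)"
  using assms(2)
proof (induction rule: inc_induct)
  case base
  have "upS n n n = lowS n n (Suc n)" by (auto simp: upS_def lowS_def)
  then show ?case using reach_lower[OF q, of n n] by simp
next
  case (step i)
  have "reach n q (upS n (Suc i) m)" if "Suc i \<le> m" "m \<le> n" for m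
    using that
  proof (induction rule: dec_induct)
    case base
    show ?case by (rule step.IH)
  next
    case (step b)
    have "upS n (Suc i) (Suc b) = insert (Suc i, Suc b) (upS n (Suc i) b)"
      using step by (auto simp: upS_def)
    moreover have "reach n q (insert (Suc i, Suc b) (upS n (Suc i) b))"
      by (rule reach_step[OF q step.IH[OF Suc_leD[OF step.prems]], of "Suc b" b]) (use step in \<open>auto simp: upS_def\<close>)
    ultimately show ?case by simp
  qed
  moreover have "upS n (Suc i) n = upS n i i" by (auto simp: upS_def)
  ultimately show ?case using step.hyps by (metis Suc_leI order_refl)
qed

lemma pbw_exists:
  fixes q :: "'k::field"
  assumes "q \<noteq> 0"
  obtains X :: "nat \<Rightarrow> nat \<Rightarrow> 'k op" and N where "qmatrix n q X"
    "\<And>i j y. X i j * tails N y = tails N y * X i j" "pbw X ({1..n} \<times> {1..n}) N"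
proof -
  have "upS n 0 0 = {1..n} \<times> {1..n}" by (auto simp: upS_def)
  then show ?thesis using reach_upper[OF assms, of 0 n] that unfolding reach_def by auto
qed

section \<open>Noncommutative polynomials modulo the relations\<close>

definition mon :: "'k::field \<Rightarrow> (nat \<times> nat) list \<Rightarrow> 'k nc_poly"
  where "mon c w = Poly_Mapping.single (NC_Word w) c"

definition words :: "'k::field nc_poly \<Rightarrow> (nat \<times> nat) list set"
  where "words p = letters ` Poly_Mapping.keys p"

definition wcoeff :: "'k::field nc_poly \<Rightarrow> (nat \<times> nat) list \<Rightarrow> 'k"
  where "wcoeff p w = Poly_Mapping.lookup p (NC_Word w)"

lemma words_iff: "w \<in> words p \<longleftrightarrow> wcoeff p w \<noteq> 0"
  unfolding words_def wcoeff_def in_keys_iff[symmetric]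
  by (metis image_iff nc_word.collapse nc_word.sel)

lemma finite_words: "finite (words p)"
  by (simp add: words_def)

lemma wcoeff_simps [simp]:
  "wcoeff 0 w = 0" "wcoeff (p + p') w = wcoeff p w + wcoeff p' w"
  "wcoeff (p - p') w = wcoeff p w - wcoeff p' w" "wcoeff (- p) w = - wcoeff p w"
  by (simp_all add: wcoeff_def lookup_add lookup_minus)

lemma wcoeff_sum: "wcoeff (sum f A) w = (\<Sum>a\<in>A. wcoeff (f a) w)"
  by (induction A rule: infinite_finite_induct) auto

lemma wcoeff_mon: "wcoeff (mon c v) w = (if v = w then c else 0)"
  by (simp add: mon_def wcoeff_def lookup_single when_def)

lemma poly_eqI: "(\<And>w. wcoeff p w = wcoeff p' w) \<Longrightarrow> p = p'"
  unfolding wcoeff_def by (rule poly_mapping_eqI) (metis nc_word.collapse)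

lemma mon_0 [simp]: "mon 0 w = 0"
  by (simp add: mon_def)

lemma mon_mult: "mon c v * mon d w = mon (c * d) (v @ w)"
  by (simp add: mon_def mult_single plus_nc_word_def)

lemma mon_Nil: "mon 1 [] = 1"
  by (simp add: mon_def zero_nc_word_def[symmetric])

lemma nc_const_mon: "nc_const c = mon c []"
  by (simp add: mon_def nc_const_def zero_nc_word_def)

lemma nc_var_mon: "nc_var i j = mon 1 [(i, j)]"
  by (simp add: mon_def nc_var_def)

lemma poly_decompose: "finite A \<Longrightarrow> words p \<subseteq> A \<Longrightarrow> p = (\<Sum>w\<in>A. mon (wcoeff p w) w)"
  by (rule poly_eqI) (auto simp: wcoeff_sum wcoeff_mon words_iff sum.delta)

lemma poly_decompose': "p = (\<Sum>w\<in>words p. mon (wcoeff p w) w)"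
  using poly_decompose[OF finite_words] by blast

lemma wcoeff_const_mult: "wcoeff (nc_const c * p) w = c * wcoeff p w"
  by (subst poly_decompose'[of p])
    (auto simp: nc_const_mon sum_distrib_left mon_mult wcoeff_sum wcoeff_mon words_iff
      finite_words sum.delta)

lemma words_mult: "words (p * p') \<subseteq> {v @ w | v w. v \<in> words p \<and> w \<in> words p'}"
proof
  fix x assume "x \<in> words (p * p')"
  then obtain k where k: "k \<in> Poly_Mapping.keys (p * p')" "x = letters k"
    unfolding words_def by blast
  obtain a b where "a \<in> Poly_Mapping.keys p" "b \<in> Poly_Mapping.keys p'" "k = a + b"
    using k(1) by (rule keys_nc_mult)
  then have "letters a \<in> words p" "letters b \<in> words p'" "x = letters a @ letters b"
    by (simp_all add: words_def k plus_nc_word_def)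
  then show "x \<in> {v @ w | v w. v \<in> words p \<and> w \<in> words p'}" by blast
qed

lemma words_add: "words (p + p') \<subseteq> words p \<union> words p'"
  by (auto simp: words_iff)

lemma words_sum: "words (sum f A) \<subseteq> (\<Union>a\<in>A. words (f a))"
proof
  fix w assume "w \<in> words (sum f A)"
  then have "(\<Sum>a\<in>A. wcoeff (f a) w) \<noteq> 0" by (simp add: words_iff wcoeff_sum)
  then obtain a where "a \<in> A" "wcoeff (f a) w \<noteq> 0"
    by (rule sum.not_neutral_contains_not_neutral)
  then show "w \<in> (\<Union>a\<in>A. words (f a))" by (auto simp: words_iff)
qed

lemma words_const_mult: "words (nc_const c * p) \<subseteq> words p"
  by (auto simp: words_iff wcoeff_const_mult)

lemma words_mon: "words (mon c w) \<subseteq> {w}"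
  by (auto simp: words_iff wcoeff_mon split: if_splits)

lemma words_0 [simp]: "words 0 = {}"
  by (auto simp: words_iff)

lemma carrier_free_alg: "carrier (free_alg n) = {p. \<forall>w\<in>words p. set w \<subseteq> {1..n} \<times> {1..n}}"
  by (auto simp: free_alg_def words_def)

lemma carrierI: "(\<And>w. w \<in> words p \<Longrightarrow> set w \<subseteq> {1..n} \<times> {1..n}) \<Longrightarrow> p \<in> carrier (free_alg n)"
  by (simp add: carrier_free_alg)

lemma mon_carrier: "set w \<subseteq> {1..n} \<times> {1..n} \<Longrightarrow> mon c w \<in> carrier (free_alg n)"
  using words_mon[of c w] by (auto simp: carrier_free_alg)

lemma free_alg_add: "p \<in> carrier (free_alg n) \<Longrightarrow> p' \<in> carrier (free_alg n) \<Longrightarrow>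
    p + p' \<in> carrier (free_alg n)"
  using words_add[of p p'] by (auto simp: carrier_free_alg)

lemma free_alg_sum: "(\<And>a. a \<in> A \<Longrightarrow> f a \<in> carrier (free_alg n)) \<Longrightarrow> sum f A \<in> carrier (free_alg n)"
  using words_sum[of f A] unfolding carrier_free_alg by fast

section \<open>Congruence modulo the defining relations\<close>

context
  fixes n :: nat and q :: "'k::field"
begin

lemma ideal_0: "0 \<in> qmat_ideal n q"
  using additive_subgroup.zero_closed[OF ideal.axioms(1)[OF qmat_ideal[of n q]]]
  by (simp add: free_alg_simps)

lemma ideal_add: "x \<in> qmat_ideal n q \<Longrightarrow> y \<in> qmat_ideal n q \<Longrightarrow> x + y \<in> qmat_ideal n q"
  using additive_subgroup.a_closed[OF ideal.axioms(1)[OF qmat_ideal[of n q]]]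
  by (simp add: free_alg_simps)

lemma ideal_lmult: "p \<in> carrier (free_alg n) \<Longrightarrow> x \<in> qmat_ideal n q \<Longrightarrow> p * x \<in> qmat_ideal n q"
  using ideal.I_l_closed[OF qmat_ideal[of n q]] by (simp add: free_alg_simps)

lemma ideal_rmult: "p \<in> carrier (free_alg n) \<Longrightarrow> x \<in> qmat_ideal n q \<Longrightarrow> x * p \<in> qmat_ideal n q"
  using ideal.I_r_closed[OF qmat_ideal[of n q]] by (simp add: free_alg_simps)

lemma ideal_const: "x \<in> qmat_ideal n q \<Longrightarrow> nc_const c * x \<in> qmat_ideal n q"
  by (rule ideal_lmult) simp_all

lemma ideal_uminus: "x \<in> qmat_ideal n q \<Longrightarrow> - x \<in> qmat_ideal n q"
  using ideal_const[of x "-1"] by (simp add: nc_const_def single_uminus)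

lemma ideal_sum: "(\<And>a. a \<in> A \<Longrightarrow> f a \<in> qmat_ideal n q) \<Longrightarrow> sum f A \<in> qmat_ideal n q"
  by (induction A rule: infinite_finite_induct) (auto simp: ideal_0 ideal_add)

lemma ideal_rels: "x \<in> qmat_rels n q \<Longrightarrow> x \<in> qmat_ideal n q"
  using ring.genideal_self[OF free_alg_ring qmat_rels_carrier[of n q]]
  unfolding qmat_ideal_def by blast

definition cong :: "'k nc_poly \<Rightarrow> 'k nc_poly \<Rightarrow> bool" (infix "\<approx>" 50)
  where "p \<approx> p' \<longleftrightarrow> p - p' \<in> qmat_ideal n q"

lemma cong_refl: "p \<approx> p"
  by (simp add: cong_def ideal_0)

lemma cong_sym: "p \<approx> p' \<Longrightarrow> p' \<approx> p"
  using ideal_uminus[of "p - p'"] by (simp add: cong_def)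

lemma cong_trans: "p \<approx> p' \<Longrightarrow> p' \<approx> p'' \<Longrightarrow> p \<approx> p''"
  using ideal_add[of "p - p'" "p' - p''"] by (simp add: cong_def)

lemma cong_add: "p \<approx> p' \<Longrightarrow> r \<approx> r' \<Longrightarrow> p + r \<approx> p' + r'"
  using ideal_add[of "p - p'" "r - r'"] by (simp add: cong_def algebra_simps)

lemma cong_sum: "(\<And>a. a \<in> A \<Longrightarrow> f a \<approx> g a) \<Longrightarrow> sum f A \<approx> sum g A"
  using ideal_sum[of A "\<lambda>a. f a - g a"] by (simp add: cong_def sum_subtractf)

lemma cong_const: "p \<approx> p' \<Longrightarrow> nc_const c * p \<approx> nc_const c * p'"
  using ideal_const[of "p - p'" c] by (simp add: cong_def right_diff_distrib)

text \<open>The type of polynomials also contains letters with indices outside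
  \<open>{1..n}\<close>, and the ideal absorbs only factors from the carrier.\<close>

lemma cong_context:
  assumes "p \<approx> p'" "u \<in> carrier (free_alg n)" "v \<in> carrier (free_alg n)"
  shows "u * p * v \<approx> u * p' * v"
  using ideal_rmult[OF assms(3) ideal_lmult[OF assms(2)], of "p - p'"] assms(1)
  by (simp add: cong_def right_diff_distrib left_diff_distrib)

end

section \<open>Reordering words\<close>

fun inversions :: "'a::linorder list \<Rightarrow> nat" where
  "inversions [] = 0"
| "inversions (x # xs) = length (filter (\<lambda>y. y < x) xs) + inversions xs"

lemma inversions_swap:
  "x < y \<Longrightarrow> inversions (us @ [y, x] @ vs) = Suc (inversions (us @ [x, y] @ vs))"
  by (induction us) auto

lemma adjacent_failure:
  assumes "\<not> sorted_wrt P xs" "transp P"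
  obtains us y x vs where "xs = us @ [y, x] @ vs" "\<not> P y x"
proof -
  obtain i where i: "Suc i < length xs" "\<not> P (xs ! i) (xs ! Suc i)"
    using assms sorted_wrt_iff_nth_Suc_transp by blast
  have "xs = take i xs @ [xs ! i, xs ! Suc i] @ drop (Suc (Suc i)) xs"
    using i(1) by (metis Cons_nth_drop_Suc Suc_lessD append_Cons append_Nil append_take_drop_id)
  with i(2) that show ?thesis by blast
qed

lemma descent:
  fixes xs :: "'a::linorder list"
  assumes "\<not> sorted xs"
  obtains us y x vs where "xs = us @ [y, x] @ vs" "x < y"
proof (rule adjacent_failure[OF assms])
  show "transp ((\<le>) :: 'a \<Rightarrow> _)" by (rule transp_on_le)
next
  fix us y x vs assume "xs = us @ [y, x] @ vs" "\<not> y \<le> x"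
  with that show thesis by (simp add: not_le)
qed

lemma inversions_sorted: "sorted xs \<Longrightarrow> inversions xs = 0"
  by (induction xs) (auto simp: filter_empty_conv not_less)

definition wdeg :: "(nat \<times> nat) list \<Rightarrow> nat"
  where "wdeg w = sum_list (map (\<lambda>(i, j). i * j) w)"

lemma wdeg_simps [simp]: "wdeg [] = 0" "wdeg ((i, j) # w) = i * j + wdeg w"
  "wdeg (v @ w) = wdeg v + wdeg w"
  by (simp_all add: wdeg_def)

text \<open>The weight \<open>i * j\<close> makes the correction term \<open>X\<^sub>i\<^sub>m X\<^sub>l\<^sub>j\<close> of the last relation smaller than
  \<open>X\<^sub>i\<^sub>j X\<^sub>l\<^sub>m\<close>, see \<open>exchange_degree\<close>.\<close>

definition below :: "nat \<Rightarrow> (nat \<times> nat) list \<Rightarrow> (nat \<times> nat) list set"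
  where "below n w = {v. set v \<subseteq> {1..n} \<times> {1..n} \<and> wdeg v < wdeg w \<and>
    mset (map fst v) = mset (map fst w) \<and> mset (map snd v) = mset (map snd w)}"

lemma wdeg_mset: "mset v = mset w \<Longrightarrow> wdeg v = wdeg w"
  unfolding wdeg_def by (metis mset_map sum_mset_sum_list)

lemma below_mset:
  assumes "mset v = mset w" shows "below n v = below n w"
proof -
  have "mset (map f v) = mset (map f w)" for f :: "nat \<times> nat \<Rightarrow> nat"
    using assms by (metis mset_map)
  then show ?thesis using wdeg_mset[OF assms] by (simp add: below_def)
qed

lemma below_trans: "v \<in> below n w \<Longrightarrow> below n v \<subseteq> below n w"
  by (auto simp: below_def)

lemma below_context:
  "v \<in> below n w \<Longrightarrow> set us \<subseteq> {1..n} \<times> {1..n} \<Longrightarrow> set vs \<subseteq> {1..n} \<times> {1..n} \<Longrightarrow>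
    us @ v @ vs \<in> below n (us @ w @ vs)"
  by (auto simp: below_def)

text \<open>The difference of the two sides is \<open>(l - i) * (m - j)\<close>.\<close>

lemma exchange_degree:
  fixes i l j m :: nat
  assumes "i < l" "j < m"
  shows "i * m + l * j < i * j + l * m"
proof -
  obtain a b where "l = i + Suc a" "m = j + Suc b"
    using assms by (metis less_iff_Suc_add add_Suc_right)
  then show ?thesis by (simp add: algebra_simps)
qed

lemma qmat_rels_mon:
  assumes "i \<in> {1..n}" "j \<in> {1..n}" "l \<in> {1..n}" "m \<in> {1..n}"
  shows "i < l \<Longrightarrow> mon 1 [(i, j), (l, j)] - mon q [(l, j), (i, j)] \<in> qmat_rels n q"
    and "j < m \<Longrightarrow> mon 1 [(i, j), (i, m)] - mon q [(i, m), (i, j)] \<in> qmat_rels n q"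
    and "i < l \<Longrightarrow> m < j \<Longrightarrow> mon 1 [(i, j), (l, m)] - mon 1 [(l, m), (i, j)] \<in> qmat_rels n q"
    and "i < l \<Longrightarrow> j < m \<Longrightarrow> mon 1 [(i, j), (l, m)] - mon 1 [(l, m), (i, j)] -
      mon (q - inverse q) [(i, m), (l, j)] \<in> qmat_rels n q"
proof -
  have "i < l \<Longrightarrow> nc_var i j * nc_var l j - nc_const q * (nc_var l j * nc_var i j) \<in> qmat_rels n q"
    "j < m \<Longrightarrow> nc_var i j * nc_var i m - nc_const q * (nc_var i m * nc_var i j) \<in> qmat_rels n q"
    "i < l \<Longrightarrow> m < j \<Longrightarrow> nc_var i j * nc_var l m - nc_var l m * nc_var i j \<in> qmat_rels n q"
    "i < l \<Longrightarrow> j < m \<Longrightarrow> nc_var i j * nc_var l m - nc_var l m * nc_var i j -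
      nc_const (q - inverse q) * (nc_var i m * nc_var l j) \<in> qmat_rels n q"
    unfolding qmat_rels_def using assms by blast+
  then show "i < l \<Longrightarrow> mon 1 [(i, j), (l, j)] - mon q [(l, j), (i, j)] \<in> qmat_rels n q"
    "j < m \<Longrightarrow> mon 1 [(i, j), (i, m)] - mon q [(i, m), (i, j)] \<in> qmat_rels n q"
    "i < l \<Longrightarrow> m < j \<Longrightarrow> mon 1 [(i, j), (l, m)] - mon 1 [(l, m), (i, j)] \<in> qmat_rels n q"
    "i < l \<Longrightarrow> j < m \<Longrightarrow> mon 1 [(i, j), (l, m)] - mon 1 [(l, m), (i, j)] -
      mon (q - inverse q) [(i, m), (l, j)] \<in> qmat_rels n q"
    by (simp_all add: nc_var_mon nc_const_mon mon_mult)
qed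

lemma exchange:
  fixes q :: "'k::field"
  assumes q: "q \<noteq> 0" and xy: "x < y" "x \<in> {1..n} \<times> {1..n}" "y \<in> {1..n} \<times> {1..n}"
  obtains c r where "c \<noteq> 0" "words r \<subseteq> below n [y, x]" "cong n q (mon 1 [y, x]) (mon c [x, y] + r)"
proof -
  obtain i j l m where x: "x = (i, j)" and y: "y = (l, m)" by (cases x, cases y) auto
  have ij: "i \<in> {1..n}" "j \<in> {1..n}" "l \<in> {1..n}" "m \<in> {1..n}" using xy x y by auto
  \<comment> \<open>The \<open>q\<close>-commutation relation solved for the word in the wrong
    order; it has the same form for two letters in one row and for two in one column.\<close>
  have scal: "mon 1 [y, x] - mon (inverse q) [x, y] = nc_const (- inverse q) *
      (mon 1 [x, y] - mon q [y, x])"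
    using q by (intro poly_eqI) (auto simp: wcoeff_const_mult wcoeff_mon field_simps)
  consider "i < l" "j < m" | "i < l" "j = m" | "i < l" "m < j" | "i = l" "j < m"
    using xy(1) x y by (cases i l rule: linorder_cases; cases j m rule: linorder_cases)
      (auto simp: less_prod_def)
  then show ?thesis
  proof cases
    case 1
    let ?r = "mon (- (q - inverse q)) [(i, m), (l, j)]"
    have "mon 1 [x, y] - mon 1 [y, x] - mon (q - inverse q) [(i, m), (l, j)] \<in> qmat_rels n q"
      unfolding x y using 1 ij by (intro qmat_rels_mon)
    from ideal_uminus[OF ideal_rels[OF this]] have "cong n q (mon 1 [y, x]) (mon 1 [x, y] + ?r)"
      unfolding cong_def by (simp add: algebra_simps mon_def single_diff single_uminus)
    moreover have "words ?r \<subseteq> below n [y, x]"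
      using words_mon[of "- (q - inverse q)" "[(i, m), (l, j)]"] exchange_degree[OF 1] ij x y
      by (auto simp: below_def)
    ultimately show ?thesis by (intro that[of 1 ?r]) auto
  next
    case 2
    have "mon 1 [x, y] - mon q [y, x] \<in> qmat_rels n q"
      unfolding x y using 2 ij qmat_rels_mon(1) by blast
    from ideal_const[OF ideal_rels[OF this]] scal show ?thesis
      using q by (intro that[of "inverse q" 0]) (simp_all add: cong_def)
  next
    case 3
    have "mon 1 [x, y] - mon 1 [y, x] \<in> qmat_rels n q"
      unfolding x y using 3 ij by (intro qmat_rels_mon)
    from ideal_uminus[OF ideal_rels[OF this]] show ?thesis
      by (intro that[of 1 0]) (simp_all add: cong_def)
  next
    case 4
    have "mon 1 [x, y] - mon q [y, x] \<in> qmat_rels n q"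
      unfolding x y using 4 ij qmat_rels_mon(2) by blast
    from ideal_const[OF ideal_rels[OF this]] scal show ?thesis
      using q by (intro that[of "inverse q" 0]) (simp_all add: cong_def)
  qed
qed

lemma cong_words:
  fixes p :: "'k::field nc_poly"
  assumes "\<And>w. w \<in> words p \<Longrightarrow> \<exists>p'. words p' \<subseteq> A \<and> cong n q (mon 1 w) p'"
  shows "\<exists>p'. words p' \<subseteq> A \<and> cong n q p p'"
proof -
  have "\<exists>f. \<forall>w\<in>words p. words (f w) \<subseteq> A \<and> cong n q (mon 1 w) (f w)"
    by (rule bchoice) (use assms in blast)
  then obtain f where f: "\<And>w. w \<in> words p \<Longrightarrow> words (f w) \<subseteq> A"
    "\<And>w. w \<in> words p \<Longrightarrow> cong n q (mon 1 w) (f w)" by blast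
  let ?p = "\<Sum>w\<in>words p. nc_const (wcoeff p w) * f w"
  have "words ?p \<subseteq> A"
    using words_sum[of "\<lambda>w. nc_const (wcoeff p w) * f w" "words p"] words_const_mult f(1) by blast
  moreover have "cong n q (\<Sum>w\<in>words p. mon (wcoeff p w) w) ?p"
    using cong_const[OF f(2)] by (intro cong_sum) (simp add: nc_const_mon mon_mult)
  ultimately show ?thesis using poly_decompose'[of p] by auto
qed

lemma sorted_below: "v \<in> below n w \<Longrightarrow> sort v \<in> below n w"
  using below_mset[of "sort v" v] by (auto simp: below_def wdeg_mset[of "sort v" v])

text \<open>Two nested inductions. Swapping a descent keeps the weight and lowers the number of
  inversions; the correction term may have many inversions but has smaller weight, so the outer
  induction handles it. The coefficient \<open>u\<close> stays nonzero as a product of nonzero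
  exchange factors.\<close>

lemma reorder:
  fixes q :: "'k::field"
  assumes q: "q \<noteq> 0" and w: "set w \<subseteq> {1..n} \<times> {1..n}"
  shows "\<exists>u r. u \<noteq> 0 \<and> words r \<subseteq> {v \<in> below n w. sorted v} \<and>
    cong n q (mon 1 w) (mon u (sort w) + r)"
  using w
proof (induction "wdeg w" arbitrary: w rule: less_induct)
  case (less w)
  note IH = less.hyps
  have low: "\<exists>r'. words r' \<subseteq> {v \<in> below n v0. sorted v} \<and> cong n q r r'"
    if r: "words r \<subseteq> below n v0" and v0: "wdeg v0 = wdeg w" for r :: "'k nc_poly" and v0
  proof (rule cong_words)
    fix v assume v: "v \<in> words r"
    then have vw: "v \<in> below n v0" using r by auto
    then obtain u r' where *: "words r' \<subseteq> {v' \<in> below n v. sorted v'}"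
      "cong n q (mon 1 v) (mon u (sort v) + r')"
      using v0 IH[of v] by (auto simp: below_def)
    have "words (mon u (sort v) + r') \<subseteq> {v \<in> below n v0. sorted v}"
      using words_add[of "mon u (sort v)" r'] words_mon[of u "sort v"] sorted_below[OF vw]
        *(1) below_trans[OF vw] sorted_sort[of v] by blast
    with *(2) show "\<exists>p'. words p' \<subseteq> {v \<in> below n v0. sorted v} \<and> cong n q (mon 1 v) p'" by blast
  qed
  have "\<exists>u r. u \<noteq> 0 \<and> words r \<subseteq> {v' \<in> below n v. sorted v'} \<and>
    cong n q (mon 1 v) (mon u (sort v) + r)"
    if "wdeg v = wdeg w" "set v \<subseteq> {1..n} \<times> {1..n}" for v
    using that
  proof (induction "inversions v" arbitrary: v rule: less_induct)
    case (less v)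
    show ?case
    proof (cases "sorted v")
      case True
      then show ?thesis
        by (intro exI[of _ 1] exI[of _ 0]) (simp add: sorted_sort_id cong_refl)
    next
      case False
      then obtain us y x vs where v: "v = us @ [y, x] @ vs" and yx: "x < y"
        by (rule descent)
      have rng: "x \<in> {1..n} \<times> {1..n}" "y \<in> {1..n} \<times> {1..n}"
        "set us \<subseteq> {1..n} \<times> {1..n}" "set vs \<subseteq> {1..n} \<times> {1..n}"
        using less.prems(2) unfolding v by auto
      obtain c r where r: "c \<noteq> 0" "words r \<subseteq> below n [y, x]"
        "cong n q (mon 1 [y, x]) (mon c [x, y] + r)"
        using exchange[OF q yx rng(1,2)] by blast
      let ?v = "us @ [x, y] @ vs" and ?r = "mon 1 us * r * mon 1 vs"
      have ms: "mset ?v = mset v" unfolding v by simp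
      have "inversions ?v < inversions v" unfolding v inversions_swap[OF yx] by simp
      moreover have "wdeg ?v = wdeg w" using wdeg_mset[OF ms] less.prems(1) by simp
      moreover have "set ?v \<subseteq> {1..n} \<times> {1..n}" using rng by simp
      ultimately obtain u1 r1 where r1: "u1 \<noteq> 0" "words r1 \<subseteq> {v' \<in> below n ?v. sorted v'}"
        "cong n q (mon 1 ?v) (mon u1 (sort ?v) + r1)"
        using less.hyps[of ?v] by blast
      have "words ?r \<subseteq> below n v"
      proof
        fix v' assume "v' \<in> words ?r"
        then obtain z where "z \<in> words r" "v' = us @ z @ vs"
          using words_mult[of "mon 1 us * r" "mon 1 vs"] words_mult[of "mon 1 us" r]
            words_mon[of 1 us] words_mon[of 1 vs] by fastforce
        then show "v' \<in> below n v"
          unfolding v using below_context rng(3,4) r(2) by blast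
      qed
      then obtain r2 where r2: "words r2 \<subseteq> {v' \<in> below n v. sorted v'}" "cong n q ?r r2"
        using low[OF _ less.prems(1)] by blast
      have "cong n q (mon 1 us * mon 1 [y, x] * mon 1 vs) (mon 1 us * (mon c [x, y] + r) * mon 1 vs)"
        by (rule cong_context[OF r(3) mon_carrier[OF rng(3)] mon_carrier[OF rng(4)]])
      then have "cong n q (mon 1 v) (nc_const c * mon 1 ?v + ?r)"
        by (simp add: mon_mult v distrib_left distrib_right nc_const_mon)
      moreover have "cong n q (nc_const c * mon 1 ?v + ?r) (nc_const c * (mon u1 (sort ?v) + r1) + r2)"
        by (intro cong_add cong_const r1(3) r2(2))
      moreover have "sort ?v = sort v"
        using ms by (metis mset_sort properties_for_sort sorted_sort)
      ultimately have "cong n q (mon 1 v) (mon (c * u1) (sort v) + (nc_const c * r1 + r2))"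
        using cong_trans by (simp add: distrib_left nc_const_mon mon_mult add.assoc) blast
      moreover have "words (nc_const c * r1 + r2) \<subseteq> {v' \<in> below n v. sorted v'}"
        using words_add[of "nc_const c * r1" r2] words_const_mult[of c r1] r1(2) r2(1)
        unfolding below_mset[OF ms] by blast
      moreover have "c * u1 \<noteq> 0" using r(1) r1(1) by simp
      ultimately show ?thesis by blast
    qed
  qed
  from this[OF refl less.prems] show ?case .
qed

section \<open>Evaluation at a matrix of operators\<close>

definition ev :: "(nat \<Rightarrow> nat \<Rightarrow> 'k::field op) \<Rightarrow> 'k nc_poly \<Rightarrow> 'k op"
  where "ev X p = (\<Sum>w\<in>words p. scal (wcoeff p w) * wprod X w)"

lemma ev_superset:
  "finite A \<Longrightarrow> words p \<subseteq> A \<Longrightarrow> ev X p = (\<Sum>w\<in>A. scal (wcoeff p w) * wprod X w)"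
  unfolding ev_def by (rule sum.mono_neutral_left) (auto simp: words_iff)

lemma ev_add: "ev X (p + p') = ev X p + ev X p'"
proof -
  have f: "finite (words p \<union> words p')" by (simp add: finite_words)
  have "ev X (p + p') = (\<Sum>w\<in>words p \<union> words p'. scal (wcoeff (p + p') w) * wprod X w)"
    by (rule ev_superset[OF f words_add])
  also have "\<dots> = (\<Sum>w\<in>words p \<union> words p'. scal (wcoeff p w) * wprod X w) +
    (\<Sum>w\<in>words p \<union> words p'. scal (wcoeff p' w) * wprod X w)"
    by (simp add: scal_add distrib_right sum.distrib)
  finally show ?thesis using ev_superset[OF f, of p X] ev_superset[OF f, of p' X] by simp
qed

lemma ev_0 [simp]: "ev X 0 = 0"
  by (simp add: ev_def)

lemma ev_sum: "ev X (sum f A) = (\<Sum>a\<in>A. ev X (f a))"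
  by (induction A rule: infinite_finite_induct) (auto simp: ev_add)

lemma ev_mon: "ev X (mon c w) = scal c * wprod X w"
  using ev_superset[OF _ words_mon[of c w], of X] by (simp add: wcoeff_mon)

lemma ev_mult: "ev X (p * p') = ev X p * ev X p'"
proof -
  have "p * p' = (\<Sum>v\<in>words p. \<Sum>w\<in>words p'. mon (wcoeff p v * wcoeff p' w) (v @ w))"
    by (subst poly_decompose'[of p], subst poly_decompose'[of p']) (simp add: sum_product mon_mult)
  then have "ev X (p * p') = (\<Sum>v\<in>words p. \<Sum>w\<in>words p'.
      scal (wcoeff p v) * wprod X v * (scal (wcoeff p' w) * wprod X w))"
  proof (simp only: ev_sum ev_mon, intro sum.cong refl)
    fix v w
    show "scal (wcoeff p v * wcoeff p' w) * wprod X (v @ w) =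
      scal (wcoeff p v) * wprod X v * (scal (wcoeff p' w) * wprod X w)"
      by (simp only: scal_mult wprod_simps mult.assoc scal_left_comm[of "wprod X v"])
  qed
  then show ?thesis unfolding ev_def by (simp add: sum_product)
qed

lemma ev_const: "ev X (nc_const c * p) = scal c * ev X p"
  by (simp add: ev_mult nc_const_mon ev_mon)

lemma ev_diff: "ev X (p - p') = ev X p - ev X p'"
  using ev_add[of X "p - p'" p'] by simp

lemma ev_one [simp]: "ev X 1 = 1"
  by (simp add: mon_Nil[symmetric] ev_mon)

lemma ev_prod_list: "ev X (prod_list ps) = prod_list (map (ev X) ps)"
  by (induction ps) (simp_all add: ev_mult)

lemma qmatrixD:
  assumes "qmatrix n q X" "i \<in> {1..n}" "j \<in> {1..n}" "l \<in> {1..n}" "m \<in> {1..n}"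
  shows "i < l \<Longrightarrow> X i j * X l j = scal q * (X l j * X i j)"
    and "j < m \<Longrightarrow> X i j * X i m = scal q * (X i m * X i j)"
    and "i < l \<Longrightarrow> m < j \<Longrightarrow> X i j * X l m = X l m * X i j"
    and "i < l \<Longrightarrow> j < m \<Longrightarrow>
      X i j * X l m - X l m * X i j = scal (q - inverse q) * (X i m * X l j)"
  using assms(1)[unfolded qmatrix_def, rule_format, OF assms(2,4,3,5)] by blast+

lemma ev_rels:
  assumes X: "qmatrix n q X" and r: "r \<in> qmat_rels n q"
  shows "ev X r = 0"
  using r unfolding qmat_rels_def
proof (elim UnE CollectE exE conjE)
  fix i l j assume "i \<in> {1..n}" "l \<in> {1..n}" "j \<in> {1..n}" "i < l"
    and r: "r = nc_var i j * nc_var l j - nc_const q * (nc_var l j * nc_var i j)"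
  then have "X i j * X l j = scal q * (X l j * X i j)" using qmatrixD(1)[OF X] by blast
  then show ?thesis by (simp add: r nc_var_mon nc_const_mon mon_mult ev_diff ev_mon)
next
  fix i j m assume "i \<in> {1..n}" "j \<in> {1..n}" "m \<in> {1..n}" "j < m"
    and r: "r = nc_var i j * nc_var i m - nc_const q * (nc_var i m * nc_var i j)"
  then have "X i j * X i m = scal q * (X i m * X i j)" using qmatrixD(2)[OF X] by blast
  then show ?thesis by (simp add: r nc_var_mon nc_const_mon mon_mult ev_diff ev_mon)
next
  fix i j l m assume "i \<in> {1..n}" "j \<in> {1..n}" "l \<in> {1..n}" "m \<in> {1..n}" "i < l" "m < j"
    and r: "r = nc_var i j * nc_var l m - nc_var l m * nc_var i j"
  then have "X i j * X l m = X l m * X i j" using qmatrixD(3)[OF X] by blast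
  then show ?thesis by (simp add: r nc_var_mon nc_const_mon mon_mult ev_diff ev_mon)
next
  fix i j l m assume "i \<in> {1..n}" "j \<in> {1..n}" "l \<in> {1..n}" "m \<in> {1..n}" "i < l" "j < m"
    and r: "r = nc_var i j * nc_var l m - nc_var l m * nc_var i j -
      nc_const (q - inverse q) * (nc_var i m * nc_var l j)"
  then have "X i j * X l m - X l m * X i j = scal (q - inverse q) * (X i m * X l j)"
    using qmatrixD(4)[OF X] by blast
  then show ?thesis by (simp add: r nc_var_mon nc_const_mon mon_mult ev_diff ev_mon)
qed

lemma ev_ideal:
  assumes X: "qmatrix n q X" and p: "p \<in> qmat_ideal n q"
  shows "ev X p = 0"
proof -
  let ?K = "{p \<in> carrier (free_alg n). ev X p = 0}"
  interpret F: ring "free_alg n :: 'a nc_poly ring" by (rule free_alg_ring)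
  have "ideal ?K (free_alg n)"
  proof (rule idealI[OF free_alg_ring])
    show "subgroup ?K (add_monoid (free_alg n))"
    proof (rule group.subgroupI[OF F.a_group])
      fix p assume p: "p \<in> ?K"
      then have "- p \<in> carrier (free_alg n)" "ev X (- p) = 0"
        using nc_minus_carrier[OF F.zero_closed, of p] ev_diff[of X 0 p] by (simp_all add: free_alg_simps)
      moreover have "inv\<^bsub>add_monoid (free_alg n)\<^esub> p = - p"
        using F.minus_equality[of "- p" p] p calculation
        by (simp add: a_inv_def free_alg_simps)
      ultimately show "inv\<^bsub>add_monoid (free_alg n)\<^esub> p \<in> ?K" by simp
    next
      fix p p' assume "p \<in> ?K" "p' \<in> ?K"
      then show "p \<otimes>\<^bsub>add_monoid (free_alg n)\<^esub> p' \<in> ?K"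
        by (simp add: free_alg_simps free_alg_add ev_add)
    next
      have "0 \<in> ?K" using F.zero_closed by (simp add: free_alg_simps)
      then show "?K \<noteq> {}" by blast
    qed auto
  qed (simp_all add: free_alg_simps nc_mult_carrier ev_mult)
  moreover have "qmat_rels n q \<subseteq> ?K"
  proof
    fix r assume r: "r \<in> qmat_rels n q"
    have "ev X r = 0" by (rule ev_rels[OF X r])
    then show "r \<in> ?K" using qmat_rels_carrier r by blast
  qed
  ultimately have "qmat_ideal n q \<subseteq> ?K"
    unfolding qmat_ideal_def by (rule F.genideal_minimal)
  with p show ?thesis by blast
qed

lemma ev_cong: "qmatrix n q X \<Longrightarrow> cong n q p p' \<Longrightarrow> ev X p = ev X p'"
  using ev_ideal[of n q X "p - p'"] by (simp add: cong_def ev_diff)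

section \<open>Quantum minors and the Cauchy-Binet formula\<close>

definition arrangements :: "'a list \<Rightarrow> 'a list set"
  where "arrangements js = {ks. mset ks = mset js}"

lemma finite_arrangements: "finite (arrangements js)"
proof -
  have "arrangements js \<subseteq> {ks. set ks \<subseteq> set js \<and> length ks = length js}"
    by (auto simp: arrangements_def dest: mset_eq_setD mset_eq_length)
  then show ?thesis by (rule finite_subset) (rule finite_lists_length_eq, simp)
qed

text \<open>Summing over arrangements of the column list instead of permutations leaves the row list
  arbitrary. Unsorted and repeated rows do occur when a minor of a matrix product is
  expanded.\<close>

definition minor :: "'k::field \<Rightarrow> (nat \<Rightarrow> nat \<Rightarrow> 'k op) \<Rightarrow> nat list \<Rightarrow> nat list \<Rightarrow> 'k op"
  where "minor q X is js =
    (\<Sum>ks\<in>arrangements js. scal ((- q) ^ inversions ks) * wprod X (zip is ks))"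

definition poly_minor :: "'k::field \<Rightarrow> nat list \<Rightarrow> nat list \<Rightarrow> 'k nc_poly"
  where "poly_minor q is js = (\<Sum>ks\<in>arrangements js. mon ((- q) ^ inversions ks) (zip is ks))"

lemma ev_poly_minor: "ev X (poly_minor q is js) = minor q X is js"
  by (simp add: poly_minor_def minor_def ev_sum ev_mon)

definition swap_at :: "nat \<Rightarrow> 'a list \<Rightarrow> 'a list"
  where "swap_at p ks = ks[p := ks ! Suc p, Suc p := ks ! p]"

lemma swap_at_append: "swap_at (length ps) (ps @ x # y # rs) = ps @ y # x # rs"
  by (simp add: swap_at_def nth_append list_update_append)

lemma split_at_two:
  assumes "Suc p < length ks"
  obtains ps x y rs where "ks = ps @ x # y # rs" "length ps = p" "x = ks ! p" "y = ks ! Suc p"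
proof -
  have "ks = take p ks @ ks ! p # ks ! Suc p # drop (Suc (Suc p)) ks"
    using assms by (metis Cons_nth_drop_Suc Suc_lessD append_take_drop_id)
  then show ?thesis using that assms by simp
qed

text \<open>Swapping positions \<open>p\<close> and \<open>Suc p\<close> is an involution without
  fixed points on arrangements of distinct entries; each of its pairs has exactly one member
  increasing at \<open>p\<close>.\<close>

lemma sum_arrangements_swap:
  fixes js :: "'a::linorder list" and f :: "'a list \<Rightarrow> 'b::ab_group_add"
  assumes "distinct js" "Suc p < length js"
  shows "(\<Sum>ks\<in>arrangements js. f ks) =
    (\<Sum>ks\<in>{ks \<in> arrangements js. ks ! p < ks ! Suc p}. f ks + f (swap_at p ks))"
proof -
  let ?A = "{ks \<in> arrangements js. ks ! p < ks ! Suc p}"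
  let ?B = "{ks \<in> arrangements js. ks ! Suc p < ks ! p}"
  have len: "Suc p < length ks" if "ks \<in> arrangements js" for ks
    using that assms(2) mset_eq_length[of ks js] by (simp add: arrangements_def)
  have sw: "swap_at p ks \<in> arrangements js \<and> swap_at p ks ! p = ks ! Suc p \<and>
    swap_at p ks ! Suc p = ks ! p \<and> swap_at p (swap_at p ks) = ks" if ks: "ks \<in> arrangements js" for ks
  proof (rule split_at_two[OF len[OF ks]])
    fix ps x y rs assume *: "ks = ps @ x # y # rs" "length ps = p"
    show ?thesis
      using ks swap_at_append[of ps x y rs] swap_at_append[of ps y x rs] *
      by (simp add: arrangements_def nth_append add_mset_commute)
  qed
  have ne: "ks ! p \<noteq> ks ! Suc p" if "ks \<in> arrangements js" for ks
  proof -
    have "distinct ks"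
      using that assms(1) mset_eq_imp_distinct_iff[of ks js] by (simp add: arrangements_def)
    then show ?thesis using len[OF that] by (simp add: nth_eq_iff_index_eq)
  qed
  have un: "arrangements js = ?A \<union> ?B" using ne by (auto simp: neq_iff)
  have "(\<Sum>ks\<in>arrangements js. f ks) = sum f ?A + sum f ?B"
    by (subst un, rule sum.union_disjoint) (use finite_arrangements[of js] in auto)
  also have "sum f ?B = (\<Sum>ks\<in>?A. f (swap_at p ks))"
    by (rule sum.reindex_bij_witness[of _ "swap_at p" "swap_at p"]) (use sw in auto)
  finally show ?thesis by (simp add: sum.distrib)
qed

text \<open>The \<open>q\<close>-antisymmetry in the rows for 2 by 2 minors, to which the general
  row swap reduces. The coefficient works out because
  \<open>q * (q - inverse q) = q * q - 1\<close>.\<close>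

lemma qmatrix_exchange:
  fixes X :: "nat \<Rightarrow> nat \<Rightarrow> 'k::field op"
  assumes q: "q \<noteq> 0" and X: "qmatrix n q X" and ab: "a < b" "x < y"
    "a \<in> {1..n}" "b \<in> {1..n}" "x \<in> {1..n}" "y \<in> {1..n}"
  shows "X b x * X a y - scal q * (X b y * X a x) =
    scal (- q) * (X a x * X b y - scal q * (X a y * X b x))"
proof -
  have 1: "X a y * X b x = X b x * X a y"
    and 2: "X a x * X b y - X b y * X a x = scal (q - inverse q) * (X a y * X b x)"
    using X ab unfolding qmatrix_def by blast+
  have "X b y * X a x = X a x * X b y - scal (q - inverse q) * (X a y * X b x)"
    unfolding 2[symmetric] by simp
  then have "X b x * X a y - scal q * (X b y * X a x) = X a y * X b x - scal q * (X a x * X b y) +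
    scal q * (scal (q - inverse q) * (X a y * X b x))"
    by (simp add: 1 right_diff_distrib)
  also have "scal q * (scal (q - inverse q) * (X a y * X b x)) = scal (q * q - 1) * (X a y * X b x)"
    using q by (simp add: mult.assoc[symmetric] scal_mult[symmetric] right_diff_distrib)
  also have "X a y * X b x - scal q * (X a x * X b y) + scal (q * q - 1) * (X a y * X b x) =
    scal (- q) * (X a x * X b y - scal q * (X a y * X b x))"
  proof -
    have "scal (- q) = - scal q" using scal_minus[of 0 q] by simp
    then show ?thesis
      by (simp add: scal_minus left_diff_distrib right_diff_distrib scal_mult mult.assoc)
  qed
  finally show ?thesis .
qed

text \<open>Pairing arrangements that differ by a swap of the columns used in two neighbouring rows
  isolates a 2 by 2 minor of these rows in each summand.\<close>

lemma minor_two_rows: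
  fixes X :: "nat \<Rightarrow> nat \<Rightarrow> 'k::field op"
  assumes js: "distinct js" "length js = Suc (Suc (length us + length vs))"
  shows "minor q X (us @ a # b # vs) js =
    (\<Sum>ks\<in>{ks \<in> arrangements js. ks ! length us < ks ! Suc (length us)}.
      scal ((- q) ^ inversions ks) * (wprod X (zip us (take (length us) ks)) *
      (X a (ks ! length us) * X b (ks ! Suc (length us)) -
        scal q * (X a (ks ! Suc (length us)) * X b (ks ! length us))) *
      wprod X (zip vs (drop (Suc (Suc (length us))) ks))))"
  unfolding minor_def
proof (subst sum_arrangements_swap[OF js(1), of "length us"], use js(2) in simp, intro sum.cong refl)
  fix ks assume ks: "ks \<in> {ks \<in> arrangements js. ks ! length us < ks ! Suc (length us)}"
  then have "length ks = length js" by (auto simp: arrangements_def dest: mset_eq_length)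
  then have "Suc (length us) < length ks" using js(2) by simp
  then obtain ps x y rs where k: "ks = ps @ x # y # rs" "length ps = length us"
    "x = ks ! length us" "y = ks ! Suc (length us)"
    by (rule split_at_two)
  have "ks ! length us < ks ! Suc (length us)" using ks by simp
  then have lt: "x < y" by (simp only: k(3,4))
  have s: "swap_at (length us) ks = ps @ y # x # rs"
    unfolding k(1) k(2)[symmetric] by (rule swap_at_append)
  have inv: "inversions (ps @ y # x # rs) = Suc (inversions ks)"
    using inversions_swap[OF lt, of ps rs] k(1) by simp
  have m: "scal (- q) = - scal q" using scal_minus[of 0 q] by simp
  have 1: "wprod X (zip (us @ a # b # vs) ks) =
      wprod X (zip us ps) * (X a x * X b y) * wprod X (zip vs rs)"
    unfolding k(1) using k(2) by (simp add: mult.assoc)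
  have 2: "wprod X (zip (us @ a # b # vs) (ps @ y # x # rs)) =
      wprod X (zip us ps) * (X a y * X b x) * wprod X (zip vs rs)"
    using k(2) by (simp add: mult.assoc)
  have t: "take (length us) ks = ps" "drop (Suc (Suc (length us))) ks = rs"
    unfolding k(1) k(2)[symmetric] by simp_all
  show "scal ((- q) ^ inversions ks) * wprod X (zip (us @ a # b # vs) ks) +
    scal ((- q) ^ inversions (swap_at (length us) ks)) *
      wprod X (zip (us @ a # b # vs) (swap_at (length us) ks)) =
    scal ((- q) ^ inversions ks) * (wprod X (zip us (take (length us) ks)) *
      (X a (ks ! length us) * X b (ks ! Suc (length us)) -
        scal q * (X a (ks ! Suc (length us)) * X b (ks ! length us))) *
      wprod X (zip vs (drop (Suc (Suc (length us))) ks)))"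
    unfolding s inv 1 2 t k(3,4)[symmetric] power_Suc2 scal_mult m
    by (simp add: right_diff_distrib left_diff_distrib mult.assoc
        scal_left_comm[of "wprod X (zip us ps)"])
qed

lemma minor_row_swap:
  fixes X :: "nat \<Rightarrow> nat \<Rightarrow> 'k::field op"
  assumes q: "q \<noteq> 0" and X: "qmatrix n q X"
    and js: "distinct js" "length js = Suc (Suc (length us + length vs))" "set js \<subseteq> {1..n}"
    and ab: "a < b" "a \<in> {1..n}" "b \<in> {1..n}"
  shows "minor q X (us @ b # a # vs) js = scal (- q) * minor q X (us @ a # b # vs) js"
  unfolding minor_two_rows[OF js(1,2)] sum_distrib_left
proof (intro sum.cong refl)
  fix ks assume ks: "ks \<in> {ks \<in> arrangements js. ks ! length us < ks ! Suc (length us)}"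
  let ?x = "ks ! length us" and ?y = "ks ! Suc (length us)"
  let ?A = "wprod X (zip us (take (length us) ks))"
    and ?B = "wprod X (zip vs (drop (Suc (Suc (length us))) ks))"
  have "mset ks = mset js" using ks by (simp add: arrangements_def)
  then have "length ks = length js" "set ks = set js" by (auto dest: mset_eq_length mset_eq_setD)
  then have "?x \<in> {1..n}" "?y \<in> {1..n}"
    using js(2,3) nth_mem[of "length us" ks] nth_mem[of "Suc (length us)" ks] by auto
  with ks ab have "X b ?x * X a ?y - scal q * (X b ?y * X a ?x) =
    scal (- q) * (X a ?x * X b ?y - scal q * (X a ?y * X b ?x))"
    by (intro qmatrix_exchange[OF q X]) auto
  then show "scal ((- q) ^ inversions ks) * (?A * (X b ?x * X a ?y - scal q * (X b ?y * X a ?x)) * ?B) =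
    scal (- q) * (scal ((- q) ^ inversions ks) *
      (?A * (X a ?x * X b ?y - scal q * (X a ?y * X b ?x)) * ?B))"
    by (simp only: mult.assoc scal_left_comm[of ?A] scal_left_comm[of "scal ((- q) ^ inversions ks)"])
qed

lemma minor_equal_rows:
  fixes X :: "nat \<Rightarrow> nat \<Rightarrow> 'k::field op"
  assumes X: "qmatrix n q X"
    and js: "distinct js" "length js = Suc (Suc (length us + length vs))" "set js \<subseteq> {1..n}"
    and a: "a \<in> {1..n}"
  shows "minor q X (us @ a # a # vs) js = 0"
  unfolding minor_two_rows[OF js(1,2)]
proof (intro sum.neutral ballI)
  fix ks assume ks: "ks \<in> {ks \<in> arrangements js. ks ! length us < ks ! Suc (length us)}"
  let ?x = "ks ! length us" and ?y = "ks ! Suc (length us)"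
  have "mset ks = mset js" using ks by (simp add: arrangements_def)
  then have "length ks = length js" "set ks = set js" by (auto dest: mset_eq_length mset_eq_setD)
  then have "?x \<in> {1..n}" "?y \<in> {1..n}"
    using js(2,3) nth_mem[of "length us" ks] nth_mem[of "Suc (length us)" ks] by auto
  with ks a have "X a ?x * X a ?y = scal q * (X a ?y * X a ?x)"
    using X unfolding qmatrix_def by blast
  then show "scal ((- q) ^ inversions ks) * (wprod X (zip us (take (length us) ks)) *
      (X a ?x * X a ?y - scal q * (X a ?y * X a ?x)) *
      wprod X (zip vs (drop (Suc (Suc (length us))) ks))) = 0"
    by simp
qed

text \<open>Bubble sort on the rows: each swap of a descent costs \<open>- q\<close>, and two equal
  neighbours make the minor vanish. If some row is repeated, sorting eventually brings equal rows
  together.\<close>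

lemma minor_rows:
  fixes X :: "nat \<Rightarrow> nat \<Rightarrow> 'k::field op"
  assumes q: "q \<noteq> 0" and X: "qmatrix n q X"
    and js: "distinct js" "set js \<subseteq> {1..n}"
    and rs: "set rs \<subseteq> {1..n}" "length rs = length js"
  shows "minor q X rs js =
    (if distinct rs then scal ((- q) ^ inversions rs) * minor q X (sort rs) js else 0)"
  using rs
proof (induction "inversions rs" arbitrary: rs rule: less_induct)
  case (less rs)
  show ?case
  proof (cases "sorted_wrt (<) rs")
    case True
    then have "sorted rs" "distinct rs" by (simp_all add: strict_sorted_iff)
    then show ?thesis by (simp add: inversions_sorted sorted_sort_id)
  next
    case False
    obtain us b a vs where u: "rs = us @ [b, a] @ vs" "\<not> b < a"
      using adjacent_failure[OF False] by (metis transp_on_less)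
    have mem: "a \<in> {1..n}" "b \<in> {1..n}" and len: "length js = Suc (Suc (length us + length vs))"
      using less.prems u by auto
    show ?thesis
    proof (cases "a = b")
      case True
      then show ?thesis
        using minor_equal_rows[OF X js(1) len js(2) mem(1)] u by simp
    next
      case ne: False
      then have ab: "a < b" using u by simp
      let ?rs = "us @ [a, b] @ vs"
      have inv: "inversions rs = Suc (inversions ?rs)" unfolding u by (rule inversions_swap[OF ab])
      have ms: "mset ?rs = mset rs" unfolding u by simp
      have "distinct ?rs = distinct rs" "sort ?rs = sort rs"
        using mset_eq_imp_distinct_iff[OF ms] properties_for_sort[of "sort rs" ?rs] ms by simp_all
      moreover have "minor q X ?rs js =
        (if distinct ?rs then scal ((- q) ^ inversions ?rs) * minor q X (sort ?rs) js else 0)"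
        by (rule less.hyps) (use inv less.prems u in auto)
      moreover have "minor q X rs js = scal (- q) * minor q X ?rs js"
        using minor_row_swap[OF q X js(1) len js(2) ab mem] u by simp
      moreover have "scal (- q) * (scal e * M) = scal (- (q * e)) * M" for e and M :: "'k op"
        by (simp add: mult.assoc[symmetric] scal_mult[symmetric])
      ultimately show ?thesis by (simp add: inv)
    qed
  qed
qed

section \<open>Minors of a product of two commuting quantum matrices\<close>

definition strict_lists :: "nat \<Rightarrow> nat \<Rightarrow> nat list set"
  where "strict_lists n s = {K. sorted_wrt (<) K \<and> set K \<subseteq> {1..n} \<and> length K = s}"

lemma finite_lists_n: "finite {ls. set ls \<subseteq> {1..n::nat} \<and> length ls = s}"
  by (rule finite_lists_length_eq) simp

lemma finite_strict_lists: "finite (strict_lists n s)"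
  by (rule finite_subset[OF _ finite_lists_n[of n s]]) (auto simp: strict_lists_def)

lemma sum_lists_Suc:
  "(\<Sum>ls | set ls \<subseteq> {1..n::nat} \<and> length ls = Suc s. f ls) =
    (\<Sum>k\<in>{1..n}. \<Sum>ls | set ls \<subseteq> {1..n} \<and> length ls = s. f (k # ls))"
  unfolding sum.cartesian_product
  by (rule sum.reindex_bij_witness[of _ "\<lambda>(k, ls). k # ls" "\<lambda>ls. (hd ls, List.tl ls)"])
    (auto simp: length_Suc_conv)

lemma wprod_product:
  fixes X Y :: "nat \<Rightarrow> nat \<Rightarrow> 'k::field op"
  assumes XY: "\<And>i j k l. X i j * Y k l = Y k l * X i j" and "length is = length ks"
  shows "wprod (\<lambda>i j. \<Sum>k\<in>{1..n}. X i k * Y k j) (zip is ks) =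
    (\<Sum>ls | set ls \<subseteq> {1..n} \<and> length ls = length is. wprod X (zip is ls) * wprod Y (zip ls ks))"
  using assms(2)
proof (induction "is" ks rule: list_induct2)
  case Nil
  have "{ls. set ls \<subseteq> {1..n} \<and> length ls = 0} = {[]}" by auto
  then show ?case by simp
next
  case (Cons i "is" j ks)
  have c: "Y k l * wprod X v = wprod X v * Y k l" for k l v
    by (simp only: wprod_def, rule prod_list_commute[symmetric]) (auto simp: XY)
  have "wprod (\<lambda>i j. \<Sum>k\<in>{1..n}. X i k * Y k j) (zip (i # is) (j # ks)) =
    (\<Sum>k\<in>{1..n}. X i k * Y k j) * (\<Sum>ls | set ls \<subseteq> {1..n} \<and> length ls = length is.
      wprod X (zip is ls) * wprod Y (zip ls ks))"
    using Cons by simp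
  also have "\<dots> = (\<Sum>k\<in>{1..n}. \<Sum>ls | set ls \<subseteq> {1..n} \<and> length ls = length is.
      wprod X (zip (i # is) (k # ls)) * wprod Y (zip (k # ls) (j # ks)))"
    unfolding sum_product
  proof (intro sum.cong refl)
    fix k ls
    show "X i k * Y k j * (wprod X (zip is ls) * wprod Y (zip ls ks)) =
      wprod X (zip (i # is) (k # ls)) * wprod Y (zip (k # ls) (j # ks))"
      using c[of k j "zip is ls"] by (simp add: mult.assoc) (simp add: mult.assoc[symmetric])
  qed
  finally show ?case by (simp only: sum_lists_Suc list.size add_Suc_right add_0_right)
qed

text \<open>The middle indices run over all lists \<open>ls\<close>. By \<open>minor_rows\<close>
  for \<open>Y\<close>, repetitions drop out, and distinct lists with the same sorted form
  \<open>K\<close> share the factor \<open>minor q Y K js\<close> up to powers of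
  \<open>- q\<close>; these powers are exactly the coefficients of
  \<open>minor q X is K\<close>.\<close>

lemma Cauchy_Binet:
  fixes X Y :: "nat \<Rightarrow> nat \<Rightarrow> 'k::field op"
  assumes q: "q \<noteq> 0" and Y: "qmatrix n q Y" and XY: "\<And>i j k l. X i j * Y k l = Y k l * X i j"
    and js: "distinct js" "set js \<subseteq> {1..n}" and len: "length is = length js"
  shows "minor q (\<lambda>i j. \<Sum>k\<in>{1..n}. X i k * Y k j) is js =
    (\<Sum>K\<in>strict_lists n (length js). minor q X is K * minor q Y K js)"
proof -
  let ?s = "length js"
  let ?L = "{ls. set ls \<subseteq> {1..n} \<and> length ls = ?s}"
  let ?D = "{ls \<in> ?L. distinct ls}"
  have la: "length ks = ?s" if "ks \<in> arrangements js" for ks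
    using that by (auto simp: arrangements_def dest: mset_eq_length)
  have "minor q (\<lambda>i j. \<Sum>k\<in>{1..n}. X i k * Y k j) is js =
    (\<Sum>ks\<in>arrangements js. \<Sum>ls\<in>?L. scal ((- q) ^ inversions ks) *
      (wprod X (zip is ls) * wprod Y (zip ls ks)))"
    unfolding minor_def sum_distrib_left[symmetric]
    by (intro sum.cong refl, subst wprod_product[OF XY]) (auto simp: la len)
  also have "\<dots> = (\<Sum>ls\<in>?L. wprod X (zip is ls) * minor q Y ls js)"
    by (subst sum.swap) (simp add: minor_def sum_distrib_left scal_left_comm)
  also have "\<dots> = (\<Sum>ls\<in>?D. wprod X (zip is ls) * minor q Y ls js)"
    by (rule sum.mono_neutral_right)
      (use minor_rows[OF q Y js] finite_lists_n[of n ?s] in auto)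
  also have "\<dots> = (\<Sum>ls\<in>?D. scal ((- q) ^ inversions ls) * wprod X (zip is ls) * minor q Y (sort ls) js)"
  proof (intro sum.cong refl)
    fix ls assume "ls \<in> ?D"
    then have "minor q Y ls js = scal ((- q) ^ inversions ls) * minor q Y (sort ls) js"
      using minor_rows[OF q Y js, of ls] by simp
    then show "wprod X (zip is ls) * minor q Y ls js =
      scal ((- q) ^ inversions ls) * wprod X (zip is ls) * minor q Y (sort ls) js"
      by (simp only: mult.assoc scal_left_comm[of "wprod X (zip is ls)"])
  qed
  also have "\<dots> = (\<Sum>K\<in>strict_lists n ?s. \<Sum>ls | ls \<in> ?D \<and> sort ls = K.
      scal ((- q) ^ inversions ls) * wprod X (zip is ls) * minor q Y (sort ls) js)"
    by (rule sum.group[OF finite_subset[OF _ finite_lists_n[of n ?s]] finite_strict_lists, symmetric])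
      (auto simp: strict_lists_def strict_sorted_iff)
  also have "\<dots> = (\<Sum>K\<in>strict_lists n ?s. minor q X is K * minor q Y K js)"
  proof (intro sum.cong refl)
    fix K assume K: "K \<in> strict_lists n ?s"
    then have sK: "sorted K" "distinct K" "set K \<subseteq> {1..n}" "length K = ?s"
      by (auto simp: strict_lists_def strict_sorted_iff)
    have "{ls. ls \<in> ?D \<and> sort ls = K} = arrangements K"
    proof (intro equalityI subsetI)
      fix ls assume "ls \<in> {ls. ls \<in> ?D \<and> sort ls = K}"
      then show "ls \<in> arrangements K" by (auto simp: arrangements_def)
    next
      fix ls assume "ls \<in> arrangements K"
      then have "mset ls = mset K" by (simp add: arrangements_def)
      then show "ls \<in> {ls. ls \<in> ?D \<and> sort ls = K}"
        using sK mset_eq_setD[of ls K] mset_eq_length[of ls K] mset_eq_imp_distinct_iff[of ls K]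
          properties_for_sort[of K ls] by auto
    qed
    then show "(\<Sum>ls | ls \<in> ?D \<and> sort ls = K.
        scal ((- q) ^ inversions ls) * wprod X (zip is ls) * minor q Y (sort ls) js) =
      minor q X is K * minor q Y K js"
      unfolding minor_def[of q X] sum_distrib_right
      by (intro sum.cong) auto
  qed
  finally show ?thesis .
qed

section \<open>Leading words of products of minors\<close>

text \<open>The rearrangement inequality: undoing a descent of \<open>ks\<close> against strictly
  increasing rows raises the weight strictly.\<close>

lemma wdeg_arrangement:
  assumes "sorted_wrt (<) is" "sorted_wrt (<) js" "length is = length js" "mset ks = mset js"
  shows "ks = js \<or> wdeg (zip is ks) < wdeg (zip is js)"
  using assms(4)
proof (induction "inversions ks" arbitrary: ks rule: less_induct)
  case (less ks)
  show ?case
  proof (cases "sorted ks")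
    case True
    then have "ks = js"
      using less.prems assms(2) properties_for_sort[of ks js] sorted_sort_id[of js]
      by (simp add: strict_sorted_iff)
    then show ?thesis ..
  next
    case False
    then obtain us y x vs where k: "ks = us @ [y, x] @ vs" and xy: "x < y" by (rule descent)
    let ?ks = "us @ [x, y] @ vs"
    have "inversions ?ks < inversions ks" unfolding k inversions_swap[OF xy] by simp
    moreover have "mset ?ks = mset js" using less.prems unfolding k by (simp add: add_mset_commute)
    ultimately have IH: "?ks = js \<or> wdeg (zip is ?ks) < wdeg (zip is js)" by (rule less.hyps)
    have "length is = length ks" using less.prems assms(3) mset_eq_length by metis
    then have "Suc (length us) < length is" by (simp add: k)
    then obtain ps a b rs where i: "is = ps @ a # b # rs" "length ps = length us"
      by (rule split_at_two)
    then have "a < b" using assms(1) by (simp add: sorted_wrt_append)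
    from exchange_degree[OF this xy] have "wdeg (zip is ks) < wdeg (zip is ?ks)"
      using i by (simp add: k)
    then show ?thesis using IH by auto
  qed
qed

text \<open>Leading words are taken in the free algebra, where they are multiplicative by
  concatenation; \<open>w\<close> is in general unsorted, and \<open>normal_form\<close> passes to
  sorted words.\<close>

definition leads :: "nat \<Rightarrow> 'k::field nc_poly \<Rightarrow> (nat \<times> nat) list \<Rightarrow> bool"
  where "leads n p w \<longleftrightarrow> set w \<subseteq> {1..n} \<times> {1..n} \<and> words (p - mon 1 w) \<subseteq> below n w"

lemma leads_minor:
  assumes "sorted_wrt (<) is" "sorted_wrt (<) js" "length is = length js"
    "set is \<subseteq> {1..n}" "set js \<subseteq> {1..n}"
  shows "leads n (poly_minor q is js) (zip is js)"
proof -
  have js: "js \<in> arrangements js" by (simp add: arrangements_def)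
  have "inversions js = 0" using assms(2) inversions_sorted strict_sorted_iff by blast
  then have "poly_minor q is js - mon 1 (zip is js) =
    (\<Sum>ks\<in>arrangements js - {js}. mon ((- q) ^ inversions ks) (zip is ks))"
    unfolding poly_minor_def sum.remove[OF finite_arrangements js] by simp
  moreover have "zip is ks \<in> below n (zip is js)" if "ks \<in> arrangements js - {js}" for ks
  proof -
    have ks: "mset ks = mset js" "ks \<noteq> js" using that by (auto simp: arrangements_def)
    then have "length ks = length js" "set ks = set js"
      by (auto dest: mset_eq_length mset_eq_setD)
    moreover from this have "map fst (zip is ks) = is" "map snd (zip is ks) = ks"
      "map fst (zip is js) = is" "map snd (zip is js) = js"
      using assms(3) by simp_all
    ultimately show ?thesis
      using wdeg_arrangement[OF assms(1,2,3) ks(1)] ks assms(4,5)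
      by (auto simp: below_def simp del: mset_map dest: set_zip_leftD set_zip_rightD)
  qed
  ultimately have "words (poly_minor q is js - mon 1 (zip is js)) \<subseteq> below n (zip is js)"
    using words_sum[of "\<lambda>ks. mon ((- q) ^ inversions ks) (zip is ks)" "arrangements js - {js}"]
      words_mon by fastforce
  then show ?thesis
    using assms(4,5) by (auto simp: leads_def dest: set_zip_leftD set_zip_rightD)
qed

lemma leads_mult:
  assumes "leads n p v" "leads n p' w"
  shows "leads n (p * p') (v @ w)"
proof -
  let ?r = "p - mon 1 v" and ?r' = "p' - mon 1 w"
  have e: "p * p' - mon 1 (v @ w) = mon 1 v * ?r' + ?r * mon 1 w + ?r * ?r'"
    using mon_mult[of 1 v 1 w] by (simp add: algebra_simps)
  have b: "x @ y \<in> below n (v @ w)"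
    if "x \<in> below n v \<and> y \<in> insert w (below n w) \<or> x = v \<and> y \<in> below n w" for x y
    using that assms by (auto simp: below_def leads_def)
  have "words (p * p' - mon 1 (v @ w)) \<subseteq> below n (v @ w)"
  proof
    fix z assume "z \<in> words (p * p' - mon 1 (v @ w))"
    then have "z \<in> words (mon 1 v * ?r') \<or> z \<in> words (?r * mon 1 w) \<or> z \<in> words (?r * ?r')"
      unfolding e using words_add by blast
    then obtain x y where "z = x @ y" "x \<in> words (mon (1::'a) v) \<and> y \<in> words ?r' \<or>
      x \<in> words ?r \<and> y \<in> words (mon (1::'a) w) \<or> x \<in> words ?r \<and> y \<in> words ?r'"
      using words_mult by blast
    then show "z \<in> below n (v @ w)"
      using b assms words_mon[of "1::'a" v] words_mon[of "1::'a" w] unfolding leads_def by blast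
  qed
  then show ?thesis using assms by (simp add: leads_def)
qed

definition poly_product :: "'k::field \<Rightarrow> nat list list \<Rightarrow> nat list list \<Rightarrow> 'k nc_poly"
  where "poly_product q T U = prod_list (map2 (poly_minor q) T U)"

definition diagonal_word :: "nat list list \<Rightarrow> nat list list \<Rightarrow> (nat \<times> nat) list"
  where "diagonal_word T U = concat (map2 zip T U)"

definition row_pair :: "nat \<Rightarrow> nat list \<Rightarrow> nat list \<Rightarrow> bool"
  where "row_pair n r r' \<longleftrightarrow> sorted_wrt (<) r \<and> sorted_wrt (<) r' \<and> length r = length r' \<and>
    set r \<subseteq> {1..n} \<and> set r' \<subseteq> {1..n}"

lemma leads_product:
  "list_all2 (row_pair n) T U \<Longrightarrow> leads n (poly_product q T U) (diagonal_word T U)"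
proof (induction T U rule: list_all2_induct)
  case Nil
  show ?case by (simp add: leads_def poly_product_def diagonal_word_def mon_Nil)
next
  case (Cons r T r' U)
  then have "leads n (poly_minor q r r') (zip r r')"
    by (intro leads_minor) (auto simp: row_pair_def)
  from leads_mult[OF this Cons.IH] show ?case
    by (simp add: poly_product_def diagonal_word_def)
qed

lemma below_reorder:
  fixes q :: "'k::field"
  assumes q: "q \<noteq> 0" and r: "words r \<subseteq> below n w"
  shows "\<exists>r'. words r' \<subseteq> {v \<in> below n w. sorted v} \<and> cong n q r r'"
proof (rule cong_words)
  fix v assume "v \<in> words r"
  then have v: "v \<in> below n w" using r by auto
  then have "set v \<subseteq> {1..n} \<times> {1..n}" by (simp add: below_def)
  from reorder[OF q this] obtain u r' where
    *: "words r' \<subseteq> {v' \<in> below n v. sorted v'}" "cong n q (mon 1 v) (mon u (sort v) + r')"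
    by blast
  have "words (mon u (sort v) + r') \<subseteq> {v \<in> below n w. sorted v}"
    using words_add[of "mon u (sort v)" r'] words_mon[of u "sort v"] sorted_below[OF v]
      *(1) below_trans[OF v] sorted_sort[of v] by blast
  with *(2) show "\<exists>p'. words p' \<subseteq> {v \<in> below n w. sorted v} \<and> cong n q (mon 1 v) p'" by blast
qed

text \<open>The coefficient at \<open>sort w\<close> is required to be nonzero rather than 1, since
  sorting \<open>w\<close> may introduce powers of \<open>inverse q\<close>.\<close>

definition normal_form ::
  "nat \<Rightarrow> 'k::field \<Rightarrow> 'k nc_poly \<Rightarrow> (nat \<times> nat) list \<Rightarrow> 'k nc_poly \<Rightarrow> bool"
  where "normal_form n q p w p' \<longleftrightarrow> cong n q p p' \<and> wcoeff p' (sort w) \<noteq> 0 \<and>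
    words p' \<subseteq> insert (sort w) {v \<in> below n w. sorted v}"

lemma normal_form_exists:
  fixes q :: "'k::field"
  assumes q: "q \<noteq> 0" and p: "leads n p w"
  shows "\<exists>p'. normal_form n q p w p'"
proof -
  have w: "set w \<subseteq> {1..n} \<times> {1..n}" and r: "words (p - mon 1 w) \<subseteq> below n w"
    using p by (auto simp: leads_def)
  obtain u r1 where 1: "u \<noteq> 0" "words r1 \<subseteq> {v \<in> below n w. sorted v}"
    "cong n q (mon 1 w) (mon u (sort w) + r1)"
    using reorder[OF q w] by blast
  obtain r2 where 2: "words r2 \<subseteq> {v \<in> below n w. sorted v}" "cong n q (p - mon 1 w) r2"
    using below_reorder[OF q r] by blast
  have "cong n q p (mon u (sort w) + (r1 + r2))"
    using cong_add[OF 1(3) 2(2)] by (simp add: add.assoc)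
  moreover have sw: "sort w \<notin> below n w"
    using wdeg_mset[of "sort w" w] by (simp add: below_def)
  moreover have "wcoeff r1 (sort w) = 0" "wcoeff r2 (sort w) = 0"
    using sw 1(2) 2(1) words_iff by blast+
  moreover have "words (mon u (sort w) + (r1 + r2)) \<subseteq> insert (sort w) {v \<in> below n w. sorted v}"
    using words_add[of "mon u (sort w)" "r1 + r2"] words_add[of r1 r2] words_mon[of u "sort w"]
      1(2) 2(1) by blast
  ultimately show ?thesis
    unfolding normal_form_def using 1(1)
    by (intro exI[of _ "mon u (sort w) + (r1 + r2)"]) (simp add: wcoeff_mon)
qed

lemma normal_form_sorted:
  "normal_form n q p w p' \<Longrightarrow> set w \<subseteq> {1..n} \<times> {1..n} \<Longrightarrow> words p' \<subseteq> sorted_words n"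
  unfolding normal_form_def sorted_words_def by (fastforce simp: below_def)

lemma normal_form_coeff:
  assumes "normal_form n q p w p'" "wcoeff p' v \<noteq> 0"
  shows "v = sort w \<or> wdeg v < wdeg w"
    and "mset (map fst v) = mset (map fst w)" "mset (map snd v) = mset (map snd w)"
proof -
  have "v \<in> words p'" using assms(2) by (simp add: words_iff)
  then have "v = sort w \<or> v \<in> below n w" using assms(1) unfolding normal_form_def by blast
  then show "v = sort w \<or> wdeg v < wdeg w"
    "mset (map fst v) = mset (map fst w)" "mset (map snd v) = mset (map snd w)"
    by (auto simp: below_def)
qed

section \<open>The initial tableau of a shape\<close>

definition initial :: "nat list list \<Rightarrow> nat list list"
  where "initial T = map (\<lambda>r. [1..<Suc (length r)]) T"

lemma strict_nth_ge:
  assumes "sorted_wrt (<) k" "set k \<subseteq> {1..n::nat}" "i < length k"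
  shows "Suc i \<le> k ! i"
  using assms(3)
proof (induction i)
  case 0
  then have "k ! 0 \<in> {1..n}" using assms(2) nth_mem by blast
  then show ?case by simp
next
  case (Suc i)
  then have "k ! i < k ! Suc i" using assms(1) by (simp add: sorted_wrt_nth_less)
  with Suc show ?case by simp
qed

text \<open>A strictly increasing list of positive numbers dominates \<open>1, 2, ...\<close>
  position by position, so equal sums force equality everywhere.\<close>

lemma initial_row_minimal:
  assumes k: "k \<in> strict_lists n s"
  shows "sum_list [1..<Suc s] \<le> sum_list k"
    and "sum_list k \<le> sum_list [1..<Suc s] \<Longrightarrow> k = [1..<Suc s]"
proof -
  have len: "length k = s" and ge: "\<And>i. i < s \<Longrightarrow> Suc i \<le> k ! i"
    using k strict_nth_ge[of k n] by (auto simp: strict_lists_def)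
  have 1: "sum_list [1..<Suc s] = (\<Sum>i<s. Suc i)"
    by (simp add: sum_list_sum_nth atLeast0LessThan del: upt_Suc)
  have 2: "sum_list k = (\<Sum>i<s. k ! i)"
    by (simp add: sum_list_sum_nth len atLeast0LessThan)
  show "sum_list [1..<Suc s] \<le> sum_list k"
    unfolding 1 2 by (rule sum_mono) (use ge in auto)
  assume le: "sum_list k \<le> sum_list [1..<Suc s]"
  have "k ! i = Suc i" if i: "i < s" for i
  proof (rule ccontr)
    assume "k ! i \<noteq> Suc i"
    then have "Suc i < k ! i" using ge[OF i] by linarith
    then have "(\<Sum>i<s. Suc i) < (\<Sum>i<s. k ! i)"
      using i by (intro sum_strict_mono_ex1) (auto intro!: ge bexI[of _ i])
    then show False using le unfolding 1 2 by simp
  qed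
  then show "k = [1..<Suc s]" by (intro nth_equalityI) (simp_all add: len del: upt_Suc)
qed

text \<open>The \<open>K\<close> of the Cauchy-Binet expansion, applied to each row separately; no
  condition links the rows, so the columns of \<open>K\<close> may fail to be nondecreasing.\<close>

definition middle_rows :: "nat \<Rightarrow> nat list list \<Rightarrow> nat list list set"
  where "middle_rows n T = listset (map (\<lambda>r. strict_lists n (length r)) T)"

lemma finite_middle_rows: "finite (middle_rows n T)"
proof -
  have "finite (listset As)" if "\<forall>A\<in>set As. finite A" for As :: "nat list set list"
    using that
  proof (induction As)
    case (Cons A As)
    have "set_Cons A (listset As) = (\<lambda>(a, as). a # as) ` (A \<times> listset As)"
      by (auto simp: set_Cons_def)
    with Cons show ?case by simp
  qed simp
  then show ?thesis by (simp add: middle_rows_def finite_strict_lists)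
qed

lemma middle_rows_Cons:
  "K \<in> middle_rows n (r # T) \<longleftrightarrow> (\<exists>k L. K = k # L \<and> k \<in> strict_lists n (length r) \<and> L \<in> middle_rows n T)"
  by (auto simp: middle_rows_def set_Cons_def)

lemma middle_rows_Nil: "middle_rows n [] = {[]}"
  by (simp add: middle_rows_def)

text \<open>The sum of all entries serves as the size of \<open>K\<close> because it can be read
  from a PBW word: it is the sum of the second indices, which sorting and correction terms
  preserve.\<close>

lemma middle_rows_minimal:
  "K \<in> middle_rows n T \<Longrightarrow> sum_list (concat (initial T)) \<le> sum_list (concat K) \<and>
    (sum_list (concat K) \<le> sum_list (concat (initial T)) \<longrightarrow> K = initial T)"
proof (induction T arbitrary: K)
  case Nil
  then show ?case by (simp add: middle_rows_Nil initial_def)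
next
  case (Cons r T)
  then obtain k L where K: "K = k # L" "k \<in> strict_lists n (length r)" "L \<in> middle_rows n T"
    by (auto simp: middle_rows_Cons)
  show ?case
    using initial_row_minimal[OF K(2)] Cons.IH[OF K(3)]
    by (auto simp: K(1) initial_def simp del: upt_Suc)
qed

lemma sum_middle_rows_Cons:
  "(\<Sum>K\<in>middle_rows n (r # T). f K) =
    (\<Sum>k\<in>strict_lists n (length r). \<Sum>L\<in>middle_rows n T. f (k # L))"
  unfolding sum.cartesian_product
  by (rule sum.reindex_bij_witness[of _ "\<lambda>(k, L). k # L" "\<lambda>K. (hd K, List.tl K)"])
    (auto simp: middle_rows_Cons)

lemma product_expansion:
  fixes f g :: "nat list \<Rightarrow> nat list \<Rightarrow> 'k::field op"
  assumes comm: "\<And>k r' r k'. g k r' * f r k' = f r k' * g k r'"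
    and "length T = length U"
  shows "prod_list (map2 (\<lambda>r r'. \<Sum>k\<in>strict_lists n (length r). f r k * g k r') T U) =
    (\<Sum>K\<in>middle_rows n T. prod_list (map2 f T K) * prod_list (map2 g K U))"
  using assms(2)
proof (induction T U rule: list_induct2)
  case Nil
  show ?case by (simp add: middle_rows_Nil)
next
  case (Cons r T r' U)
  have c: "g k r' * prod_list (map2 f T K) = prod_list (map2 f T K) * g k r'" for k K
    by (rule prod_list_commute[symmetric]) (auto simp: comm)
  have "f r k * g k r' * (prod_list (map2 f T K) * prod_list (map2 g K U)) =
    f r k * prod_list (map2 f T K) * (g k r' * prod_list (map2 g K U))" for k K
    using c[of k K] by (simp add: mult.assoc) (simp add: mult.assoc[symmetric])
  then show ?case
    unfolding sum_middle_rows_Cons by (simp add: Cons.IH sum_product)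
qed

section \<open>Reading a tableau from its diagonal word\<close>

lemma diagonal_word_swap: "map prod.swap (diagonal_word T U) = diagonal_word U T"
proof -
  have "map prod.swap (zip r r') = zip r' r" for r r' :: "nat list"
    by (simp add: zip_commute[of r' r] prod.swap_def case_prod_beta)
  then show ?thesis
  proof (induction T arbitrary: U)
    case (Cons r T)
    then show ?case by (cases U) (simp_all add: diagonal_word_def)
  qed (simp add: diagonal_word_def)
qed

lemma diagonal_word_snd:
  "list_all2 (\<lambda>r r'. length r = length r') T U \<Longrightarrow> map snd (diagonal_word T U) = concat U"
  by (induction T U rule: list_all2_induct) (simp_all add: diagonal_word_def)

definition column :: "nat \<Rightarrow> nat list list \<Rightarrow> nat list"
  where "column c T = map (\<lambda>r. r ! c) (filter (\<lambda>r. c < length r) T)"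

lemma filter_zip_upt:
  "filter (\<lambda>p. snd p = Suc c) (zip r [1..<Suc (length r)]) =
    (if c < length r then [(r ! c, Suc c)] else [])"
proof (induction r rule: rev_induct)
  case (snoc x r)
  have "[1..<Suc (Suc (length r))] = [1..<Suc (length r)] @ [Suc (length r)]"
    by (rule upt_Suc_append) simp
  then have "zip (r @ [x]) [1..<Suc (length (r @ [x]))] = zip r [1..<Suc (length r)] @ [(x, Suc (length r))]"
    by (simp del: upt_Suc)
  then show ?case using snoc by (auto simp: nth_append simp del: upt_Suc)
qed simp

lemma column_diagonal_word:
  "map fst (filter (\<lambda>p. snd p = Suc c) (diagonal_word T (initial T))) = column c T"
  by (induction T) (simp_all add: diagonal_word_def initial_def column_def filter_zip_upt[unfolded One_nat_def] del: upt_Suc)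

text \<open>Row lengths decrease, so the rows that reach column \<open>c\<close> are the top ones
  and the filter skips no row before them.\<close>

lemma tableau_columns:
  assumes "tableau n T"
  shows "r < length (column c T) \<longleftrightarrow> r < length T \<and> c < length (T ! r)"
    and "r < length (column c T) \<Longrightarrow> column c T ! r = T ! r ! c"
proof -
  have s: "sorted_wrt (\<ge>) (map length T)" using assms by (simp add: tableau_def)
  have f: "filter (\<lambda>r. c < length r) T = takeWhile (\<lambda>r. c < length r) T" (is "_ = ?W")
    by (rule filter_equals_takeWhile_sorted_rev)
      (use s in \<open>simp add: sorted_wrt_rev rev_map[symmetric]\<close>)
  have len: "length (column c T) = length ?W" by (simp add: column_def f)
  show iff: "r < length (column c T) \<longleftrightarrow> r < length T \<and> c < length (T ! r)"
  proof
    assume "r < length (column c T)"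
    then have "r < length ?W" by (simp add: len)
    then show "r < length T \<and> c < length (T ! r)"
      using length_takeWhile_le[of "\<lambda>r. c < length r" T] takeWhile_nth[of r "\<lambda>r. c < length r" T]
        set_takeWhileD[of "?W ! r" "\<lambda>r. c < length r" T] nth_mem[of r ?W] by auto
  next
    assume r: "r < length T \<and> c < length (T ! r)"
    show "r < length (column c T)"
    proof (rule ccontr)
      assume "\<not> r < length (column c T)"
      then have h: "length ?W \<le> r" by (simp add: len)
      then have "\<not> c < length (T ! length ?W)"
        using r by (intro nth_length_takeWhile) auto
      moreover have "length (T ! r) \<le> length (T ! length ?W)"
        using s h r by (cases "length ?W = r") (auto simp: sorted_wrt_iff_nth_less)
      ultimately show False using r by simp
    qed
  qed
  show "r < length (column c T) \<Longrightarrow> column c T ! r = T ! r ! c"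
    using takeWhile_nth[of r "\<lambda>r. c < length r" T] by (simp add: column_def f)
qed

text \<open>The second index of a letter tells the column of its box, so the multiset determines the
  content of each column; columns of an increasing tableau are sorted and hence determined by their
  content.\<close>

lemma diagonal_word_inj:
  assumes T: "tableau n T" "increasing_tableau T" and U: "tableau n U" "increasing_tableau U"
    and eq: "mset (diagonal_word T (initial T)) = mset (diagonal_word U (initial U))"
  shows "T = U"
proof -
  have srt: "sorted (column c T)" if "tableau n T" "increasing_tableau T" for c T
    unfolding sorted_iff_nth_mono_less
  proof (intro allI impI)
    fix i j assume ij: "i < j" "j < length (column c T)"
    then have "i < length (column c T)" by simp
    then have "column c T ! i = T ! i ! c" "column c T ! j = T ! j ! c"
      using tableau_columns(2)[OF that(1)] ij(2) by blast+
    moreover have "j < length T" "c < length (T ! j)"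
      using tableau_columns(1)[OF that(1)] ij(2) by blast+
    ultimately show "column c T ! i \<le> column c T ! j"
      using that(2) ij(1) unfolding increasing_tableau_def by simp
  qed
  have col: "column c T = column c U" for c
  proof -
    have "mset (column c T) = mset (column c U)"
      unfolding column_diagonal_word[symmetric] mset_map mset_filter eq ..
    then show ?thesis
      using srt[OF T, of c] srt[OF U, of c] properties_for_sort sorted_sort_id by metis
  qed
  have len: "length (column 0 T) = length T" if "tableau n T" for T
    using that by (simp add: column_def tableau_def filter_id_conv)
  show ?thesis
  proof (rule nth_equalityI)
    show "length T = length U" using len[OF T(1)] len[OF U(1)] col[of 0] by simp
    fix r assume r: "r < length T"
    have *: "c < length (T ! r) \<longleftrightarrow> c < length (U ! r)" for c
      using tableau_columns(1)[OF T(1), of r c] tableau_columns(1)[OF U(1), of r c] col[of c] r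
        \<open>length T = length U\<close> by simp
    show "T ! r = U ! r"
    proof (rule nth_equalityI)
      show "length (T ! r) = length (U ! r)" using * by (metis linorder_neqE_nat less_irrefl)
      fix c assume "c < length (T ! r)"
      then have "r < length (column c T)" using tableau_columns(1)[OF T(1)] r by blast
      then show "T ! r ! c = U ! r ! c"
        using tableau_columns(2)[OF T(1), of r c] tableau_columns(2)[OF U(1), of r c] col[of c] by simp
    qed
  qed
qed

section \<open>Linear independence\<close>

lemma minor_commute:
  assumes "\<And>i j. X i j * g = g * X i j"
  shows "minor q X is js * g = g * minor q X is js"
proof -
  have "wprod X w * g = g * wprod X w" for w
    unfolding wprod_def by (rule prod_list_commute) (auto simp: assms)
  then have "scal c * wprod X w * g = g * (scal c * wprod X w)" for c w
    by (simp add: mult.assoc scal_left_comm[of g])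
  then show ?thesis by (simp add: minor_def sum_distrib_left sum_distrib_right)
qed

lemma middle_rows_pairs:
  "list_all2 (row_pair n) T U \<Longrightarrow> K \<in> middle_rows n T \<Longrightarrow>
    list_all2 (row_pair n) T K \<and> list_all2 (row_pair n) K U"
proof (induction T U arbitrary: K rule: list_all2_induct)
  case Nil
  then show ?case by (simp add: middle_rows_Nil)
next
  case (Cons r T r' U)
  obtain k L where K: "K = k # L" "k \<in> strict_lists n (length r)" "L \<in> middle_rows n T"
    using Cons.prems by (auto simp: middle_rows_Cons)
  then show ?case
    using Cons.IH[OF K(3)] Cons.hyps by (simp add: row_pair_def strict_lists_def)
qed

lemma ev_product:
  fixes X Y :: "nat \<Rightarrow> nat \<Rightarrow> 'k::field op"
  assumes q: "q \<noteq> 0" and Y: "qmatrix n q Y" and XY: "\<And>i j k l. X i j * Y k l = Y k l * X i j"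
    and TU: "list_all2 (row_pair n) T U"
  shows "ev (\<lambda>i j. \<Sum>k\<in>{1..n}. X i k * Y k j) (poly_product q T U) =
    (\<Sum>K\<in>middle_rows n T. ev X (poly_product q T K) * ev Y (poly_product q K U))"
proof -
  let ?Z = "\<lambda>i j. \<Sum>k\<in>{1..n}. X i k * Y k j"
  have e: "ev W (poly_product q A B) = prod_list (map2 (minor q W) A B)" for A B and W :: "nat \<Rightarrow> nat \<Rightarrow> 'k op"
    unfolding poly_product_def ev_prod_list map_map
    by (rule arg_cong[of _ _ prod_list], rule map_cong) (auto simp: ev_poly_minor)
  have m: "map2 (minor q ?Z) T U =
    map2 (\<lambda>r r'. \<Sum>k\<in>strict_lists n (length r). minor q X r k * minor q Y k r') T U"
  proof (rule map_cong[OF refl], clarify)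
    fix r r' assume "(r, r') \<in> set (zip T U)"
    then have "row_pair n r r'" using TU by (auto simp: list_all2_iff)
    then have "distinct r'" "set r' \<subseteq> {1..n}" "length r = length r'"
      by (auto simp: row_pair_def strict_sorted_iff)
    then show "minor q ?Z r r' = (\<Sum>k\<in>strict_lists n (length r). minor q X r k * minor q Y k r')"
      using Cauchy_Binet[OF q Y XY] by simp
  qed
  have "minor q Y k r' * minor q X r k' = minor q X r k' * minor q Y k r'" for k r' r k'
    by (rule minor_commute, rule minor_commute[symmetric], rule XY)
  then show ?thesis
    unfolding e m by (rule product_expansion) (rule list_all2_lengthD[OF TU])
qed

lemma ev_tails: "ev (\<lambda>i j. tails N (X i j)) p = tails N (ev X p)"
proof -
  have "wprod (\<lambda>i j. tails N (X i j)) w = tails N (wprod X w)" for w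
    by (induction w) (auto simp: tails_1 tails_mult)
  then show ?thesis by (simp add: ev_def tails_sum tails_mult tails_scal)
qed

lemma scal_eq_0: "scal c = 0 \<longleftrightarrow> c = 0"
  using scal_cancel[of c 1 0] by auto

text \<open>Replacing each \<open>p i\<close> by its normal form and collecting sorted words lets
  \<open>pbw\<close> act word by word. The factors \<open>d i\<close> are operators because they
  will be the \<open>Y\<close> sides of the Cauchy-Binet terms.\<close>

lemma coefficient_vanishes:
  fixes X :: "nat \<Rightarrow> nat \<Rightarrow> 'k::field op"
  assumes X: "qmatrix n q X" and pbw: "pbw X ({1..n} \<times> {1..n}) N" and fin: "finite E"
    and nf: "\<And>i. i \<in> E \<Longrightarrow> normal_form n q (p i) (w i) (f i)"
    and w: "\<And>i. i \<in> E \<Longrightarrow> set (w i) \<subseteq> {1..n} \<times> {1..n}"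
    and sum0: "(\<Sum>i\<in>E. ev X (p i) * tails N (d i)) = 0"
  shows "(\<Sum>i\<in>E. scal (wcoeff (f i) v) * d i) = 0"
proof -
  let ?F = "\<Union>i\<in>E. words (f i)"
  let ?y = "\<lambda>v. \<Sum>i\<in>E. scal (wcoeff (f i) v) * d i"
  have F: "finite ?F" using fin by (simp add: finite_words)
  have "ev X (p i) * tails N (d i) = (\<Sum>v\<in>?F. wprod X v * tails N (scal (wcoeff (f i) v) * d i))"
    if "i \<in> E" for i
  proof -
    have "ev X (p i) = ev X (f i)"
      using nf[OF that] ev_cong[OF X] unfolding normal_form_def by blast
    also have "\<dots> = (\<Sum>v\<in>?F. scal (wcoeff (f i) v) * wprod X v)"
      by (rule ev_superset[OF F]) (use that in blast)
    finally show ?thesis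
      by (simp add: sum_distrib_right tails_mult tails_scal mult.assoc scal_left_comm[of "wprod X _"])
  qed
  then have "0 = (\<Sum>i\<in>E. \<Sum>v\<in>?F. wprod X v * tails N (scal (wcoeff (f i) v) * d i))"
    using sum0 by simp
  also have "\<dots> = (\<Sum>v\<in>?F. wprod X v * tails N (?y v))"
    by (subst sum.swap) (simp add: tails_sum sum_distrib_left)
  finally have "(\<Sum>v\<in>?F. wprod X v * tails N (?y v)) = 0" ..
  moreover have "\<forall>v\<in>?F. sorted v \<and> set v \<subseteq> {1..n} \<times> {1..n}"
  proof
    fix v assume "v \<in> ?F"
    then obtain i where "i \<in> E" "v \<in> words (f i)" by blast
    then have "v \<in> sorted_words n" using normal_form_sorted[OF nf w] by blast
    then show "sorted v \<and> set v \<subseteq> {1..n} \<times> {1..n}" by (simp add: sorted_words_def)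
  qed
  ultimately have y: "\<forall>v\<in>?F. ?y v = 0"
    using pbw[unfolded pbw_def, THEN spec[of _ ?F], THEN spec[of _ ?y]] F by blast
  show ?thesis
  proof (cases "v \<in> ?F")
    case False
    then show ?thesis by (simp add: words_iff)
  qed (use y in blast)
qed

lemma standard_row_pairs:
  assumes "(T, U) \<in> standard_bitableaux n"
  shows "list_all2 (row_pair n) T U"
proof -
  have *: "tableau n T" "tableau n U" "map length T = map length U"
    "increasing_tableau T" "increasing_tableau U"
    using assms by (auto simp: standard_bitableaux_def bitableaux_def tableau_shape_def)
  have len: "length T = length U" using *(3) map_eq_imp_length_eq by blast
  have "length (T ! i) = length (U ! i)" if "i < length T" for i
    using arg_cong[OF *(3), of "\<lambda>xs. xs ! i"] that len by simp
  then show ?thesis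
    using * len nth_mem unfolding list_all2_conv_all_nth row_pair_def tableau_def increasing_tableau_def
    by (metis (no_types, lifting))
qed

text \<open>A strictly increasing row in \<open>{1..n}\<close> has at most \<open>n\<close> entries,
  so the initial row of that length stays within range.\<close>

lemma initial_middle: "list_all2 (row_pair n) T U \<Longrightarrow> initial T \<in> middle_rows n T"
proof (induction T U rule: list_all2_induct)
  case Nil
  show ?case by (simp add: middle_rows_Nil initial_def)
next
  case (Cons r T r' U)
  have "card (set r) \<le> card {1..n}"
    using Cons.hyps by (intro card_mono) (auto simp: row_pair_def)
  then have "length r \<le> n"
    using Cons.hyps distinct_card[of r] by (simp add: row_pair_def strict_sorted_iff)
  then have "[1..<Suc (length r)] \<in> strict_lists n (length r)"
    by (auto simp: strict_lists_def simp del: upt_Suc)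
  with Cons.IH show ?case
    by (simp add: initial_def middle_rows_Cons del: upt_Suc)
qed

lemma finite_argmax:
  fixes f :: "'a \<Rightarrow> nat"
  assumes "finite C" "C \<noteq> {}"
  obtains b where "b \<in> C" "\<And>b'. b' \<in> C \<Longrightarrow> f b' \<le> f b"
proof -
  have "Max (f ` C) \<in> f ` C" using assms by (intro Max_in) auto
  then obtain b where b: "b \<in> C" "f b = Max (f ` C)" by auto
  have "f b' \<le> f b" if "b' \<in> C" for b'
    unfolding b(2) using that assms(1) by simp
  with b(1) show ?thesis by (rule that)
qed

lemma finite_argmin:
  fixes f :: "'a \<Rightarrow> nat"
  assumes "finite C" "C \<noteq> {}"
  obtains b where "b \<in> C" "\<And>b'. b' \<in> C \<Longrightarrow> f b \<le> f b'"
proof -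
  have "Min (f ` C) \<in> f ` C" using assms by (intro Min_in) auto
  then obtain b where b: "b \<in> C" "f b = Min (f ` C)" by auto
  have "f b \<le> f b'" if "b' \<in> C" for b'
    unfolding b(2) using that assms(1) by simp
  with b(1) show ?thesis by (rule that)
qed

text \<open>With the left tableau fixed to be initial, the leading words separate the right
  tableaux. For a \<open>b1\<close> of maximal leading weight, its sorted leading word cannot be a
  correction term of another product, nor the leading word of one.\<close>

lemma independent_right:
  fixes X :: "nat \<Rightarrow> nat \<Rightarrow> 'k::field op"
  assumes q: "q \<noteq> 0" and X: "qmatrix n q X" and pbw: "pbw X ({1..n} \<times> {1..n}) N"
    and fin: "finite C" "C \<noteq> {}" and C: "\<And>b. b \<in> C \<Longrightarrow> b \<in> standard_bitableaux n \<and> fst b = T0"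
    and d: "\<And>b. b \<in> C \<Longrightarrow> d b \<noteq> 0"
  shows "(\<Sum>b\<in>C. scal (d b) * ev X (poly_product q (initial T0) (snd b))) \<noteq> 0"
proof
  assume sum0: "(\<Sum>b\<in>C. scal (d b) * ev X (poly_product q (initial T0) (snd b))) = 0"
  let ?p = "\<lambda>b. poly_product q (initial T0) (snd b)"
  let ?w = "\<lambda>b. diagonal_word (initial T0) (snd b)"
  have lead: "leads n (?p b) (?w b)" if "b \<in> C" for b
  proof -
    have "list_all2 (row_pair n) T0 (snd b)"
      using C[OF that] standard_row_pairs[of T0 "snd b" n] by (metis prod.collapse)
    then show ?thesis
      using leads_product middle_rows_pairs initial_middle by blast
  qed
  have "\<exists>f. \<forall>b\<in>C. normal_form n q (?p b) (?w b) (f b)"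
    by (rule bchoice) (use normal_form_exists[OF q lead] in blast)
  then obtain f where f: "\<And>b. b \<in> C \<Longrightarrow> normal_form n q (?p b) (?w b) (f b)" by blast
  obtain b1 where b1: "b1 \<in> C" "\<And>b. b \<in> C \<Longrightarrow> wdeg (?w b) \<le> wdeg (?w b1)"
    using finite_argmax[OF fin, of "\<lambda>b. wdeg (?w b)"] by blast
  let ?v = "sort (?w b1)"
  have "(\<Sum>b\<in>C. ev X (?p b) * tails N (scal (d b))) = 0"
    using sum0 by (simp add: tails_scal scal_comm)
  from coefficient_vanishes[OF X pbw fin(1) f _ this, of ?v]
  have "0 = (\<Sum>b\<in>C. scal (wcoeff (f b) ?v) * scal (d b))"
    using lead by (auto simp: leads_def)
  also have "\<dots> = (\<Sum>b\<in>{b1}. scal (wcoeff (f b) ?v) * scal (d b))"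
  proof (rule sum.mono_neutral_right[OF fin(1)], use b1(1) in simp, intro ballI)
    fix b assume b: "b \<in> C - {b1}"
    have "wcoeff (f b) ?v = 0"
    proof (rule ccontr)
      assume nz: "wcoeff (f b) ?v \<noteq> 0"
      have "\<not> wdeg ?v < wdeg (?w b)"
        using b1(2)[of b] b wdeg_mset[of ?v "?w b1"] by simp
      then have "?v = sort (?w b)"
        using normal_form_coeff(1)[OF f nz] b by auto
      then have "mset (?w b1) = mset (?w b)" by (metis mset_sort)
      \<comment> \<open>Transposing the letters puts the right tableau first. Its own initial
        tableau is \<open>initial T0\<close>, since both tableaux have the same shape, so
        \<open>diagonal_word_inj\<close> applies.\<close>
      then have "mset (map prod.swap (?w b1)) = mset (map prod.swap (?w b))" by simp
      then have "mset (diagonal_word (snd b1) (initial T0)) = mset (diagonal_word (snd b) (initial T0))"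
        by (simp only: diagonal_word_swap)
      moreover have std: "tableau n (snd b')" "increasing_tableau (snd b')" "initial (snd b') = initial T0"
        if "b' \<in> C" for b'
      proof -
        have U: "(T0, snd b') \<in> standard_bitableaux n" using C[OF that] by (metis prod.collapse)
        then have "map length T0 = map length (snd b')"
          by (auto simp: standard_bitableaux_def bitableaux_def tableau_shape_def)
        then have "map (\<lambda>s. [1..<Suc s]) (map length T0) = map (\<lambda>s. [1..<Suc s]) (map length (snd b'))"
          by (rule arg_cong)
        then show "initial (snd b') = initial T0" by (simp add: initial_def comp_def del: upt_Suc)
        show "tableau n (snd b')" "increasing_tableau (snd b')"
          using U by (auto simp: standard_bitableaux_def bitableaux_def)
      qed
      ultimately have "snd b1 = snd b"
        using diagonal_word_inj[OF std(1,2) std(1,2), of b1 b] b b1(1) std(3)[of b] std(3)[OF b1(1)] by simp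
      then have "b1 = b" using C[of b] C[OF b1(1)] b by (auto intro: prod_eqI)
      then show False using b by simp
    qed
    then show "scal (wcoeff (f b) ?v) * scal (d b) = 0" by simp
  qed
  also have "\<dots> = scal (wcoeff (f b1) ?v * d b1)" by (simp add: scal_mult)
  finally have "wcoeff (f b1) ?v * d b1 = 0" by (metis scal_eq_0)
  then show False using d[OF b1(1)] f[OF b1(1)] by (simp add: normal_form_def)
qed

theorem standard_products_independent:
  fixes q :: "'k::field"
  assumes q: "q \<noteq> 0" and B: "finite B" "B \<subseteq> standard_bitableaux n"
    and sum0: "(\<Sum>b\<in>B. nc_const (c b) * poly_product q (fst b) (snd b)) \<in> qmat_ideal n q"
    and b: "b \<in> B"
  shows "c b = 0"
proof (rule ccontr)
  assume "c b \<noteq> 0"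
  define C where "C = {b \<in> B. c b \<noteq> 0}"
  have "b \<in> C" using b \<open>c b \<noteq> 0\<close> by (simp add: C_def)
  then have ne: "C \<noteq> {}" by blast
  have C: "finite C" "C \<subseteq> standard_bitableaux n" and cnz: "\<And>b. b \<in> C \<Longrightarrow> c b \<noteq> 0"
    using B by (auto simp: C_def)
  have pairs: "list_all2 (row_pair n) (fst b) (snd b)" if "b \<in> C" for b
    using C(2) that standard_row_pairs[of "fst b" "snd b" n] by auto
  obtain X :: "nat \<Rightarrow> nat \<Rightarrow> 'k op" and N where X: "qmatrix n q X"
    and tl: "\<And>i j y. X i j * tails N y = tails N y * X i j" and pbw: "pbw X ({1..n} \<times> {1..n}) N"
    using pbw_exists[OF q] by metis
  \<comment> \<open>The copy of \<open>X\<close> in the variables from \<open>N\<close> on; it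
    commutes with \<open>X\<close> by the choice of \<open>N\<close>.\<close>
  define Y where "Y = (\<lambda>i j. tails N (X i j))"
  have Y: "qmatrix n q Y" unfolding Y_def by (rule qmatrix_tails[OF X])
  have XY: "X i j * Y k l = Y k l * X i j" for i j k l unfolding Y_def by (rule tl)
  let ?Z = "\<lambda>i j. \<Sum>k\<in>{1..n}. X i k * Y k j"
  let ?P = "poly_product q"
  have "0 = ev ?Z (\<Sum>b\<in>B. nc_const (c b) * ?P (fst b) (snd b))"
    using ev_ideal[OF qmatrix_mult[OF q X Y XY] sum0] by simp
  also have "\<dots> = (\<Sum>b\<in>B. scal (c b) * ev ?Z (?P (fst b) (snd b)))"
    by (simp add: ev_sum ev_const)
  also have "\<dots> = (\<Sum>b\<in>C. scal (c b) * ev ?Z (?P (fst b) (snd b)))"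
    by (rule sum.mono_neutral_right[OF B(1)]) (auto simp: C_def)
  \<comment> \<open>The \<open>Y\<close> factors become coefficients under \<open>tails N\<close>,
    the form that \<open>coefficient_vanishes\<close> expects.\<close>
  also have "\<dots> = (\<Sum>b\<in>C. \<Sum>K\<in>middle_rows n (fst b).
      ev X (?P (fst b) K) * tails N (scal (c b) * ev X (?P K (snd b))))"
  proof (intro sum.cong refl)
    fix b assume "b \<in> C"
    show "scal (c b) * ev ?Z (?P (fst b) (snd b)) = (\<Sum>K\<in>middle_rows n (fst b).
      ev X (?P (fst b) K) * tails N (scal (c b) * ev X (?P K (snd b))))"
      unfolding ev_product[OF q Y XY pairs[OF \<open>b \<in> C\<close>]] sum_distrib_left
      by (intro sum.cong refl)
        (simp add: tails_mult tails_scal scal_left_comm[of "ev X _"] Y_def ev_tails)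
  qed
  finally have sum1: "(\<Sum>z\<in>(SIGMA b:C. middle_rows n (fst b)). ev X (?P (fst (fst z)) (snd z)) *
      tails N (scal (c (fst z)) * ev X (?P (snd z) (snd (fst z))))) = 0"
    using sum.Sigma[OF C(1), of "\<lambda>b. middle_rows n (fst b)" "\<lambda>b K. ev X (?P (fst b) K) *
        tails N (scal (c b) * ev X (?P K (snd b)))"] finite_middle_rows
    by (simp add: case_prod_beta)
  define E where "E = (SIGMA b:C. middle_rows n (fst b))"
  let ?w = "\<lambda>z. diagonal_word (fst (fst z)) (snd z)"
  have finE: "finite E" using C(1) by (simp add: E_def finite_middle_rows)
  have rp: "list_all2 (row_pair n) (fst (fst z)) (snd z)" if "z \<in> E" for z
    using that middle_rows_pairs[OF pairs] by (auto simp: E_def)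
  have lead: "leads n (?P (fst (fst z)) (snd z)) (?w z)" if "z \<in> E" for z
    by (rule leads_product[OF rp[OF that]])
  have "\<exists>f. \<forall>z\<in>E. normal_form n q (?P (fst (fst z)) (snd z)) (?w z) (f z)"
    by (rule bchoice) (use normal_form_exists[OF q lead] in blast)
  then obtain f where f: "\<And>z. z \<in> E \<Longrightarrow> normal_form n q (?P (fst (fst z)) (snd z)) (?w z) (f z)"
    by blast
  \<comment> \<open>Two extremal choices isolate one tableau. If the word \<open>?v\<close> below
    occurs for \<open>(b, K)\<close>, equality of column contents gives
    \<open>sum_list (concat K) = ?s b0\<close>; this is at least \<open>?s b\<close>, which is at
    least \<open>?s b0\<close> by minimality, so \<open>K\<close> is initial. Maximality of
    \<open>?g\<close> then excludes correction terms, which weigh less than their leading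
    word.\<close>
  let ?s = "\<lambda>b. sum_list (concat (initial (fst b)))"
  let ?g = "\<lambda>b. wdeg (diagonal_word (fst b) (initial (fst b)))"
  obtain bm where bm: "bm \<in> C" "\<And>b. b \<in> C \<Longrightarrow> ?s bm \<le> ?s b"
    using finite_argmin[OF C(1) ne, of ?s] by blast
  have "{b \<in> C. ?s b = ?s bm} \<noteq> {}" using bm(1) by blast
  moreover have "finite {b \<in> C. ?s b = ?s bm}" using C(1) by simp
  ultimately obtain b0 where "b0 \<in> {b \<in> C. ?s b = ?s bm}"
    and max: "\<And>b. b \<in> {b \<in> C. ?s b = ?s bm} \<Longrightarrow> ?g b \<le> ?g b0"
    using finite_argmax[of "{b \<in> C. ?s b = ?s bm}" ?g] by blast
  then have b0: "b0 \<in> C" "?s b0 = ?s bm" by auto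
  let ?v = "sort (diagonal_word (fst b0) (initial (fst b0)))"
  have lens: "list_all2 (\<lambda>r r'. length r = length r') T K" if "list_all2 (row_pair n) T K" for T K
    using that by (rule list_all2_mono) (simp add: row_pair_def)
  have tab: "tableau n (fst b)" "increasing_tableau (fst b)" if "b \<in> C" for b
    using that C(2) by (auto simp: standard_bitableaux_def bitableaux_def)
  have key: "fst b = fst b0 \<and> K = initial (fst b0)"
    if z: "(b, K) \<in> E" and nz: "wcoeff (f (b, K)) ?v \<noteq> 0" for b K
  proof -
    have bC: "b \<in> C" and K: "K \<in> middle_rows n (fst b)" using z by (auto simp: E_def)
    note nf = f[OF z, simplified]
    have "sum_list (map snd ?v) = sum_list (map snd (diagonal_word (fst b) K))"
      using normal_form_coeff(3)[OF nf nz] by (metis sum_mset_sum_list)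
    moreover have "sum_list (map snd ?v) = sum_list (map snd (diagonal_word (fst b0) (initial (fst b0))))"
      by (metis mset_map mset_sort sum_mset_sum_list)
    moreover have "list_all2 (row_pair n) (fst b0) (initial (fst b0))"
      using middle_rows_pairs[OF pairs initial_middle[OF pairs]] b0(1) by blast
    ultimately have s: "sum_list (concat K) = ?s b0"
      using diagonal_word_snd[OF lens] rp[OF z] by simp
    then have Ki: "K = initial (fst b)" and "?s b = ?s bm"
      using middle_rows_minimal[OF K] bm(2)[OF bC] b0(2) by auto
    then have "\<not> ?g b0 < ?g b" using max[of b] bC by auto
    moreover have "wdeg ?v = ?g b0" by (rule wdeg_mset) simp
    ultimately have "?v = sort (diagonal_word (fst b) (initial (fst b)))"
      using normal_form_coeff(1)[OF nf nz] Ki by auto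
    then have "mset (diagonal_word (fst b0) (initial (fst b0))) =
      mset (diagonal_word (fst b) (initial (fst b)))"
      by (metis mset_sort)
    then have "fst b0 = fst b" by (rule diagonal_word_inj[OF tab[OF b0(1)] tab[OF bC]])
    then show ?thesis using Ki by simp
  qed
  let ?C0 = "{b \<in> C. fst b = fst b0}"
  let ?i = "initial (fst b0)"
  have ne0: "?C0 \<noteq> {}" using b0(1) by blast
  have i0: "(b, ?i) \<in> E" if "b \<in> ?C0" for b
    using that initial_middle[OF pairs, of b] by (auto simp: E_def)
  have "0 = (\<Sum>z\<in>E. scal (wcoeff (f z) ?v) * (scal (c (fst z)) * ev X (?P (snd z) (snd (fst z)))))"
    by (rule coefficient_vanishes[OF X pbw finE f _ sum1[folded E_def], symmetric])
      (use lead in \<open>auto simp: leads_def\<close>)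
  also have "\<dots> = (\<Sum>z\<in>(\<lambda>b. (b, ?i)) ` ?C0. scal (wcoeff (f z) ?v) *
      (scal (c (fst z)) * ev X (?P (snd z) (snd (fst z)))))"
  proof (rule sum.mono_neutral_right[OF finE])
    show "\<forall>z\<in>E - (\<lambda>b. (b, ?i)) ` ?C0.
      scal (wcoeff (f z) ?v) * (scal (c (fst z)) * ev X (?P (snd z) (snd (fst z)))) = 0"
    proof
      fix z assume z: "z \<in> E - (\<lambda>b. (b, ?i)) ` ?C0"
      obtain b K where bK: "z = (b, K)" by (cases z)
      have "wcoeff (f (b, K)) ?v = 0"
        using key[of b K] z bK by (auto simp: E_def)
      then show "scal (wcoeff (f z) ?v) * (scal (c (fst z)) * ev X (?P (snd z) (snd (fst z)))) = 0"
        by (simp add: bK)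
    qed
  qed (use i0 in auto)
  also have "\<dots> = (\<Sum>b\<in>?C0. scal (wcoeff (f (b, ?i)) ?v * c b) * ev X (?P ?i (snd b)))"
    by (subst sum.reindex) (auto simp: inj_on_def scal_mult mult.assoc)
  \<comment> \<open>The coefficient of one word in the \<open>X\<close> variables is a relation with
    scalar coefficients between products whose left tableau is the initial one; the right tableaux
    are still to be separated.\<close>
  finally have "(\<Sum>b\<in>?C0. scal (wcoeff (f (b, ?i)) ?v * c b) * ev X (?P ?i (snd b))) = 0" ..
  moreover have "(\<Sum>b\<in>?C0. scal (wcoeff (f (b, ?i)) ?v * c b) * ev X (?P ?i (snd b))) \<noteq> 0"
  proof (rule independent_right[OF q X pbw _ ne0])
    fix b assume b: "b \<in> ?C0"
    have "wcoeff (f (b, ?i)) ?v \<noteq> 0"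
      using f[OF i0[OF b]] b by (simp add: normal_form_def)
    then show "wcoeff (f (b, ?i)) ?v * c b \<noteq> 0" using cnz b by simp
  qed (use C b0 in auto)
  ultimately show False by contradiction
qed

section \<open>Spanning\<close>

lemma vector_space_nc_poly:
  "vector_space (\<lambda>c (p :: 'k::field nc_poly). nc_const c * p)"
  by standard (auto simp: nc_const_def distrib_left distrib_right single_add mult_single
      mult.assoc[symmetric])

definition bitableau_poly :: "'k::field \<Rightarrow> nat list list \<times> nat list list \<Rightarrow> 'k nc_poly"
  where "bitableau_poly q b = poly_product q (fst b) (snd b)"

lemma leads_bitableau_poly:
  assumes "b \<in> standard_bitableaux n"
  shows "leads n (bitableau_poly q b) (diagonal_word (fst b) (snd b))"
  using leads_product standard_row_pairs assms unfolding bitableau_poly_def by (metis prod.collapse)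

lemma leads_carrier:
  fixes p :: "'a::field nc_poly"
  shows "leads n p w \<Longrightarrow> p \<in> carrier (free_alg n)"
proof (rule carrierI)
  fix v assume p: "leads n p w" "v \<in> words p"
  then have "v \<in> words (p - mon 1 w) \<union> words (mon (1::'a) w)"
    using words_add[of "p - mon 1 w" "mon 1 w"] by auto
  then have "v \<in> below n w \<or> v = w" using p(1) words_mon[of "1::'a" w] unfolding leads_def by blast
  then show "set v \<subseteq> {1..n} \<times> {1..n}" using p(1) unfolding leads_def below_def by blast
qed

lemma length_diagonal_word:
  assumes "b \<in> standard_bitableaux n"
  shows "length (diagonal_word (fst b) (snd b)) = bitableau_size b"
proof -
  have "list_all2 (row_pair n) (fst b) (snd b)"
    using assms standard_row_pairs by (metis prod.collapse)
  then have "length (diagonal_word (fst b) (snd b)) = sum_list (map length (fst b))"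
    by (induction rule: list_all2_induct) (simp_all add: diagonal_word_def row_pair_def)
  then show ?thesis by (simp add: bitableau_size_def)
qed

text \<open>Since the standard products of size \<open>d\<close> are independent and at least as many as the sorted
  words of length \<open>d\<close>, which span modulo the ideal, they span as well.\<close>

lemma standard_products_span:
  fixes q :: "'k::field"
  assumes q: "q \<noteq> 0" and p: "p \<in> carrier (free_alg n)"
  obtains B c where "finite B" "B \<subseteq> standard_bitableaux n"
    "cong n q p (\<Sum>b\<in>B. nc_const (c b) * bitableau_poly q b)"
proof -
  interpret vs: vector_space "\<lambda>c (p :: 'k nc_poly). nc_const c * p" by (rule vector_space_nc_poly)
  let ?SB = "standard_bitableaux n"
  \<comment> \<open>A subspace of the free algebra closed under congruence; it remains to find the
    sorted words in it.\<close>
  define Sp where "Sp = {p. \<exists>B c. finite B \<and> B \<subseteq> ?SB \<and>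
    cong n q p (\<Sum>b\<in>B. nc_const (c b) * bitableau_poly q b)}"
  have SpI: "p \<in> Sp" if "finite B" "B \<subseteq> ?SB"
    "cong n q p (\<Sum>b\<in>B. nc_const (c b) * bitableau_poly q b)" for p B c
    unfolding Sp_def mem_Collect_eq by (intro exI[of _ B] exI[of _ c] conjI that)
  have Sp_base: "p \<in> Sp" if "cong n q (bitableau_poly q b) p" "b \<in> ?SB" for p b
    unfolding Sp_def using that cong_sym[OF that(1)]
    by (auto intro!: exI[of _ "{b}"] exI[of _ "\<lambda>_. 1"] simp: nc_const_mon mon_Nil)
  have Sp_cong: "p \<in> Sp" if pp: "cong n q p p'" "p' \<in> Sp" for p p'
  proof -
    obtain B c where B: "finite B" "B \<subseteq> ?SB"
      "cong n q p' (\<Sum>b\<in>B. nc_const (c b) * bitableau_poly q b)"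
      using pp(2) unfolding Sp_def by blast
    have "cong n q p (\<Sum>b\<in>B. nc_const (c b) * bitableau_poly q b)"
      by (rule cong_trans[OF pp(1) B(3)])
    then show ?thesis by (rule SpI[OF B(1,2)])
  qed
  have "vs.subspace Sp"
  proof (rule vs.subspaceI)
    show "0 \<in> Sp" unfolding Sp_def by (auto intro!: exI[of _ "{}"] simp: cong_refl)
  next
    fix x y assume "x \<in> Sp" "y \<in> Sp"
    then obtain B c B' c' where B: "finite B" "B \<subseteq> ?SB" "finite B'" "B' \<subseteq> ?SB"
      "cong n q x (\<Sum>b\<in>B. nc_const (c b) * bitableau_poly q b)"
      "cong n q y (\<Sum>b\<in>B'. nc_const (c' b) * bitableau_poly q b)"
      unfolding Sp_def by blast
    let ?c = "\<lambda>b. (if b \<in> B then c b else 0) + (if b \<in> B' then c' b else 0)"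
    have "(\<Sum>b\<in>B \<union> B'. nc_const (?c b) * bitableau_poly q b) =
      (\<Sum>b\<in>B \<union> B'. nc_const (if b \<in> B then c b else 0) * bitableau_poly q b) +
      (\<Sum>b\<in>B \<union> B'. nc_const (if b \<in> B' then c' b else 0) * bitableau_poly q b)"
      by (simp only: vs.scale_left_distrib sum.distrib)
    also have "(\<Sum>b\<in>B \<union> B'. nc_const (if b \<in> B then c b else 0) * bitableau_poly q b) =
      (\<Sum>b\<in>B. nc_const (c b) * bitableau_poly q b)"
      by (rule sum.mono_neutral_cong_right) (use B in \<open>auto simp: nc_const_mon\<close>)
    also have "(\<Sum>b\<in>B \<union> B'. nc_const (if b \<in> B' then c' b else 0) * bitableau_poly q b) =
      (\<Sum>b\<in>B'. nc_const (c' b) * bitableau_poly q b)"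
      by (rule sum.mono_neutral_cong_right) (use B in \<open>auto simp: nc_const_mon\<close>)
    finally have xy: "cong n q (x + y) (\<Sum>b\<in>B \<union> B'. nc_const (?c b) * bitableau_poly q b)"
      using cong_add[OF B(5,6)] by simp
    show "x + y \<in> Sp" by (rule SpI[OF _ _ xy]) (use B(1-4) in auto)
  next
    fix c x assume "x \<in> Sp"
    then obtain B d where B: "finite B" "B \<subseteq> ?SB"
      "cong n q x (\<Sum>b\<in>B. nc_const (d b) * bitableau_poly q b)"
      unfolding Sp_def by blast
    have "nc_const c * (\<Sum>b\<in>B. nc_const (d b) * bitableau_poly q b) =
      (\<Sum>b\<in>B. nc_const (c * d b) * bitableau_poly q b)"
      by (simp add: sum_distrib_left)
    then have "cong n q (nc_const c * x) (\<Sum>b\<in>B. nc_const (c * d b) * bitableau_poly q b)"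
      using cong_const[OF B(3), of c] by simp
    then show "nc_const c * x \<in> Sp" by (rule SpI[OF B(1,2)])
  qed
  note sub = this
  let ?w = "\<lambda>b. diagonal_word (fst b) (snd b)"
  \<comment> \<open>Normal forms replace the products because they lie in the span of the sorted
    words in the free algebra itself, not merely modulo the ideal. The dimension count can therefore
    be made there.\<close>
  have "\<exists>f. \<forall>b\<in>?SB. normal_form n q (bitableau_poly q b) (?w b) (f b)"
    by (rule bchoice) (use normal_form_exists[OF q leads_bitableau_poly] in blast)
  then obtain f where f: "\<And>b. b \<in> ?SB \<Longrightarrow> normal_form n q (bitableau_poly q b) (?w b) (f b)"
    by blast
  have indep: "\<forall>b\<in>B. c b = 0"
    if B: "finite B" "B \<subseteq> ?SB" and s0: "(\<Sum>b\<in>B. nc_const (c b) * f b) = 0" for B c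
  proof -
    have "cong n q (\<Sum>b\<in>B. nc_const (c b) * bitableau_poly q b) (\<Sum>b\<in>B. nc_const (c b) * f b)"
      by (intro cong_sum cong_const) (use f B in \<open>auto simp: normal_form_def\<close>)
    then have "(\<Sum>b\<in>B. nc_const (c b) * poly_product q (fst b) (snd b)) \<in> qmat_ideal n q"
      by (simp add: s0 cong_def bitableau_poly_def)
    then show ?thesis using standard_products_independent[OF q B] by blast
  qed
  have inj: "inj_on f ?SB"
  proof (rule inj_onI, rule ccontr)
    fix b b' assume b: "b \<in> ?SB" "b' \<in> ?SB" "f b = f b'" "b \<noteq> b'"
    \<comment> \<open>Coefficients 1 and -1 turn a coincidence of two normal forms into a nontrivial
      relation.\<close>
    have "(\<Sum>x\<in>{b, b'}. nc_const (if x = b then 1 else - 1 :: 'k) * f x) = 0"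
      using b by (simp add: vs.scale_minus_left)
    from indep[OF _ _ this] b show False by auto
  qed
  have sorted_in: "mon 1 w \<in> Sp" if w: "w \<in> sorted_words n" for w
  proof -
    \<comment> \<open>Normal forms keep the length of words, so the comparison takes place in one
      degree at a time, where both families are finite.\<close>
    define d where "d = length w"
    let ?S = "{b \<in> ?SB. bitableau_size b = d}" and ?W = "{w \<in> sorted_words n. length w = d}"
    let ?t = "mon (1::'k) ` ?W"
    have ind: "vs.independent (f ` ?S)"
    proof
      assume "vs.dependent (f ` ?S)"
      then obtain t u where t: "finite t" "t \<subseteq> f ` ?S" "(\<Sum>v\<in>t. nc_const (u v) * v) = 0"
        and v: "\<exists>v\<in>t. u v \<noteq> 0"
        unfolding vs.dependent_explicit by blast
      obtain B where B: "B \<subseteq> ?S" "finite B" "t = f ` B"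
        using finite_subset_image[OF t(1,2)] by blast
      have "inj_on f B" by (rule inj_on_subset[OF inj]) (use B in auto)
      then have "(\<Sum>b\<in>B. nc_const (u (f b)) * f b) = 0"
        using t(3) unfolding B(3) by (simp add: sum.reindex)
      from indep[OF B(2) _ this] have "\<forall>b\<in>B. u (f b) = 0" using B(1) by blast
      then show False using v B(3) by blast
    qed
    have span: "f ` ?S \<subseteq> vs.span ?t"
    proof
      fix g assume "g \<in> f ` ?S"
      then obtain b where b: "b \<in> ?SB" "bitableau_size b = d" "g = f b" by blast
      have "v \<in> ?W" if "v \<in> words g" for v
      proof -
        have "wcoeff (f b) v \<noteq> 0" using that b(3) by (simp add: words_iff)
        from normal_form_coeff(2)[OF f[OF b(1)] this] have "length v = length (?w b)"
          by (metis size_mset length_map)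
        moreover have "set (?w b) \<subseteq> {1..n} \<times> {1..n}"
          using leads_bitableau_poly[OF b(1)] unfolding leads_def by blast
        then have "v \<in> sorted_words n"
          using normal_form_sorted[OF f[OF b(1)]] that b(3) by blast
        ultimately show ?thesis using length_diagonal_word[OF b(1)] b(2) by simp
      qed
      then have "(\<Sum>v\<in>words g. nc_const (wcoeff g v) * mon 1 v) \<in> vs.span ?t"
        by (intro vs.span_sum vs.span_scale vs.span_base) blast
      then show "g \<in> vs.span ?t"
        using poly_decompose'[of g] by (simp add: nc_const_mon mon_mult)
    qed
    have fint: "finite ?t" using finite_sorted_words by blast
    have "card ?t \<le> card ?W" by (rule card_image_le[OF finite_sorted_words])
    also have "\<dots> \<le> card ?S" by (rule card_sorted_words_le)
    also have "card ?S = card (f ` ?S)"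
      by (rule card_image[symmetric]) (rule inj_on_subset[OF inj], blast)
    finally have card: "card ?t \<le> card (f ` ?S)" .
    have "mon 1 w \<in> vs.span (f ` ?S)"
    proof (rule ccontr)
      \<comment> \<open>A sorted word outside the span would enlarge an independent family that
        already has at least as many members as the spanning set \<open>?t\<close>.\<close>
      assume no: "mon 1 w \<notin> vs.span (f ` ?S)"
      then have "vs.independent (insert (mon 1 w) (f ` ?S))"
        using ind by (simp add: vs.independent_insert)
      moreover have "insert (mon 1 w) (f ` ?S) \<subseteq> vs.span ?t"
        using span vs.span_base[of "mon 1 w" ?t] w by (auto simp: d_def)
      ultimately have "card (insert (mon 1 w) (f ` ?S)) \<le> card ?t"
        using vs.independent_span_bound[OF fint] by blast
      moreover have "mon 1 w \<notin> f ` ?S" using no vs.span_superset[of "f ` ?S"] by auto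
      moreover have "finite (f ` ?S)" by (rule finite_imageI[OF finite_standard_bitableaux])
      ultimately show False using card by simp
    qed
    moreover have "f ` ?S \<subseteq> Sp"
    proof
      fix g assume "g \<in> f ` ?S"
      then obtain b where b: "b \<in> ?SB" "g = f b" by blast
      then show "g \<in> Sp" using f[OF b(1)] Sp_base[OF _ b(1)] by (simp add: normal_form_def)
    qed
    ultimately show ?thesis using vs.span_minimal[OF _ sub] by blast
  qed
  have poly_in: "p \<in> Sp" if "words p \<subseteq> sorted_words n" for p
  proof -
    have "(\<Sum>v\<in>words p. nc_const (wcoeff p v) * mon 1 v) \<in> Sp"
      by (intro vs.subspace_sum[OF sub] vs.subspace_scale[OF sub] sorted_in) (use that in blast)
    then show ?thesis using poly_decompose'[of p] by (simp add: nc_const_mon mon_mult)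
  qed
  have "\<exists>p'. words p' \<subseteq> sorted_words n \<and> cong n q p p'"
  proof (rule cong_words)
    fix w assume "w \<in> words p"
    then have w: "set w \<subseteq> {1..n} \<times> {1..n}" using p by (auto simp: carrier_free_alg)
    obtain u r where r: "words r \<subseteq> {v \<in> below n w. sorted v}"
      "cong n q (mon 1 w) (mon u (sort w) + r)"
      using reorder[OF q w] by blast
    have "words (mon u (sort w) + r) \<subseteq> sorted_words n"
      using words_add[of "mon u (sort w)" r] words_mon[of u "sort w"] r(1) w
      by (fastforce simp: sorted_words_def below_def)
    with r(2) show "\<exists>p'. words p' \<subseteq> sorted_words n \<and> cong n q (mon 1 w) p'" by blast
  qed
  then have "p \<in> Sp" using poly_in Sp_cong by blast
  then show ?thesis using that unfolding Sp_def by blast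
qed

section \<open>Standard products in the quotient\<close>

lemma qmat_proj_eq_iff:
  assumes "p \<in> carrier (free_alg n)" "p' \<in> carrier (free_alg n)"
  shows "qmat_proj n q p = qmat_proj n q p' \<longleftrightarrow> cong n q p p'"
proof -
  interpret F: ring "free_alg n :: 'a nc_poly ring" by (rule free_alg_ring)
  have "p' \<ominus>\<^bsub>free_alg n\<^esub> p' = 0" "\<ominus>\<^bsub>free_alg n\<^esub> p' = - p'"
  proof -
    show "p' \<ominus>\<^bsub>free_alg n\<^esub> p' = 0"
      using F.r_neg[OF assms(2)] by (simp add: a_minus_def free_alg_simps)
    have "- p' \<in> carrier (free_alg n)"
      using nc_minus_carrier[OF F.zero_closed assms(2)] by (simp add: free_alg_simps)
    then show "\<ominus>\<^bsub>free_alg n\<^esub> p' = - p'"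
      using F.minus_equality[of "- p'" p'] assms(2) by (simp add: free_alg_simps)
  qed
  then have "p \<ominus>\<^bsub>free_alg n\<^esub> p' = p - p'"
    by (simp add: a_minus_def free_alg_simps)
  then show ?thesis
    using F.quotient_eq_iff_same_a_r_cos[OF qmat_ideal assms] by (simp add: qmat_proj_def cong_def)
qed

lemma qmat_proj_zero: "qmat_proj n q 0 = \<zero>\<^bsub>qmat n q\<^esub>"
proof -
  interpret F: ring "free_alg n :: 'a nc_poly ring" by (rule free_alg_ring)
  have "qmat_proj n q 0 = qmat_ideal n q"
    using F.a_coset_add_zero[OF ideal.axioms(1)[OF qmat_ideal[of n q], THEN additive_subgroup.a_subset]]
    by (simp add: qmat_proj_def free_alg_simps)
  then show ?thesis by (simp add: qmat_simps FactRing_def)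
qed

lemma qmat_proj_smult:
  "p \<in> carrier (free_alg n) \<Longrightarrow> c \<odot>\<^bsub>qmat n q\<^esub> qmat_proj n q p = qmat_proj n q (nc_const c * p)"
  by (simp add: qmat_simps(6) qmat_proj_hom(1))

lemma qmat_proj_sum:
  assumes "finite A" "\<And>a. a \<in> A \<Longrightarrow> f a \<in> carrier (free_alg n)"
  shows "(\<Oplus>\<^bsub>qmat n q\<^esub>a\<in>A. qmat_proj n q (f a)) = qmat_proj n q (sum f A)"
proof -
  interpret Q: ring "qmat n q" by (rule qmat_ring)
  show ?thesis
    using assms
  proof (induction A rule: finite_induct)
    case (insert a A)
    have "(\<Oplus>\<^bsub>qmat n q\<^esub>x\<in>insert a A. qmat_proj n q (f x)) =
      qmat_proj n q (f a) \<oplus>\<^bsub>qmat n q\<^esub> (\<Oplus>\<^bsub>qmat n q\<^esub>x\<in>A. qmat_proj n q (f x))"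
      using insert by (intro Q.finsum_insert) (auto intro: qmat_proj_carrier)
    also have "\<dots> = qmat_proj n q (f a + sum f A)"
      using insert by (simp add: qmat_proj_hom(2) free_alg_sum)
    finally show ?case using insert by simp
  qed (simp add: qmat_proj_zero)
qed

lemma qmat_proj_prod_list:
  "set ps \<subseteq> carrier (free_alg n) \<Longrightarrow>
    prod_list ps \<in> carrier (free_alg n) \<and>
    qmat_prod_list n q (map (qmat_proj n q) ps) = qmat_proj n q (prod_list ps)"
proof (induction ps)
  case Nil
  have "1 \<in> carrier (free_alg n :: 'a nc_poly ring)"
    using mon_carrier[of "[]" n 1] by (simp add: mon_Nil)
  then show ?case by (simp add: qmat_prod_list_def qmat_proj_one)
next
  case (Cons p ps)
  then show ?case by (simp add: qmat_prod_list_def qmat_proj_hom(1) nc_mult_carrier)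
qed

section \<open>Quantum minors as sums over arrangements\<close>

lemma inversions_card:
  "inversions ks = card {(a, b). a < b \<and> b < length ks \<and> ks ! b < ks ! a}"
proof (induction ks)
  case (Cons x ks)
  let ?A = "(\<lambda>b. (0::nat, Suc b)) ` {b. b < length ks \<and> ks ! b < x}"
  let ?B = "(\<lambda>(a, b). (Suc a, Suc b)) ` {(a, b). a < b \<and> b < length ks \<and> ks ! b < ks ! a}"
  have "{(a, b). a < b \<and> b < length (x # ks) \<and> (x # ks) ! b < (x # ks) ! a} = ?A \<union> ?B"
  proof (intro equalityI subsetI)
    fix z assume "z \<in> {(a, b). a < b \<and> b < length (x # ks) \<and> (x # ks) ! b < (x # ks) ! a}"
    then obtain a b where z: "z = (a, Suc b)" "a < Suc b" "b < length ks" "ks ! b < (x # ks) ! a"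
      by (cases z) (auto simp: less_Suc_eq_0_disj gr0_conv_Suc)
    then show "z \<in> ?A \<union> ?B" by (cases a) (auto simp: image_iff)
  qed auto
  moreover have "finite ?B"
    by (rule finite_imageI, rule finite_subset[of _ "{..<length ks} \<times> {..<length ks}"]) auto
  moreover have "?A \<inter> ?B = {}" by auto
  ultimately have "card {(a, b). a < b \<and> b < length (x # ks) \<and> (x # ks) ! b < (x # ks) ! a} =
    card ?A + card ?B"
    by (simp add: card_Un_disjoint)
  also have "card ?A = length (filter (\<lambda>y. y < x) ks)"
    by (subst card_image) (auto simp: inj_on_def length_filter_conv_card)
  also have "card ?B = inversions ks"
    unfolding Cons.IH by (rule card_image) (auto simp: inj_on_def)
  finally show ?case by simp
qed simp

text \<open>Permutations correspond to arrangements through \<open>permute_list\<close>, bijectively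
  because \<open>r'\<close> has distinct entries; inversions agree because \<open>r'\<close> is
  increasing.\<close>

lemma sum_permutations:
  assumes r': "sorted_wrt (<) r'" and len: "length r = length r'"
  shows "(\<Sum>\<sigma> | \<sigma> permutes {..<length r}. mon ((- q) ^ perm_length (length r) \<sigma>)
      (map (\<lambda>a. (r ! a, r' ! \<sigma> a)) [0..<length r])) = poly_minor q r r'"
proof -
  let ?P = "{\<sigma>. \<sigma> permutes {..<length r'}}"
  let ?h = "\<lambda>\<sigma>. permute_list \<sigma> r'"
  have d: "distinct r'" using r' by (simp add: strict_sorted_iff)
  have lt: "\<sigma> a < length r'" if "\<sigma> \<in> ?P" "a < length r'" for \<sigma> a
    using that permutes_in_image[of \<sigma> "{..<length r'}" a] by simp
  have nth: "?h \<sigma> ! a = r' ! \<sigma> a" if "a < length r'" for \<sigma> a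
    using that by (simp add: permute_list_def)
  have "bij_betw ?h ?P (arrangements r')"
  proof (rule bij_betw_imageI)
    show "inj_on ?h ?P"
    proof (rule inj_onI, rule ext)
      fix \<sigma> \<tau> a assume *: "\<sigma> \<in> ?P" "\<tau> \<in> ?P" "?h \<sigma> = ?h \<tau>"
      show "\<sigma> a = \<tau> a"
      proof (cases "a < length r'")
        case True
        then have "r' ! \<sigma> a = r' ! \<tau> a" using nth *(3) by metis
        then show ?thesis using d lt[OF *(1) True] lt[OF *(2) True] by (simp add: nth_eq_iff_index_eq)
      next
        case False
        then show ?thesis using * by (simp add: permutes_def)
      qed
    qed
    show "?h ` ?P = arrangements r'"
    proof (intro equalityI subsetI)
      fix ks assume "ks \<in> ?h ` ?P"
      then show "ks \<in> arrangements r'" by (auto simp: arrangements_def)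
    next
      fix ks assume "ks \<in> arrangements r'"
      then have "mset ks = mset r'" by (simp add: arrangements_def)
      then obtain \<sigma> where "\<sigma> permutes {..<length r'}" "permute_list \<sigma> r' = ks"
        by (rule mset_eq_permutation)
      then show "ks \<in> ?h ` ?P" by blast
    qed
  qed
  then have "poly_minor q r r' = (\<Sum>\<sigma>\<in>?P. mon ((- q) ^ inversions (?h \<sigma>)) (zip r (?h \<sigma>)))"
    unfolding poly_minor_def by (rule sum.reindex_bij_betw[symmetric])
  also have "\<dots> = (\<Sum>\<sigma>\<in>?P. mon ((- q) ^ perm_length (length r) \<sigma>)
      (map (\<lambda>a. (r ! a, r' ! \<sigma> a)) [0..<length r]))"
  proof (intro sum.cong refl)
    fix \<sigma> assume \<sigma>: "\<sigma> \<in> ?P"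
    have "r' ! \<sigma> b < r' ! \<sigma> a \<longleftrightarrow> \<sigma> b < \<sigma> a" if "a < length r'" "b < length r'" for a b
      using lt[OF \<sigma> that(1)] lt[OF \<sigma> that(2)] sorted_wrt_nth_less[OF r', of "\<sigma> b" "\<sigma> a"]
        sorted_wrt_nth_less[OF r', of "\<sigma> a" "\<sigma> b"] by (cases "\<sigma> a" "\<sigma> b" rule: linorder_cases) auto
    then have "{(a, b). a < b \<and> b < length (?h \<sigma>) \<and> ?h \<sigma> ! b < ?h \<sigma> ! a} =
      {(a, b). a < b \<and> b < length r' \<and> \<sigma> b < \<sigma> a}"
      by (auto simp: nth)
    then have "inversions (?h \<sigma>) = perm_length (length r) \<sigma>"
      by (simp add: inversions_card perm_length_def len)
    moreover have "zip r (?h \<sigma>) = map (\<lambda>a. (r ! a, r' ! \<sigma> a)) [0..<length r]"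
      by (rule nth_equalityI) (simp_all add: len nth)
    ultimately show "mon ((- q) ^ inversions (?h \<sigma>)) (zip r (?h \<sigma>)) =
      mon ((- q) ^ perm_length (length r) \<sigma>) (map (\<lambda>a. (r ! a, r' ! \<sigma> a)) [0..<length r])"
      by simp
  qed
  finally show ?thesis by (simp add: len)
qed

lemma prod_list_nc_var:
  "prod_list (map (\<lambda>a. nc_var (f a) (g a)) xs) = mon 1 (map (\<lambda>a. (f a, g a)) xs)"
  by (induction xs) (simp_all add: mon_Nil nc_var_mon mon_mult)

lemma quantum_minor_proj:
  assumes "row_pair n r r'"
  shows "quantum_minor n q (set r) (set r') = qmat_proj n q (poly_minor q r r')"
proof -
  let ?s = "length r"
  have r: "sorted_wrt (<) r" "sorted_wrt (<) r'" "length r = length r'"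
    "set r \<subseteq> {1..n}" "set r' \<subseteq> {1..n}"
    using assms by (auto simp: row_pair_def)
  have sl: "sorted_list_of_set (set r) = r" "sorted_list_of_set (set r') = r'" "card (set r) = ?s"
    using r(1,2) by (simp_all add: strict_sorted_iff sorted_list_of_set.idem_if_sorted_distinct distinct_card)
  have summand: "(- q) ^ perm_length ?s \<sigma> \<odot>\<^bsub>qmat n q\<^esub>
      qmat_prod_list n q (map (\<lambda>a. qmat_gen n q (r ! a) (r' ! \<sigma> a)) [0..<?s]) =
    qmat_proj n q (mon ((- q) ^ perm_length ?s \<sigma>) (map (\<lambda>a. (r ! a, r' ! \<sigma> a)) [0..<?s]))"
    and car: "mon ((- q) ^ perm_length ?s \<sigma>) (map (\<lambda>a. (r ! a, r' ! \<sigma> a)) [0..<?s]) \<in> carrier (free_alg n)"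
    if \<sigma>: "\<sigma> permutes {..<?s}" for \<sigma>
  proof -
    have rng: "r ! a \<in> {1..n}" "r' ! \<sigma> a \<in> {1..n}" if "a < ?s" for a
    proof -
      have "r ! a \<in> set r" "r' ! \<sigma> a \<in> set r'"
        using that r(3) permutes_in_image[OF \<sigma>, of a] by simp_all
      then show "r ! a \<in> {1..n}" "r' ! \<sigma> a \<in> {1..n}" using r(4,5) by blast+
    qed
    have w: "set (map (\<lambda>a. (r ! a, r' ! \<sigma> a)) [0..<?s]) \<subseteq> {1..n} \<times> {1..n}"
      using rng by auto
    then show "mon ((- q) ^ perm_length ?s \<sigma>) (map (\<lambda>a. (r ! a, r' ! \<sigma> a)) [0..<?s]) \<in> carrier (free_alg n)"
      by (rule mon_carrier)
    have "set (map (\<lambda>a. nc_var (r ! a) (r' ! \<sigma> a) :: 'a nc_poly) [0..<?s]) \<subseteq> carrier (free_alg n)"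
      using rng by (auto intro!: nc_var_carrier)
    from qmat_proj_prod_list[OF this, of q]
    have "qmat_prod_list n q (map (\<lambda>a. qmat_gen n q (r ! a) (r' ! \<sigma> a)) [0..<?s]) =
      qmat_proj n q (mon 1 (map (\<lambda>a. (r ! a, r' ! \<sigma> a)) [0..<?s]))"
      by (simp add: comp_def qmat_gen_def prod_list_nc_var)
    then show "(- q) ^ perm_length ?s \<sigma> \<odot>\<^bsub>qmat n q\<^esub>
        qmat_prod_list n q (map (\<lambda>a. qmat_gen n q (r ! a) (r' ! \<sigma> a)) [0..<?s]) =
      qmat_proj n q (mon ((- q) ^ perm_length ?s \<sigma>) (map (\<lambda>a. (r ! a, r' ! \<sigma> a)) [0..<?s]))"
      using mon_carrier[OF w, of "1::'a"] by (simp add: qmat_proj_smult nc_const_mon mon_mult)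
  qed
  interpret Q: ring "qmat n q" by (rule qmat_ring)
  have "quantum_minor n q (set r) (set r') = (\<Oplus>\<^bsub>qmat n q\<^esub>\<sigma>\<in>{\<sigma>. \<sigma> permutes {..<?s}}.
      qmat_proj n q (mon ((- q) ^ perm_length ?s \<sigma>) (map (\<lambda>a. (r ! a, r' ! \<sigma> a)) [0..<?s])))"
    unfolding quantum_minor_def sl
    by (rule Q.finsum_cong') (use summand car in \<open>auto intro!: qmat_proj_carrier\<close>)
  also have "\<dots> = qmat_proj n q (poly_minor q r r')"
    using car by (subst qmat_proj_sum) (simp_all add: finite_permutations sum_permutations[OF r(2,3)])
  finally show ?thesis .
qed

lemma bitableau_product_proj:
  assumes "b \<in> standard_bitableaux n"
  shows "bitableau_product n q b = qmat_proj n q (bitableau_poly q b)"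
proof -
  obtain T U where b: "b = (T, U)" by (cases b)
  have TU: "list_all2 (row_pair n) T U" using assms standard_row_pairs b by blast
  have rp: "row_pair n r r'" if "(r, r') \<in> set (zip T U)" for r r'
    using TU that by (auto simp: list_all2_iff)
  have "poly_minor q r r' \<in> carrier (free_alg n)" if "(r, r') \<in> set (zip T U)" for r r'
    by (rule leads_carrier[OF leads_minor]) (use rp[OF that] in \<open>auto simp: row_pair_def\<close>)
  then have c: "set (map2 (poly_minor q) T U) \<subseteq> carrier (free_alg n)" by auto
  have m: "map2 (\<lambda>r r'. quantum_minor n q (set r) (set r')) T U =
    map (qmat_proj n q) (map2 (poly_minor q) T U)"
    unfolding map_map by (rule map_cong[OF refl]) (auto simp: quantum_minor_proj rp)
  show ?thesis
    unfolding b bitableau_product_def bitableau_poly_def poly_product_def prod.case m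
    using qmat_proj_prod_list[OF c, of q] by simp
qed

text \<open>\<open>basis\<close> speaks of a set of vectors; injectivity adds that distinct
  bitableaux give distinct products, so that the indexed family is a basis.\<close>

theorem theorem5p8:
  fixes n :: nat and q :: "'k::field"
  assumes "n \<ge> 1" and "q \<noteq> 0"
  shows "inj_on (bitableau_product n q) (standard_bitableaux n) \<and>
    vectorspace.basis class_ring (qmat n q) (bitableau_product n q ` standard_bitableaux n)"
proof -
  let ?SB = "standard_bitableaux n" and ?P = "bitableau_product n q"
  interpret V: vectorspace "class_ring :: 'k ring" "qmat n q" by (rule qmat_vectorspace)
  have car: "bitableau_poly q b \<in> carrier (free_alg n)" if "b \<in> ?SB" for b
    by (rule leads_carrier[OF leads_bitableau_poly[OF that]])
  have car_sum: "(\<Sum>b\<in>B. nc_const (c b) * bitableau_poly q b) \<in> carrier (free_alg n)"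
    if "B \<subseteq> ?SB" for B and c :: "_ \<Rightarrow> 'k"
    using that car by (intro free_alg_sum nc_mult_carrier) auto
  have zero: "0 \<in> carrier (free_alg n :: 'k nc_poly ring)" by (simp add: carrier_free_alg)
  have indep: "c b = 0"
    if "finite B" "B \<subseteq> ?SB" "qmat_proj n q (\<Sum>b\<in>B. nc_const (c b) * bitableau_poly q b) = \<zero>\<^bsub>qmat n q\<^esub>"
      "b \<in> B" for B c b
    using that standard_products_independent[OF assms(2) that(1,2) _ that(4), of c]
      qmat_proj_eq_iff[OF car_sum[OF that(2), of c] zero, of q]
    by (simp add: qmat_proj_zero cong_def bitableau_poly_def)
  have inj: "inj_on ?P ?SB"
  proof (rule inj_onI, rule ccontr)
    fix b b' assume b: "b \<in> ?SB" "b' \<in> ?SB" "?P b = ?P b'" "b \<noteq> b'"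
    let ?c = "\<lambda>x. if x = b then 1 else - 1 :: 'k"
    have "cong n q (bitableau_poly q b) (bitableau_poly q b')"
      using b qmat_proj_eq_iff[OF car car, of b b' q] by (simp add: bitableau_product_proj)
    then have "(\<Sum>x\<in>{b, b'}. nc_const (?c x) * bitableau_poly q x) \<in> qmat_ideal n q"
      using b(4) by (simp add: cong_def nc_const_def single_uminus)
    then have "qmat_proj n q (\<Sum>x\<in>{b, b'}. nc_const (?c x) * bitableau_poly q x) = \<zero>\<^bsub>qmat n q\<^esub>"
      using qmat_proj_eq_iff[OF car_sum[of "{b, b'}" ?c] zero, of q] b
      by (simp add: qmat_proj_zero cong_def)
    from indep[OF _ _ this, of b] b show False by simp
  qed
  have lincomb: "V.lincomb a (?P ` B) = qmat_proj n q (\<Sum>b\<in>B. nc_const (a (?P b)) * bitableau_poly q b)"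
    if B: "finite B" "B \<subseteq> ?SB" for a B
  proof -
    have "V.lincomb a (?P ` B) = (\<Oplus>\<^bsub>qmat n q\<^esub>b\<in>B. a (?P b) \<odot>\<^bsub>qmat n q\<^esub> ?P b)"
      unfolding V.lincomb_def
      by (rule V.finsum_reindex)
        (use B inj_on_subset[OF inj B(2)] car in \<open>auto simp: bitableau_product_proj subset_iff
          intro!: V.smult_closed qmat_proj_carrier\<close>)
    also have "\<dots> = (\<Oplus>\<^bsub>qmat n q\<^esub>b\<in>B. qmat_proj n q (nc_const (a (?P b)) * bitableau_poly q b))"
    proof (rule V.finsum_cong')
      show "(\<lambda>b. qmat_proj n q (nc_const (a (?P b)) * bitableau_poly q b)) \<in> B \<rightarrow> carrier (qmat n q)"
        using B car by (auto intro!: qmat_proj_carrier nc_mult_carrier)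
      fix b assume "b \<in> B"
      then have "b \<in> ?SB" using B by blast
      then show "a (?P b) \<odot>\<^bsub>qmat n q\<^esub> ?P b = qmat_proj n q (nc_const (a (?P b)) * bitableau_poly q b)"
        by (simp add: bitableau_product_proj qmat_proj_smult car)
    qed simp
    also have "\<dots> = qmat_proj n q (\<Sum>b\<in>B. nc_const (a (?P b)) * bitableau_poly q b)"
      by (rule qmat_proj_sum) (use B car in \<open>auto intro!: nc_mult_carrier\<close>)
    finally show ?thesis .
  qed
  have sub: "?P ` ?SB \<subseteq> carrier (qmat n q)"
    using car by (auto simp: bitableau_product_proj intro!: qmat_proj_carrier)
  have "V.lin_indpt (?P ` ?SB)"
  proof
    assume "V.lin_dep (?P ` ?SB)"
    then obtain A a v where A: "finite A" "A \<subseteq> ?P ` ?SB" "V.lincomb a A = \<zero>\<^bsub>qmat n q\<^esub>"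
      "v \<in> A" "a v \<noteq> 0"
      unfolding V.lin_dep_def by auto
    obtain B where B: "B \<subseteq> ?SB" "finite B" "A = ?P ` B"
      using finite_subset_image[OF A(1,2)] by blast
    have "qmat_proj n q (\<Sum>b\<in>B. nc_const (a (?P b)) * bitableau_poly q b) = \<zero>\<^bsub>qmat n q\<^esub>"
      using lincomb[OF B(2,1), of a] A(3) B(3) by metis
    moreover obtain b where "b \<in> B" "v = ?P b" using A(4) B(3) by blast
    ultimately show False using indep[OF B(2,1), of "\<lambda>b. a (?P b)"] A(5) by blast
  qed
  moreover have "V.span (?P ` ?SB) = carrier (qmat n q)"
  proof
    show "V.span (?P ` ?SB) \<subseteq> carrier (qmat n q)" by (rule V.span_is_subset2[OF sub])
    show "carrier (qmat n q) \<subseteq> V.span (?P ` ?SB)"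
    proof
      fix x assume "x \<in> carrier (qmat n q)"
      then obtain p where p: "p \<in> carrier (free_alg n)" "x = qmat_proj n q p"
        by (rule qmat_proj_surj)
      obtain B c where B: "finite B" "B \<subseteq> ?SB"
        "cong n q p (\<Sum>b\<in>B. nc_const (c b) * bitableau_poly q b)"
        using standard_products_span[OF assms(2) p(1)] by blast
      \<comment> \<open>\<open>lincomb\<close> attaches coefficients to vectors, so the coefficients
        given on bitableaux are carried over along the inverse of the injection
        \<open>?P\<close>.\<close>
      define a where "a = (\<lambda>v. c (the_inv_into ?SB ?P v))"
      have "a (?P b) = c b" if "b \<in> B" for b
        unfolding a_def the_inv_into_f_f[OF inj subsetD[OF B(2) that]] ..
      then have "x = V.lincomb a (?P ` B)"
        using lincomb[OF B(1,2), of a] qmat_proj_eq_iff[OF p(1) car_sum[OF B(2), of c], of q] B(3) p(2)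
        by simp
      then show "x \<in> V.span (?P ` ?SB)"
        unfolding V.span_def using B(1,2) by auto
    qed
  qed
  ultimately show ?thesis
    using inj sub unfolding V.basis_def by blast
qed

end
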